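(* Let $\theta,\rho\in\mathbb{R}$ with $|\theta|<1$, $|\rho|<1$, let $(V_n)_{n\ge1}$ be a sequence of independent and identically distributed real random variables with zero mean, variance $\sigma^2>0$ and finite moment of order $4$, let the initial values $X_0,\varepsilon_0$ be arbitrary, and for all $n\ge1$ let $X_n=\theta X_{n-1}+\varepsilon_n$ and $\varepsilon_n=\rho\varepsilon_{n-1}+V_n$. Let $\widehat\theta_n$, $\widehat\rho_n$ be the estimators defined in the context, and set $$\theta^*=\frac{\theta+\rho}{1+\theta\rho},\qquad \rho^*=\frac{\theta\rho(\theta+\rho)}{1+\theta\rho},\qquad \sigma_\theta^2=\frac{(1-\theta^2)(1-\theta\rho)(1-\rho^2)}{(1+\theta\rho)^3},$$ $$\sigma_\rho^2=\frac{1-\theta\rho}{(1+\theta\rho)^3}\Big((\theta+\rho)^2(1+\theta\rho)^2+(\theta\rho)^2(1-\theta^2)(1-\rho^2)\Big),\qquad \Gamma=\begin{pmatrix}\sigma_\theta^2&\theta\rho\,\sigma_\theta^2\\ \theta\rho\,\sigma_\theta^2&\sigma_\rho^2\end{pmatrix}.$$ Then, as $n\to\infty$, $$\sqrt{n}\begin{pmatrix}\widehat{\theta}_n-\theta^*\\ \widehat{\rho}_n-\rho^*\end{pmatrix}\longrightarrow\mathcal{N}(0,\Gamma)\quad\text{in distribution}.$$ In particular, $\sqrt{n}\,(\widehat{\rho}_n-\rho^* )\longrightarrow\mathcal{N}(0,\sigma_\rho^2)$ in distribution.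
   Context: For $n\ge1$ put $$\widehat{\theta}_n=\frac{\sum_{k=1}^n X_kX_{k-1}}{\sum_{k=1}^n X_{k-1}^2}.$$ At step $n$, the least squares residuals are $\widehat{\varepsilon}_0=X_0$ and $\widehat{\varepsilon}_k=X_k-\widehat{\theta}_nX_{k-1}$ for $1\le k\le n$ (they depend on $n$ through $\widehat\theta_n$). The serial correlation estimator is $$\widehat{\rho}_n=\frac{\sum_{k=1}^n\widehat{\varepsilon}_k\widehat{\varepsilon}_{k-1}}{\sum_{k=1}^n\widehat{\varepsilon}_{k-1}^{\,2}}.$$ Convention: a quotient defining an estimator is read as $0$ if its denominator vanishes. $\mathcal{N}(0,\Gamma)$ denotes the centered (possibly degenerate) Gaussian law with positive semi-definite covariance matrix $\Gamma$. *)

theory Defs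
  imports "HOL-Probability.Probability"
begin

(* The estimators are functions of the observed trajectory x 0, ..., x n.  Since y / 0 = 0
   in HOL, a quotient whose denominator vanishes is 0. *)

definition theta_hat :: "(nat \<Rightarrow> real) \<Rightarrow> nat \<Rightarrow> real" where
  "theta_hat x n = (\<Sum>k=1..n. x k * x (k - 1)) / (\<Sum>k=1..n. (x (k - 1))\<^sup>2)"

definition residual :: "(nat \<Rightarrow> real) \<Rightarrow> nat \<Rightarrow> nat \<Rightarrow> real" where
  "residual x n k = (if k = 0 then x 0 else x k - theta_hat x n * x (k - 1))"

definition rho_hat :: "(nat \<Rightarrow> real) \<Rightarrow> nat \<Rightarrow> real" where
  "rho_hat x n =
     (\<Sum>k=1..n. residual x n k * residual x n (k - 1)) / (\<Sum>k=1..n. (residual x n (k - 1))\<^sup>2)"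

definition theta_star :: "real \<Rightarrow> real \<Rightarrow> real" where
  "theta_star \<theta> \<rho> = (\<theta> + \<rho>) / (1 + \<theta> * \<rho>)"

definition rho_star :: "real \<Rightarrow> real \<Rightarrow> real" where
  "rho_star \<theta> \<rho> = \<theta> * \<rho> * (\<theta> + \<rho>) / (1 + \<theta> * \<rho>)"

definition var_theta :: "real \<Rightarrow> real \<Rightarrow> real" where
  "var_theta \<theta> \<rho> = (1 - \<theta>\<^sup>2) * (1 - \<theta> * \<rho>) * (1 - \<rho>\<^sup>2) / (1 + \<theta> * \<rho>) ^ 3"

definition var_rho :: "real \<Rightarrow> real \<Rightarrow> real" where
  "var_rho \<theta> \<rho> = (1 - \<theta> * \<rho>) / (1 + \<theta> * \<rho>) ^ 3 *
     ((\<theta> + \<rho>)\<^sup>2 * (1 + \<theta> * \<rho>)\<^sup>2 + (\<theta> * \<rho>)\<^sup>2 * (1 - \<theta>\<^sup>2) * (1 - \<rho>\<^sup>2))"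

definition Gamma_mat :: "real \<Rightarrow> real \<Rightarrow> real^2^2" where
  "Gamma_mat \<theta> \<rho> =
     vector [vector [var_theta \<theta> \<rho>, \<theta> * \<rho> * var_theta \<theta> \<rho>],
             vector [\<theta> * \<rho> * var_theta \<theta> \<rho>, var_rho \<theta> \<rho>]]"

(* The law N(0, v) on the line, for v >= 0; it is the Dirac mass at 0 when v = 0. *)

definition centered_normal :: "real \<Rightarrow> real measure" where
  "centered_normal v =
     (if v = 0 then return borel 0 else density lborel (normal_density 0 (sqrt v)))"

(* mu is the law N(0, G), G positive semi-definite and possibly singular: every linear form
   t . x has law N(0, t . G t) under mu.  These one-dimensional laws determine mu. *)

definition is_centered_gaussian :: "real^'n^'n \<Rightarrow> (real^'n) measure \<Rightarrow> bool" where
  "is_centered_gaussian G \<mu> \<longleftrightarrow>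
     transpose G = G \<and> (\<forall>t. 0 \<le> t \<bullet> (G *v t)) \<and>
     prob_space \<mu> \<and> sets \<mu> = sets borel \<and>
     (\<forall>t. distr \<mu> borel (\<lambda>x. t \<bullet> x) = centered_normal (t \<bullet> (G *v t)))"

(* The library's weak_conv_m is restricted to measures on the real line. *)

definition converges_weakly ::
    "(nat \<Rightarrow> 'a::topological_space measure) \<Rightarrow> 'a measure \<Rightarrow> bool" where
  "converges_weakly \<mu>s \<mu> \<longleftrightarrow>
     (\<forall>f :: 'a \<Rightarrow> real. continuous_on UNIV f \<and> bounded (range f) \<longrightarrow>
        (\<lambda>n. integral\<^sup>L (\<mu>s n) f) \<longlonglongrightarrow> integral\<^sup>L \<mu> f)"

end

theory Submission
  imports Defs
begin

text \<open>
Write \<open>a = \<theta> + \<rho>\<close>, \<open>b = \<theta> \<rho>\<close> and \<open>\<tau> = a / (1 + b)\<close>. Eliminating the noise \<open>\<epsilon>\<close> shows that the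
observations form a second order autoregression driven by the innovations,
\<open>X\<^sub>k\<^sub>+\<^sub>2 = a X\<^sub>k\<^sub>+\<^sub>1 - b X\<^sub>k + V\<^sub>k\<^sub>+\<^sub>2\<close>. Multiplying this recursion by \<open>X\<^sub>k\<^sub>+\<^sub>1\<close> or \<open>X\<^sub>k\<close> and summing
expresses every sum in the two estimators through the sum of squares \<open>S\<^sub>n\<close>, the two scores
\<open>A\<^sub>n = \<Sum> X\<^sub>k\<^sub>+\<^sub>1 V\<^sub>k\<^sub>+\<^sub>2\<close> and \<open>B\<^sub>n = \<Sum> X\<^sub>k V\<^sub>k\<^sub>+\<^sub>2\<close>, and finitely many boundary products. The result is
exact (\<open>estimators_exact_expansion\<close>). Up to boundary products it reads
\<open>\<theta>\<^sub>n - \<tau> = A\<^sub>n / ((1 + b) S\<^sub>n)\<close>, and the numerator of \<open>\<rho>\<^sub>n - \<rho>*\<close> is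
\<open>S\<^sub>n (z\<^sup>3 - a z\<^sup>2 + b z - b \<tau> (1 - z\<^sup>2)) - z B\<^sub>n\<close> at \<open>z = \<theta>\<^sub>n\<close>. The cubic factors as \<open>(z - \<tau>) (z\<^sup>2 + b)\<close>,
so that both errors are linear in the scores with coefficients that converge in probability.

The limits of the coefficients come from the same algebra. Squaring the recursion gives a second
linear relation between \<open>S\<^sub>n\<close> and the lag one products, whose only term of order \<open>n\<close> besides these is
\<open>\<Sum> V\<^sub>k\<^sup>2\<close>; solving the two relations reduces the law of large numbers for \<open>S\<^sub>n\<close> to the one for
\<open>V\<^sub>k\<^sup>2\<close> (\<open>ar2_sum_squares_lln\<close>).

The initial values may depend on all the innovations, so the observed process need not be adapted.
It differs by a geometrically small error from the process \<open>Y\<close> started at zero, and this error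
changes the scores by a bounded amount in probability. For \<open>Y\<close>, a linear combination of the
scores is a sum \<open>\<Sum> W\<^sub>k U\<^sub>k\<close> of innovations \<open>U\<^sub>k\<close> with weights \<open>W\<^sub>k\<close> that depend on the past. The central limit theorem for such
sums (\<open>innovation_transform_clt\<close>) holds because \<open>exp (i \<Sum> W\<^sub>k U\<^sub>k + v/2 \<Sum> W\<^sub>k\<^sup>2)\<close> has expectation
close to 1, while the compensator \<open>\<Sum> W\<^sub>k\<^sup>2\<close>, normalised, is asymptotically constant.

Hence every linear form in the two normalised errors has the Gaussian limit with variance \<open>t \<bullet> \<Gamma> t\<close>
(\<open>estimators_char_limit\<close>). Convergence in the plane follows by the Cramer-Wold device
(\<open>cramer_wold\<close>).
\<close>

section \<open>Negligible and tight sequences of random variables\<close>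

text \<open>
Negligible sequences are the \<open>o\<^sub>P(1)\<close> and tight sequences the \<open>O\<^sub>P(1)\<close> of asymptotic statistics. The
rules below are their calculus.
\<close>
context prob_space begin

abbreviation tail :: "real \<Rightarrow> ('a \<Rightarrow> real) \<Rightarrow> real" where
  "tail \<delta> Z \<equiv> prob {\<omega>\<in>space M. \<delta> < \<bar>Z \<omega>\<bar>}"

definition negligible_seq :: "(nat \<Rightarrow> 'a \<Rightarrow> real) \<Rightarrow> bool" where
  "negligible_seq Z \<longleftrightarrow> (\<forall>n. Z n \<in> borel_measurable M) \<and>
     (\<forall>\<delta>>0. (\<lambda>n. tail \<delta> (Z n)) \<longlonglongrightarrow> 0)"

definition tight_seq :: "(nat \<Rightarrow> 'a \<Rightarrow> real) \<Rightarrow> bool" where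
  "tight_seq Z \<longleftrightarrow> (\<forall>n. Z n \<in> borel_measurable M) \<and>
     (\<forall>e>0. \<exists>K>0. \<forall>\<^sub>F n in sequentially. tail K (Z n) < e)"

lemma negligible_seq_measurable: "negligible_seq Z \<Longrightarrow> Z n \<in> borel_measurable M"
  and tight_seq_measurable: "tight_seq Z \<Longrightarrow> Z n \<in> borel_measurable M"
  by (auto simp: negligible_seq_def tight_seq_def)

lemma negligible_seqI:
  assumes "\<And>n. Z n \<in> borel_measurable M"
    and "\<And>\<delta> e. 0 < \<delta> \<Longrightarrow> 0 < e \<Longrightarrow> \<forall>\<^sub>F n in sequentially. tail \<delta> (Z n) < e"
  shows "negligible_seq Z"
  unfolding negligible_seq_def
proof (intro conjI allI impI)
  fix \<delta> :: real assume "0 < \<delta>"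
  show "(\<lambda>n. tail \<delta> (Z n)) \<longlonglongrightarrow> 0"
  proof (rule order_tendstoI)
    fix e :: real assume "e < 0"
    then have "e < tail \<delta> (Z n)" for n by (rule less_le_trans) simp
    then show "\<forall>\<^sub>F n in sequentially. e < tail \<delta> (Z n)" by simp
  qed (rule assms(2)[OF \<open>0 < \<delta>\<close>])
qed (use assms in auto)

lemma negligible_seqD:
  assumes "negligible_seq Z" "0 < \<delta>" "0 < e"
  shows "\<forall>\<^sub>F n in sequentially. tail \<delta> (Z n) < e"
  using assms order_tendstoD(2)[of "\<lambda>n. tail \<delta> (Z n)" 0 sequentially e]
  unfolding negligible_seq_def by auto

lemma tight_seqD:
  assumes "tight_seq Z" "0 < e"
  obtains K where "0 < K" "\<forall>\<^sub>F n in sequentially. tail K (Z n) < e"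
  using assms unfolding tight_seq_def by blast

lemma prob_le_add:
  assumes "\<And>\<omega>. \<omega> \<in> space M \<Longrightarrow> P \<omega> \<Longrightarrow> Q \<omega> \<or> R \<omega>"
    and "{\<omega>\<in>space M. Q \<omega>} \<in> events" "{\<omega>\<in>space M. R \<omega>} \<in> events"
  shows "prob {\<omega>\<in>space M. P \<omega>} \<le> prob {\<omega>\<in>space M. Q \<omega>} + prob {\<omega>\<in>space M. R \<omega>}"
proof -
  have "prob {\<omega>\<in>space M. P \<omega>} \<le> prob ({\<omega>\<in>space M. Q \<omega>} \<union> {\<omega>\<in>space M. R \<omega>})"
    using assms by (intro finite_measure_mono) auto
  also have "\<dots> \<le> prob {\<omega>\<in>space M. Q \<omega>} + prob {\<omega>\<in>space M. R \<omega>}"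
    using assms by (intro measure_Un_le) auto
  finally show ?thesis .
qed

lemma negligible_seq_add:
  assumes "negligible_seq Y" "negligible_seq Z"
  shows "negligible_seq (\<lambda>n \<omega>. Y n \<omega> + Z n \<omega>)"
proof (rule negligible_seqI)
  note [measurable] = assms[THEN negligible_seq_measurable]
  show "(\<lambda>\<omega>. Y n \<omega> + Z n \<omega>) \<in> borel_measurable M" for n by measurable
  fix \<delta> e :: real assume *: "0 < \<delta>" "0 < e"
  then have "0 < \<delta> / 2" "0 < e / 2" by auto
  from negligible_seqD[OF assms(1) this] negligible_seqD[OF assms(2) this]
  show "\<forall>\<^sub>F n in sequentially. tail \<delta> (\<lambda>\<omega>. Y n \<omega> + Z n \<omega>) < e"
  proof eventually_elim
    case (elim n)
    have "tail \<delta> (\<lambda>\<omega>. Y n \<omega> + Z n \<omega>) \<le>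
        tail (\<delta>/2) (Y n) + tail (\<delta>/2) (Z n)"
      by (rule prob_le_add) auto
    with elim show ?case by linarith
  qed
qed

lemma tight_seq_combine:
  assumes "tight_seq Y" "tight_seq Z" and [measurable]: "\<And>n. W n \<in> borel_measurable M"
    and bound: "\<And>K L. 0 < K \<Longrightarrow> 0 < L \<Longrightarrow>
      \<exists>C>0. \<forall>n. \<forall>\<omega>\<in>space M. \<bar>Y n \<omega>\<bar> \<le> K \<longrightarrow> \<bar>Z n \<omega>\<bar> \<le> L \<longrightarrow> \<bar>W n \<omega>\<bar> \<le> C"
  shows "tight_seq W"
  unfolding tight_seq_def
proof (intro conjI allI impI)
  note [measurable] = assms(1,2)[THEN tight_seq_measurable]
  fix e :: real assume "0 < e"
  then have "0 < e / 2" by auto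
  obtain K where K: "0 < K" "\<forall>\<^sub>F n in sequentially. tail K (Y n) < e/2"
    using tight_seqD[OF assms(1) \<open>0 < e / 2\<close>] .
  obtain L where L: "0 < L" "\<forall>\<^sub>F n in sequentially. tail L (Z n) < e/2"
    using tight_seqD[OF assms(2) \<open>0 < e / 2\<close>] .
  obtain C where C: "0 < C"
    "\<And>n \<omega>. \<omega> \<in> space M \<Longrightarrow> \<bar>Y n \<omega>\<bar> \<le> K \<Longrightarrow> \<bar>Z n \<omega>\<bar> \<le> L \<Longrightarrow> \<bar>W n \<omega>\<bar> \<le> C"
    using bound[OF K(1) L(1)] by blast
  from K(2) L(2) have "\<forall>\<^sub>F n in sequentially. tail C (W n) < e"
  proof eventually_elim
    case (elim n)
    have "tail C (W n) \<le>
        tail K (Y n) + tail L (Z n)"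
      using C(2)[of _ n] by (intro prob_le_add) (auto simp: not_le[symmetric])
    with elim show ?case by linarith
  qed
  with C(1) show "\<exists>K>0. \<forall>\<^sub>F n in sequentially. tail K (W n) < e" by blast
qed simp

lemma tight_seq_add:
  assumes "tight_seq Y" "tight_seq Z"
  shows "tight_seq (\<lambda>n \<omega>. Y n \<omega> + Z n \<omega>)"
proof (rule tight_seq_combine[OF assms])
  show "(\<lambda>\<omega>. Y n \<omega> + Z n \<omega>) \<in> borel_measurable M" for n
    using assms[THEN tight_seq_measurable] by measurable
  show "\<exists>C>0. \<forall>n. \<forall>\<omega>\<in>space M. \<bar>Y n \<omega>\<bar> \<le> K \<longrightarrow> \<bar>Z n \<omega>\<bar> \<le> L \<longrightarrow> \<bar>Y n \<omega> + Z n \<omega>\<bar> \<le> C"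
    if "0 < K" "0 < L" for K L
    using that by (intro exI[of _ "K + L"]) auto
qed

lemma tight_seq_mult:
  assumes "tight_seq Y" "tight_seq Z"
  shows "tight_seq (\<lambda>n \<omega>. Y n \<omega> * Z n \<omega>)"
proof (rule tight_seq_combine[OF assms])
  show "(\<lambda>\<omega>. Y n \<omega> * Z n \<omega>) \<in> borel_measurable M" for n
    using assms[THEN tight_seq_measurable] by measurable
  show "\<exists>C>0. \<forall>n. \<forall>\<omega>\<in>space M. \<bar>Y n \<omega>\<bar> \<le> K \<longrightarrow> \<bar>Z n \<omega>\<bar> \<le> L \<longrightarrow> \<bar>Y n \<omega> * Z n \<omega>\<bar> \<le> C"
    if "0 < K" "0 < L" for K L
    using that by (intro exI[of _ "K * L"]) (auto simp: abs_mult intro!: mult_mono)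
qed

lemma tight_mult_negligible:
  assumes "tight_seq Y" "negligible_seq Z"
  shows "negligible_seq (\<lambda>n \<omega>. Y n \<omega> * Z n \<omega>)"
proof (rule negligible_seqI)
  note [measurable] = assms(1)[THEN tight_seq_measurable] assms(2)[THEN negligible_seq_measurable]
  show "(\<lambda>\<omega>. Y n \<omega> * Z n \<omega>) \<in> borel_measurable M" for n by measurable
  fix \<delta> e :: real assume *: "0 < \<delta>" "0 < e"
  then have "0 < e / 2" by simp
  obtain K where K: "0 < K" "\<forall>\<^sub>F n in sequentially. tail K (Y n) < e/2"
    using tight_seqD[OF assms(1) \<open>0 < e / 2\<close>] .
  have "\<forall>\<^sub>F n in sequentially. tail (\<delta>/K) (Z n) < e/2"
    using * K(1) by (intro negligible_seqD[OF assms(2)]) auto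
  with K(2) show "\<forall>\<^sub>F n in sequentially. tail \<delta> (\<lambda>\<omega>. Y n \<omega> * Z n \<omega>) < e"
  proof eventually_elim
    case (elim n)
    have "tail \<delta> (\<lambda>\<omega>. Y n \<omega> * Z n \<omega>) \<le>
        tail K (Y n) + tail (\<delta>/K) (Z n)"
    proof (rule prob_le_add)
      fix \<omega> assume "\<delta> < \<bar>Y n \<omega> * Z n \<omega>\<bar>"
      show "K < \<bar>Y n \<omega>\<bar> \<or> \<delta>/K < \<bar>Z n \<omega>\<bar>"
      proof (rule ccontr)
        assume "\<not> ?thesis"
        then have "\<bar>Y n \<omega>\<bar> * \<bar>Z n \<omega>\<bar> \<le> K * (\<delta>/K)" using K by (intro mult_mono) auto
        with \<open>\<delta> < \<bar>Y n \<omega> * Z n \<omega>\<bar>\<close> K(1) show False by (simp add: abs_mult)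
      qed
    qed auto
    with elim show ?case by linarith
  qed
qed

lemma negligible_imp_tight: "negligible_seq Z \<Longrightarrow> tight_seq Z"
  using negligible_seqD[of Z 1] by (auto simp: tight_seq_def negligible_seq_measurable intro!: exI[of _ 1])

lemma negligible_seq_null: "c \<longlonglongrightarrow> 0 \<Longrightarrow> negligible_seq (\<lambda>n \<omega>. c n)"
proof (rule negligible_seqI)
  fix \<delta> e :: real assume "c \<longlonglongrightarrow> 0" "0 < \<delta>" "0 < e"
  then have "\<forall>\<^sub>F n in sequentially. \<bar>c n\<bar> < \<delta>" using tendstoD[of c 0 sequentially \<delta>] by simp
  then show "\<forall>\<^sub>F n in sequentially. tail \<delta> (\<lambda>\<omega>. c n) < e"
  proof eventually_elim
    case (elim n)
    then have "{\<omega>\<in>space M. \<delta> < \<bar>c n\<bar>} = {}" by auto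
    then show ?case using \<open>0 < e\<close> by (simp only: measure_empty)
  qed
qed simp

lemma tight_seq_constant:
  assumes [measurable]: "Z \<in> borel_measurable M"
  shows "tight_seq (\<lambda>n. Z)"
  unfolding tight_seq_def
proof (intro conjI allI impI)
  fix e :: real assume "0 < e"
  have "(\<lambda>k. tail (real k) Z) \<longlonglongrightarrow> prob (\<Inter>k. {\<omega>\<in>space M. real k < \<bar>Z \<omega>\<bar>})"
    by (intro finite_Lim_measure_decseq) (auto simp: decseq_def)
  also have "(\<Inter>k. {\<omega>\<in>space M. real k < \<bar>Z \<omega>\<bar>}) = {}"
  proof -
    have "\<exists>k. \<not> real k < \<bar>Z \<omega>\<bar>" for \<omega> using real_arch_simple[of "\<bar>Z \<omega>\<bar>"] by (simp add: not_less)
    then show ?thesis by blast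
  qed
  finally have "(\<lambda>k. tail (real k) Z) \<longlonglongrightarrow> 0" by simp
  from order_tendstoD(2)[OF this \<open>0 < e\<close>] obtain k where "tail (real k) Z < e"
    by (auto simp: eventually_sequentially)
  moreover have "tail (real (Suc k)) Z \<le> tail (real k) Z"
    by (intro finite_measure_mono) auto
  ultimately show "\<exists>K>0. \<forall>\<^sub>F n in sequentially. tail K Z < e"
    by (intro exI[of _ "real (Suc k)"]) auto
qed simp

lemma tight_seq_const [simp]: "tight_seq (\<lambda>n \<omega>. c)"
  by (rule tight_seq_constant) simp

lemma negligible_seq_mono:
  assumes "negligible_seq Y" "\<And>n. Z n \<in> borel_measurable M"
    and "\<And>n \<omega>. \<omega> \<in> space M \<Longrightarrow> \<bar>Z n \<omega>\<bar> \<le> \<bar>Y n \<omega>\<bar>"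
  shows "negligible_seq Z"
proof (rule negligible_seqI)
  note [measurable] = assms(1)[THEN negligible_seq_measurable]
  fix \<delta> e :: real assume "0 < \<delta>" "0 < e"
  from negligible_seqD[OF assms(1) this] show "\<forall>\<^sub>F n in sequentially. tail \<delta> (Z n) < e"
  proof eventually_elim
    case (elim n)
    have "tail \<delta> (Z n) \<le> tail \<delta> (Y n)"
      using assms(3)[of _ n] by (intro finite_measure_mono) (auto intro: less_le_trans)
    with elim show ?case by simp
  qed
qed (use assms in auto)

lemma tight_seq_mono:
  assumes "tight_seq Y" "\<And>n. Z n \<in> borel_measurable M"
    and "\<And>n \<omega>. \<omega> \<in> space M \<Longrightarrow> \<bar>Z n \<omega>\<bar> \<le> \<bar>Y n \<omega>\<bar>"
  shows "tight_seq Z"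
proof (rule tight_seq_combine[OF assms(1,1,2)])
  show "\<exists>C>0. \<forall>n. \<forall>\<omega>\<in>space M. \<bar>Y n \<omega>\<bar> \<le> K \<longrightarrow> \<bar>Y n \<omega>\<bar> \<le> L \<longrightarrow> \<bar>Z n \<omega>\<bar> \<le> C"
    if "0 < K" "0 < L" for K L
    using that assms(3) by (intro exI[of _ K]) (auto intro: order_trans)
qed

lemma tight_seq_of_bounded_mean:
  assumes int: "\<And>n. integrable M (Z n)" and C: "\<And>n. expectation (\<lambda>\<omega>. \<bar>Z n \<omega>\<bar>) \<le> C"
  shows "tight_seq Z"
  unfolding tight_seq_def
proof (intro conjI allI impI)
  have [measurable]: "Z n \<in> borel_measurable M" for n using int by auto
  show "Z n \<in> borel_measurable M" for n by simp
  fix e :: real assume "0 < e"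
  define K where "K = (\<bar>C\<bar> + 1) / e"
  have "0 < K" using \<open>0 < e\<close> by (auto simp: K_def intro!: divide_pos_pos)
  have "tail K (Z n) < e" for n
  proof -
    have "tail K (Z n) \<le> prob {\<omega>\<in>space M. K \<le> \<bar>Z n \<omega>\<bar>}"
      by (intro finite_measure_mono) auto
    also have "\<dots> \<le> expectation (\<lambda>\<omega>. \<bar>Z n \<omega>\<bar>) / K"
      using int \<open>0 < K\<close> by (intro integral_Markov_inequality_measure[where A="{}"]) auto
    also have "\<dots> < (\<bar>C\<bar> + 1) / K"
      using C[of n] \<open>0 < K\<close> by (intro divide_strict_right_mono) auto
    also have "\<dots> = e" using \<open>0 < e\<close> by (simp add: K_def)
    finally show ?thesis .
  qed
  then show "\<exists>K>0. \<forall>\<^sub>F n in sequentially. tail K (Z n) < e"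
    using \<open>0 < K\<close> by auto
qed

lemma negligible_seq_uminus: "negligible_seq Z \<Longrightarrow> negligible_seq (\<lambda>n \<omega>. - Z n \<omega>)"
  by (rule negligible_seq_mono) (auto dest: negligible_seq_measurable)

lemma negligible_seq_diff:
  "negligible_seq Y \<Longrightarrow> negligible_seq Z \<Longrightarrow> negligible_seq (\<lambda>n \<omega>. Y n \<omega> - Z n \<omega>)"
  using negligible_seq_add[OF _ negligible_seq_uminus] by simp

lemma negligible_seq_cmult: "negligible_seq Z \<Longrightarrow> negligible_seq (\<lambda>n \<omega>. c * Z n \<omega>)"
  by (rule tight_mult_negligible) auto

lemma tight_seq_uminus: "tight_seq Z \<Longrightarrow> tight_seq (\<lambda>n \<omega>. - Z n \<omega>)"
  by (rule tight_seq_mono) (auto dest: tight_seq_measurable)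

lemma tight_seq_diff:
  "tight_seq Y \<Longrightarrow> tight_seq Z \<Longrightarrow> tight_seq (\<lambda>n \<omega>. Y n \<omega> - Z n \<omega>)"
  using tight_seq_add[OF _ tight_seq_uminus] by simp

lemma tight_seq_of_negligible_diff:
  "negligible_seq (\<lambda>n \<omega>. Z n \<omega> - c) \<Longrightarrow> tight_seq Z"
  using tight_seq_add[OF negligible_imp_tight tight_seq_const[of c], of "\<lambda>n \<omega>. Z n \<omega> - c"] by simp

text \<open>
Estimators are quotients that are set to 0 when a denominator vanishes; formulas for them hold
outside an event of vanishing probability only, and this rule discards that event.
\<close>
lemma negligible_seq_transfer:
  assumes "negligible_seq Y" "\<And>n. Z n \<in> borel_measurable M"
    and "\<And>n. Measurable.pred M (A n)" "(\<lambda>n. prob {\<omega>\<in>space M. A n \<omega>}) \<longlonglongrightarrow> 0"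
    and "\<And>n \<omega>. \<omega> \<in> space M \<Longrightarrow> \<not> A n \<omega> \<Longrightarrow> Z n \<omega> = Y n \<omega>"
  shows "negligible_seq Z"
proof (rule negligible_seqI)
  note [measurable] = assms(1)[THEN negligible_seq_measurable] assms(2,3)
  fix \<delta> e :: real assume "0 < \<delta>" "0 < e"
  then have "0 < e / 2" by simp
  from negligible_seqD[OF assms(1) \<open>0 < \<delta>\<close> this] order_tendstoD(2)[OF assms(4) this]
  show "\<forall>\<^sub>F n in sequentially. tail \<delta> (Z n) < e"
  proof eventually_elim
    case (elim n)
    have "tail \<delta> (Z n) \<le> tail \<delta> (Y n) + prob {\<omega>\<in>space M. A n \<omega>}"
      using assms(5)[of _ n] by (intro prob_le_add) auto
    with elim show ?case by simp
  qed
qed (use assms in auto)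

lemma negligible_seq_continuous:
  assumes Z: "negligible_seq (\<lambda>n \<omega>. Z n \<omega> - c)" and f: "isCont f c" "f \<in> borel_measurable borel"
  shows "negligible_seq (\<lambda>n \<omega>. f (Z n \<omega>) - f c)"
proof (rule negligible_seqI)
  have [measurable]: "Z n \<in> borel_measurable M" for n
    using tight_seq_measurable[OF tight_seq_of_negligible_diff[OF Z]] .
  note [measurable] = f(2)
  show "(\<lambda>\<omega>. f (Z n \<omega>) - f c) \<in> borel_measurable M" for n by measurable
  fix \<delta> e :: real assume "0 < \<delta>" "0 < e"
  obtain d where d: "0 < d" "\<And>z. dist z c < d \<Longrightarrow> dist (f z) (f c) < \<delta>"
    using f(1) \<open>0 < \<delta>\<close> unfolding continuous_at_eps_delta by metis
  then have "0 < d / 2" by simp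
  from negligible_seqD[OF Z this \<open>0 < e\<close>]
  show "\<forall>\<^sub>F n in sequentially. tail \<delta> (\<lambda>\<omega>. f (Z n \<omega>) - f c) < e"
  proof eventually_elim
    case (elim n)
    have "tail \<delta> (\<lambda>\<omega>. f (Z n \<omega>) - f c) \<le> tail (d / 2) (\<lambda>\<omega>. Z n \<omega> - c)"
    proof (intro finite_measure_mono subsetI)
      fix \<omega> assume "\<omega> \<in> {\<omega>\<in>space M. \<delta> < \<bar>f (Z n \<omega>) - f c\<bar>}"
      then have "\<omega> \<in> space M" "\<not> \<bar>Z n \<omega> - c\<bar> < d" using d(2)[of "Z n \<omega>"] by (auto simp: dist_real_def)
      then have "d / 2 < \<bar>Z n \<omega> - c\<bar>" using d(1) by linarith
      with \<open>\<omega> \<in> space M\<close> show "\<omega> \<in> {\<omega>\<in>space M. d / 2 < \<bar>Z n \<omega> - c\<bar>}" by simp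
    qed auto
    with elim show ?case by simp
  qed
qed

lemma negligible_seq_inverse:
  "negligible_seq (\<lambda>n \<omega>. Z n \<omega> - c) \<Longrightarrow> c \<noteq> 0 \<Longrightarrow> negligible_seq (\<lambda>n \<omega>. inverse (Z n \<omega>) - inverse c)"
  by (rule negligible_seq_continuous) (auto intro: continuous_intros)

text \<open>
The factor \<open>Y'\<close> is allowed to vary with \<open>n\<close>: it is typically a tight score, for which there is no
limit in probability.
\<close>
lemma negligible_seq_mult_limit:
  assumes "negligible_seq (\<lambda>n \<omega>. Y n \<omega> - Y' n \<omega>)" "negligible_seq (\<lambda>n \<omega>. Z n \<omega> - Z' n \<omega>)"
    and "tight_seq Y'" "tight_seq Z"
  shows "negligible_seq (\<lambda>n \<omega>. Y n \<omega> * Z n \<omega> - Y' n \<omega> * Z' n \<omega>)"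
proof -
  have "negligible_seq (\<lambda>n \<omega>. Z n \<omega> * (Y n \<omega> - Y' n \<omega>) + Y' n \<omega> * (Z n \<omega> - Z' n \<omega>))"
    by (intro negligible_seq_add tight_mult_negligible assms)
  then show ?thesis by (simp add: algebra_simps)
qed

lemma negligible_seq_eventually:
  assumes "negligible_seq Y" "\<And>n. Z n \<in> borel_measurable M"
    and "\<forall>\<^sub>F n in sequentially. \<forall>\<omega>\<in>space M. Z n \<omega> = Y n \<omega>"
  shows "negligible_seq Z"
proof (rule negligible_seqI)
  fix \<delta> e :: real assume "0 < \<delta>" "0 < e"
  from negligible_seqD[OF assms(1) this] assms(3)
  show "\<forall>\<^sub>F n in sequentially. tail \<delta> (Z n) < e"
    by eventually_elim (simp cong: conj_cong Collect_cong)
qed (use assms in auto)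

lemma tight_seq_pred:
  assumes "tight_seq Z"
  shows "tight_seq (\<lambda>n. Z (n - 1))"
  unfolding tight_seq_def
proof (intro conjI allI impI)
  fix e :: real assume "0 < e"
  then obtain K where K: "0 < K" "\<forall>\<^sub>F n in sequentially. tail K (Z n) < e"
    using tight_seqD[OF assms] by blast
  have "filterlim (\<lambda>n::nat. n - 1) sequentially sequentially"
    by (rule filterlim_minus_const_nat_at_top)
  from eventually_compose_filterlim[OF K(2) this] K(1)
  show "\<exists>K>0. \<forall>\<^sub>F n in sequentially. tail K (\<lambda>\<omega>. Z (n - 1) \<omega>) < e" by blast
qed (use tight_seq_measurable[OF assms] in auto)

lemma null_mult_tight:
  "c \<longlonglongrightarrow> 0 \<Longrightarrow> tight_seq Z \<Longrightarrow> negligible_seq (\<lambda>n \<omega>. c n * Z n \<omega>)"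
  using tight_mult_negligible[OF _ negligible_seq_null] by (simp add: mult.commute)

lemma tight_scaled_negligible:
  assumes "tight_seq Z"
  shows "negligible_seq (\<lambda>n \<omega>. inverse (real n) * Z n \<omega>)"
    and "negligible_seq (\<lambda>n \<omega>. inverse (sqrt (real n)) * Z n \<omega>)"
  by (rule null_mult_tight[OF _ assms], real_asymp)+

lemma tight_seq_of_bounded_second_moment:
  assumes [measurable]: "\<And>n. Z n \<in> borel_measurable M"
    and int: "\<And>n. integrable M (\<lambda>\<omega>. (Z n \<omega>)\<^sup>2)" and C: "\<And>n. expectation (\<lambda>\<omega>. (Z n \<omega>)\<^sup>2) \<le> C"
  shows "tight_seq Z"
proof (rule tight_seq_mono)
  show "tight_seq (\<lambda>n \<omega>. 1 + (Z n \<omega>)\<^sup>2)"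
    by (intro tight_seq_add tight_seq_const tight_seq_of_bounded_mean[where C=C]) (use int C in auto)
  fix n \<omega>
  have "0 \<le> (\<bar>Z n \<omega>\<bar> - 1)\<^sup>2" by simp
  then show "\<bar>Z n \<omega>\<bar> \<le> \<bar>1 + (Z n \<omega>)\<^sup>2\<bar>" by (simp add: power2_diff)
qed simp

lemma expectation_bounded_negligible:
  assumes "negligible_seq Z" "\<And>n \<omega>. \<omega> \<in> space M \<Longrightarrow> \<bar>Z n \<omega>\<bar> \<le> C"
  shows "(\<lambda>n. expectation (\<lambda>\<omega>. \<bar>Z n \<omega>\<bar>)) \<longlonglongrightarrow> 0"
proof (rule LIMSEQ_I)
  note [measurable] = assms(1)[THEN negligible_seq_measurable]
  fix r :: real assume "0 < r"
  define C' where "C' = \<bar>C\<bar> + 1"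
  have C'_bound: "\<bar>Z n \<omega>\<bar> \<le> C'" if "\<omega> \<in> space M" for n \<omega>
    using assms(2)[OF that, of n] unfolding C'_def by linarith
  have C'_pos: "0 < C'" unfolding C'_def by linarith
  note C' = C'_pos C'_bound
  have "0 < r / 2" "0 < r / (2 * C')" using \<open>0 < r\<close> C' by auto
  from negligible_seqD[OF assms(1) this]
  have "\<forall>\<^sub>F n in sequentially. norm (expectation (\<lambda>\<omega>. \<bar>Z n \<omega>\<bar>) - 0) < r"
  proof eventually_elim
    case (elim n)
    let ?A = "{\<omega>\<in>space M. r / 2 < \<bar>Z n \<omega>\<bar>}"
    have "integrable M (\<lambda>\<omega>. \<bar>Z n \<omega>\<bar>)"
      using C' by (intro integrable_const_bound[where B=C']) auto
    moreover have "integrable M (\<lambda>\<omega>. r / 2 + C' * indicator ?A \<omega>)"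
      by (intro Bochner_Integration.integrable_add integrable_mult_right integrable_real_indicator) (auto simp: emeasure_eq_measure)
    ultimately have "expectation (\<lambda>\<omega>. \<bar>Z n \<omega>\<bar>) \<le> expectation (\<lambda>\<omega>. r / 2 + C' * indicator ?A \<omega>)"
      using C' \<open>0 < r\<close> by (intro integral_mono) (auto simp: indicator_def not_less intro: add_increasing)
    also have "\<dots> = r / 2 + C' * prob ?A"
      by (subst Bochner_Integration.integral_add) (auto simp: prob_space emeasure_eq_measure)
    also have "\<dots> < r / 2 + C' * (r / (2 * C'))"
      using elim C'(1) by (intro add_strict_left_mono mult_strict_left_mono)
    also have "\<dots> = r" using C'(1) by simp
    finally show ?case by simp
  qed
  then show "\<exists>no. \<forall>n\<ge>no. norm (expectation (\<lambda>\<omega>. \<bar>Z n \<omega>\<bar>) - 0) < r"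
    by (simp add: eventually_sequentially)
qed

text \<open>
Slutsky's lemma in terms of characteristic functions: \<open>x \<mapsto> e\<^sup>i\<^sup>x\<close> is bounded and 1-Lipschitz.
\<close>
lemma char_limit_negligible_diff:
  assumes lim: "(\<lambda>n. \<integral>\<omega>. iexp (Y n \<omega>) \<partial>M) \<longlonglongrightarrow> c"
    and [measurable]: "\<And>n. Y n \<in> borel_measurable M" "\<And>n. Z n \<in> borel_measurable M"
    and negl: "negligible_seq (\<lambda>n \<omega>. Z n \<omega> - Y n \<omega>)"
  shows "(\<lambda>n. \<integral>\<omega>. iexp (Z n \<omega>) \<partial>M) \<longlonglongrightarrow> c"
proof -
  have "negligible_seq (\<lambda>n \<omega>. min 2 \<bar>Z n \<omega> - Y n \<omega>\<bar>)"
    by (rule negligible_seq_mono[OF negl]) auto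
  from expectation_bounded_negligible[OF this, of 2]
  have lim0: "(\<lambda>n. expectation (\<lambda>\<omega>. min 2 \<bar>Z n \<omega> - Y n \<omega>\<bar>)) \<longlonglongrightarrow> 0" by simp
  have int: "integrable M (\<lambda>\<omega>. iexp (Y n \<omega>))" "integrable M (\<lambda>\<omega>. iexp (Z n \<omega>))" for n
    by (rule integrable_const_bound[where B=1]; simp)+
  have bound: "cmod (iexp x - iexp y) \<le> min 2 \<bar>x - y\<bar>" for x y
  proof -
    have "iexp x = iexp (x - y) * iexp y" by (simp add: exp_add[symmetric] algebra_simps)
    then have "iexp x - iexp y = (iexp (x - y) - 1) * iexp y" by (simp add: algebra_simps)
    then have "cmod (iexp x - iexp y) = cmod (iexp (x - y) - 1)" by (simp only: norm_mult norm_exp_i_times mult_1_right)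
    also have "\<dots> \<le> \<bar>x - y\<bar>" using iexp_approx1[of "x - y" 0] by simp
    finally show ?thesis using norm_triangle_ineq4[of "iexp x" "iexp y"] by simp
  qed
  have "(\<lambda>n. (\<integral>\<omega>. iexp (Z n \<omega>) \<partial>M) - (\<integral>\<omega>. iexp (Y n \<omega>) \<partial>M)) \<longlonglongrightarrow> 0"
  proof (rule Lim_null_comparison[OF always_eventually lim0], rule allI)
    fix n
    have "cmod (\<integral>\<omega>. iexp (Z n \<omega>) - iexp (Y n \<omega>) \<partial>M) \<le> (\<integral>\<omega>. cmod (iexp (Z n \<omega>) - iexp (Y n \<omega>)) \<partial>M)"
      by (rule integral_norm_bound)
    also have "\<dots> \<le> expectation (\<lambda>\<omega>. min 2 \<bar>Z n \<omega> - Y n \<omega>\<bar>)"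
    proof (rule integral_mono)
      show "integrable M (\<lambda>\<omega>. min 2 \<bar>Z n \<omega> - Y n \<omega>\<bar>)" by (rule integrable_const_bound[where B=2]) auto
    qed (use int bound in auto)
    finally show "cmod ((\<integral>\<omega>. iexp (Z n \<omega>) \<partial>M) - (\<integral>\<omega>. iexp (Y n \<omega>) \<partial>M)) \<le> expectation (\<lambda>\<omega>. min 2 \<bar>Z n \<omega> - Y n \<omega>\<bar>)"
      using int by simp
  qed
  from tendsto_add[OF this lim] show ?thesis by simp
qed

end

section \<open>The Cramer-Wold device\<close>

text \<open>
Convergence of all characteristic functions is convergence of the integrals of all trigonometric
polynomials. These form an algebra, but a trigonometric polynomial that is close to a given \<open>f\<close> on a
large box may be large elsewhere. The remedy is to approximate \<open>f\<close> by a polynomial in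
\<open>sin (c x\<^sub>1), sin (c x\<^sub>2), \<dots>\<close>. With \<open>c = \<pi> / (2 L)\<close> the map to the sines is injective on the box
\<open>[-L, L]\<^sup>d\<close> and sends the whole space into \<open>[-1, 1]\<^sup>d\<close>, so an approximation that is uniform on
\<open>[-1, 1]\<^sup>d\<close> is close to \<open>f\<close> on the box and bounded by nearly \<open>sup f\<close> everywhere.
\<close>
abbreviation sine_vector :: "real \<Rightarrow> 'a::euclidean_space \<Rightarrow> 'a" where
  "sine_vector c x \<equiv> (\<Sum>b\<in>Basis. sin (c * (x \<bullet> b)) *\<^sub>R b)"

inductive trig_poly :: "('a::euclidean_space \<Rightarrow> complex) \<Rightarrow> bool" where
  monomial: "trig_poly (\<lambda>x. c * iexp (t \<bullet> x))"
| add: "trig_poly f \<Longrightarrow> trig_poly g \<Longrightarrow> trig_poly (\<lambda>x. f x + g x)"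

lemma trig_poly_mult:
  assumes "trig_poly f" "trig_poly g"
  shows "trig_poly (\<lambda>x. f x * g x)"
  using assms
proof (induction f rule: trig_poly.induct)
  case (monomial c t)
  then show ?case
  proof (induction g rule: trig_poly.induct)
    case (monomial d s)
    have "trig_poly (\<lambda>x. (c * d) * iexp ((t + s) \<bullet> x))"
      by (rule trig_poly.monomial)
    also have "(\<lambda>x. (c * d) * iexp ((t + s) \<bullet> x)) = (\<lambda>x. c * iexp (t \<bullet> x) * (d * iexp (s \<bullet> x)))"
      by (auto simp: inner_add_left exp_add algebra_simps)
    finally show ?case .
  next
    case (add f g)
    then show ?case by (auto simp: distrib_left intro: trig_poly.add)
  qed
next
  case (add f h)
  then show ?case by (auto simp: distrib_right intro: trig_poly.add)
qed

lemma trig_poly_sum: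
  assumes "\<And>i. i \<in> I \<Longrightarrow> trig_poly (f i)"
  shows "trig_poly (\<lambda>x. \<Sum>i\<in>I. f i x)"
  using assms
proof (induction I rule: infinite_finite_induct)
  case (insert i I)
  then show ?case by (auto intro: trig_poly.add)
qed (use monomial[of 0 0] in auto)

lemma trig_poly_polynomial_of_sines:
  fixes p :: "'a::euclidean_space \<Rightarrow> real"
  assumes "real_polynomial_function p"
  shows "trig_poly (\<lambda>x. of_real (p (sine_vector c x)))"
  using assms
proof (induction p rule: real_polynomial_function.induct)
  case (linear p)
  then interpret bounded_linear p .
  have eq: "of_real (p (sine_vector c x)) =
     (\<Sum>b\<in>Basis. p b / (2*\<i>) * iexp ((c *\<^sub>R b) \<bullet> x) + (- (p b / (2*\<i>))) * iexp ((- (c *\<^sub>R b)) \<bullet> x))" for x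
  proof -
    have "of_real (sin (c * (x \<bullet> b)) * p b) =
       p b / (2*\<i>) * iexp ((c *\<^sub>R b) \<bullet> x) + (- (p b / (2*\<i>))) * iexp ((- (c *\<^sub>R b)) \<bullet> x)" for b
      by (simp add: sin_of_real[symmetric] sin_exp_eq inner_commute field_simps)
    then show ?thesis
      by (simp add: sum scaleR of_real_sum del: of_real_mult)
  qed
  show ?case unfolding eq
    by (intro trig_poly_sum trig_poly.add trig_poly.monomial)
next
  case (const k)
  then show ?case using monomial[of "of_real k" 0] by simp
qed (auto intro: trig_poly.add trig_poly_mult)

lemma integrable_bounded_borel:
  fixes f :: "'a::topological_space \<Rightarrow> 'b::{banach, second_countable_topology}"
  assumes "prob_space \<nu>" "sets \<nu> = sets borel" "f \<in> borel_measurable borel" "\<And>x. norm (f x) \<le> B"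
  shows "integrable \<nu> f"
proof -
  interpret prob_space \<nu> by fact
  have "f \<in> borel_measurable \<nu>" using assms(2,3) by (simp cong: measurable_cong_sets)
  then show ?thesis using assms(4) by (intro integrable_const_bound[where B=B]) auto
qed

lemma trig_poly_integrable_tendsto:
  fixes \<nu> :: "nat \<Rightarrow> 'a::euclidean_space measure"
  assumes \<nu>: "\<And>n. prob_space (\<nu> n)" "\<And>n. sets (\<nu> n) = sets borel"
    and \<mu>: "prob_space \<mu>" "sets \<mu> = sets borel"
    and conv: "\<And>t. (\<lambda>n. \<integral>x. iexp (t \<bullet> x) \<partial>\<nu> n) \<longlonglongrightarrow> (\<integral>x. iexp (t \<bullet> x) \<partial>\<mu>)"
    and "trig_poly h"
  shows "(\<forall>n. integrable (\<nu> n) h) \<and> integrable \<mu> h \<and>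
         (\<lambda>n. \<integral>x. h x \<partial>\<nu> n) \<longlonglongrightarrow> (\<integral>x. h x \<partial>\<mu>)"
  using \<open>trig_poly h\<close>
proof (induction h rule: trig_poly.induct)
  case (monomial c t)
  have m: "(\<lambda>x::'a. iexp (t \<bullet> x)) \<in> borel_measurable borel" by measurable
  have "integrable (\<nu> n) (\<lambda>x. iexp (t \<bullet> x))" "integrable \<mu> (\<lambda>x. iexp (t \<bullet> x))" for n
    using \<nu> \<mu> m by (auto intro!: integrable_bounded_borel[where B=1])
  then show ?case using conv[of t] by (auto intro!: tendsto_mult)
next
  case (add f g)
  then show ?case by (auto intro!: tendsto_add)
qed

text \<open>
The continuous weight \<open>min 1 (x\<^sup>2 / L\<^sup>2)\<close> dominates the indicator of \<open>\<bar>x\<bar> \<ge> L\<close>. Being bounded and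
continuous it is governed by one-dimensional weak convergence, which transfers the tightness of the
limit to the sequence.
\<close>
lemma tail_weight_integral_small:
  fixes \<mu> :: "real measure"
  assumes "prob_space \<mu>" "sets \<mu> = sets borel" "0 < e"
  shows "\<exists>L0>0. \<forall>L\<ge>L0. (\<integral>x. min 1 (x\<^sup>2 / L\<^sup>2) \<partial>\<mu>) < e"
proof -
  interpret prob_space \<mu> by fact
  have [measurable_cong]: "sets \<mu> = sets borel" by fact
  have "((\<lambda>L. \<integral>x. min 1 (x\<^sup>2 / L\<^sup>2) \<partial>\<mu>) \<longlongrightarrow> (\<integral>x. 0 \<partial>\<mu>)) at_top"
  proof (rule integral_dominated_convergence_at_top[where w="\<lambda>_. 1"])
    show "AE x in \<mu>. ((\<lambda>L. min 1 (x\<^sup>2 / L\<^sup>2)) \<longlongrightarrow> 0) at_top"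
    proof (rule AE_I2)
      fix x :: real
      have "((\<lambda>L. x\<^sup>2 / L\<^sup>2) \<longlongrightarrow> 0) at_top" by real_asymp
      then have "((\<lambda>L. min 1 (x\<^sup>2 / L\<^sup>2)) \<longlongrightarrow> min 1 0) at_top" by (intro tendsto_intros)
      then show "((\<lambda>L. min 1 (x\<^sup>2 / L\<^sup>2)) \<longlongrightarrow> 0) at_top" by simp
    qed
  qed auto
  then have "((\<lambda>L. \<integral>x. min 1 (x\<^sup>2 / L\<^sup>2) \<partial>\<mu>) \<longlongrightarrow> 0) at_top" by simp
  from order_tendstoD(2)[OF this \<open>0 < e\<close>] obtain L1 where "\<forall>L\<ge>L1. (\<integral>x. min 1 (x\<^sup>2 / L\<^sup>2) \<partial>\<mu>) < e"
    by (auto simp: eventually_at_top_linorder)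
  then show ?thesis by (intro exI[of _ "max 1 L1"]) auto
qed

lemma arcsin_sin_scaled:
  assumes "0 < L" "\<bar>y\<bar> \<le> L"
  shows "arcsin (sin (pi / (2 * L) * y)) = pi / (2 * L) * (y::real)"
proof (rule arcsin_sin)
  have *: "pi / (2 * L) * \<bar>y\<bar> \<le> pi / (2 * L) * L" using assms by (intro mult_left_mono) auto
  have "\<bar>pi / (2 * L) * y\<bar> \<le> pi / 2" using * assms by (simp add: abs_mult)
  then show "- (pi / 2) \<le> pi / (2 * L) * y" "pi / (2 * L) * y \<le> pi / 2" by linarith+
qed

lemma sine_polynomial_approx:
  fixes f :: "'a::euclidean_space \<Rightarrow> real"
  assumes f: "continuous_on UNIV f" "\<And>x. \<bar>f x\<bar> \<le> B" and "0 < L" "0 < \<delta>"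
  obtains p where "real_polynomial_function p"
    "\<And>x. \<bar>p (sine_vector (pi / (2 * L)) x)\<bar> \<le> B + \<delta>"
    "\<And>x. (\<And>b. b \<in> Basis \<Longrightarrow> \<bar>x \<bullet> b\<bar> \<le> L) \<Longrightarrow>
       \<bar>f x - p (sine_vector (pi / (2 * L)) x)\<bar> \<le> \<delta>"
proof -
  define S :: "'a set" where "S = cbox (- One) One"
  define c where "c = pi / (2 * L)"
  have "0 < c" using \<open>0 < L\<close> by (simp add: c_def)
  define F where "F y = f (\<Sum>b\<in>Basis. (arcsin (y \<bullet> b) / c) *\<^sub>R b)" for y
  have "continuous_on S (\<lambda>y. \<Sum>b\<in>Basis. (arcsin (y \<bullet> b) / c) *\<^sub>R b)"
    using \<open>0 < c\<close> by (intro continuous_intros) (auto simp: S_def mem_box)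
  then have "continuous_on S F"
    unfolding F_def by (rule continuous_on_compose2[OF f(1)]) auto
  moreover have "compact S" by (simp add: S_def compact_cbox)
  ultimately obtain p where p: "real_polynomial_function p" "\<And>y. y \<in> S \<Longrightarrow> \<bar>F y - p y\<bar> < \<delta>"
    using Stone_Weierstrass_real_polynomial_function[of S F \<delta>] \<open>0 < \<delta>\<close> by metis
  let ?s = "\<lambda>x::'a. sine_vector c x"
  have sS: "?s x \<in> S" for x
    by (auto simp: S_def mem_box)
  show thesis
  proof (rule that[OF p(1)])
    fix x :: 'a
    have "\<bar>F (?s x)\<bar> \<le> B" using f(2) by (simp add: F_def)
    then show "\<bar>p (sine_vector (pi / (2 * L)) x)\<bar> \<le> B + \<delta>"
      using p(2)[OF sS[of x]] unfolding c_def by linarith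
    assume x: "\<And>b. b \<in> Basis \<Longrightarrow> \<bar>x \<bullet> b\<bar> \<le> L"
    have "(\<Sum>b\<in>Basis. (arcsin (?s x \<bullet> b) / c) *\<^sub>R b) = (\<Sum>b\<in>Basis. (x \<bullet> b) *\<^sub>R b)"
    proof (intro sum.cong refl)
      fix b :: 'a assume b: "b \<in> Basis"
      have "arcsin (?s x \<bullet> b) = c * (x \<bullet> b)"
        using b arcsin_sin_scaled[OF \<open>0 < L\<close> x[OF b]] by (simp add: c_def)
      then show "(arcsin (?s x \<bullet> b) / c) *\<^sub>R b = (x \<bullet> b) *\<^sub>R b" using \<open>0 < c\<close> by simp
    qed
    then have "F (?s x) = f x" by (simp add: F_def euclidean_representation)
    then show "\<bar>f x - p (sine_vector (pi / (2 * L)) x)\<bar> \<le> \<delta>"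
      using p(2)[OF sS[of x]] unfolding c_def by simp
  qed
qed

theorem cramer_wold:
  fixes \<nu> :: "nat \<Rightarrow> 'a::euclidean_space measure"
  assumes \<nu>: "\<And>n. prob_space (\<nu> n)" "\<And>n. sets (\<nu> n) = sets borel"
    and \<mu>: "prob_space \<mu>" "sets \<mu> = sets borel"
    and conv: "\<And>t. (\<lambda>n. \<integral>x. iexp (t \<bullet> x) \<partial>\<nu> n) \<longlonglongrightarrow> (\<integral>x. iexp (t \<bullet> x) \<partial>\<mu>)"
  shows "converges_weakly \<nu> \<mu>"
  unfolding converges_weakly_def
proof (intro allI impI, elim conjE)
  fix f :: "'a \<Rightarrow> real" assume f: "continuous_on UNIV f" and "bounded (range f)"
  then obtain B where B: "\<And>x. \<bar>f x\<bar> \<le> B" by (auto simp: bounded_iff)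
  then have "0 \<le> B" using abs_ge_zero order_trans by blast
  define d where "d = real DIM('a)"
  have "0 < d" by (simp add: d_def)
  let ?\<psi> = "\<lambda>L x::real. min 1 (x\<^sup>2 / L\<^sup>2)"
  have \<psi>_conv: "(\<lambda>n. \<integral>x. ?\<psi> L (x \<bullet> b) \<partial>\<nu> n) \<longlonglongrightarrow> (\<integral>x. ?\<psi> L (x \<bullet> b) \<partial>\<mu>)" if "0 < L" for b and L
  proof -
    let ?d = "\<lambda>\<nu>. distr \<nu> borel (\<lambda>x. x \<bullet> b)"
    have rd: "real_distribution (?d \<mu>')" and ch: "char (?d \<mu>') t = (\<integral>x. iexp ((t *\<^sub>R b) \<bullet> x) \<partial>\<mu>')"
      and in1: "(\<integral>x. ?\<psi> L x \<partial>?d \<mu>') = (\<integral>x. ?\<psi> L (x \<bullet> b) \<partial>\<mu>')"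
      if "prob_space \<mu>'" "sets \<mu>' = sets borel" for \<mu>' t
    proof -
      interpret prob_space \<mu>' by fact
      have [measurable_cong]: "sets \<mu>' = sets borel" by fact
      show "real_distribution (?d \<mu>')" by (rule real_distribution_distr) simp
      show "char (?d \<mu>') t = (\<integral>x. iexp ((t *\<^sub>R b) \<bullet> x) \<partial>\<mu>')"
        unfolding char_def by (subst integral_distr) (auto simp: inner_commute)
      show "(\<integral>x. ?\<psi> L x \<partial>?d \<mu>') = (\<integral>x. ?\<psi> L (x \<bullet> b) \<partial>\<mu>')"
        by (subst integral_distr) auto
    qed
    have "weak_conv_m (\<lambda>n. ?d (\<nu> n)) (?d \<mu>)"
    proof (rule levy_continuity)
      fix t
      show "(\<lambda>n. char (?d (\<nu> n)) t) \<longlonglongrightarrow> char (?d \<mu>) t"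
        using conv[of "t *\<^sub>R b"] by (simp only: ch[OF \<nu>] ch[OF \<mu>])
    qed (use \<nu> \<mu> rd in auto)
    then have "(\<lambda>n. \<integral>x. ?\<psi> L x \<partial>?d (\<nu> n)) \<longlonglongrightarrow> (\<integral>x. ?\<psi> L x \<partial>?d \<mu>)"
      by (rule weak_conv_imp_integral_bdd_continuous_conv[rotated 2, where B=1])
         (use \<nu> \<mu> rd \<open>0 < L\<close> in \<open>auto intro!: continuous_intros\<close>)
    then show ?thesis using \<nu> \<mu> in1 by simp
  qed
  show "(\<lambda>n. \<integral>x. f x \<partial>\<nu> n) \<longlonglongrightarrow> (\<integral>x. f x \<partial>\<mu>)"
  proof (rule tendstoI)
    fix e :: real assume "0 < e"
    define \<delta> where "\<delta> = min 1 (e / 8)"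
    have \<delta>: "0 < \<delta>" "\<delta> \<le> e / 8" "\<delta> \<le> 1" using \<open>0 < e\<close> by (auto simp: \<delta>_def)
    (* The error is delta on the box and 2 B + 1 times the tail weights, one for each of the d
       coordinates, outside; both parts are to stay below e / 8. *)
    define k where "k = (2 * B + 1) * d"
    have "0 < k" using \<open>0 < d\<close> \<open>0 \<le> B\<close> by (simp add: k_def)
    define \<eta> where "\<eta> = e / (8 * k)"
    have "0 < \<eta>" using \<open>0 < e\<close> \<open>0 < k\<close> by (simp add: \<eta>_def)
    have "\<exists>L0>0. \<forall>L\<ge>L0. (\<integral>x. ?\<psi> L (x \<bullet> b) \<partial>\<mu>) < \<eta>" for b :: 'a
    proof -
      interpret prob_space \<mu> by fact
      have [measurable_cong]: "sets \<mu> = sets borel" by fact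
      have "prob_space (distr \<mu> borel (\<lambda>x. x \<bullet> b))" by (rule prob_space_distr) simp
      from tail_weight_integral_small[OF this _ \<open>0 < \<eta>\<close>]
      show ?thesis by (simp add: integral_distr)
    qed
    then obtain L0 where L0: "\<And>b::'a. 0 < L0 b" "\<And>b L. L0 b \<le> L \<Longrightarrow> (\<integral>x. ?\<psi> L (x \<bullet> b) \<partial>\<mu>) < \<eta>"
      by metis
    define L where "L = Max (L0 ` (Basis :: 'a set))"
    have L0L: "L0 b \<le> L" if "b \<in> Basis" for b :: 'a using that by (auto simp: L_def)
    obtain b0 :: 'a where "b0 \<in> Basis" using nonempty_Basis by blast
    then have "0 < L" using L0L L0(1) less_le_trans by blast
    obtain p where p: "real_polynomial_function p"
      "\<And>x. \<bar>p (sine_vector (pi / (2 * L)) x)\<bar> \<le> B + \<delta>"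
      "\<And>x. (\<And>b. b \<in> Basis \<Longrightarrow> \<bar>x \<bullet> b\<bar> \<le> L) \<Longrightarrow>
       \<bar>f x - p (sine_vector (pi / (2 * L)) x)\<bar> \<le> \<delta>"
      by (rule sine_polynomial_approx[OF f B \<open>0 < L\<close> \<delta>(1)]) blast
    define g where "g x = p (sine_vector (pi / (2 * L)) x)" for x :: 'a
    have g_meas: "g \<in> borel_measurable borel" and f_meas: "f \<in> borel_measurable borel"
    proof -
      have "continuous_on UNIV p"
        using p(1) continuous_on_polymonial_function real_polynomial_function_eq by blast
      then have "continuous_on UNIV g" unfolding g_def
        by (rule continuous_on_compose2) (use \<open>0 < L\<close> in \<open>auto intro!: continuous_intros\<close>)
      then show "g \<in> borel_measurable borel" by (rule borel_measurable_continuous_onI)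
      show "f \<in> borel_measurable borel" by (rule borel_measurable_continuous_onI) fact
    qed
    let ?W = "\<lambda>x::'a. \<Sum>b\<in>Basis. ?\<psi> L (x \<bullet> b)"
    have close: "\<bar>f x - g x\<bar> \<le> \<delta> + (2 * B + 1) * ?W x" for x
    proof (cases "\<forall>b\<in>Basis. \<bar>x \<bullet> b\<bar> \<le> L")
      case True
      then have "\<bar>f x - g x\<bar> \<le> \<delta>" using p(3) by (simp add: g_def)
      moreover have "0 \<le> (2 * B + 1) * ?W x" using \<open>0 \<le> B\<close> by (intro mult_nonneg_nonneg sum_nonneg) auto
      ultimately show ?thesis by linarith
    next
      case False
      then obtain b :: 'a where b: "b \<in> Basis" "L < \<bar>x \<bullet> b\<bar>" by auto
      then have "L\<^sup>2 \<le> (x \<bullet> b)\<^sup>2" using \<open>0 < L\<close> by (metis abs_le_square_iff abs_of_pos less_imp_le)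
      then have "?\<psi> L (x \<bullet> b) = 1" using \<open>0 < L\<close> by (simp add: min_def divide_simps)
      moreover have "?\<psi> L (x \<bullet> b) \<le> ?W x" using b(1) by (intro member_le_sum) auto
      ultimately have W: "(2 * B + 1) * 1 \<le> (2 * B + 1) * ?W x" using \<open>0 \<le> B\<close> by (intro mult_left_mono) auto
      have "\<bar>f x - g x\<bar> \<le> B + (B + \<delta>)" using B[of x] p(2)[of x] by (simp add: g_def)
      also have "\<dots> \<le> \<delta> + (2 * B + 1) * 1" by simp
      also have "\<dots> \<le> \<delta> + (2 * B + 1) * ?W x" using W by (rule add_left_mono)
      finally show ?thesis .
    qed
    have int_close: "\<bar>(\<integral>x. f x \<partial>\<mu>') - (\<integral>x. g x \<partial>\<mu>')\<bar> \<le> \<delta> + (2 * B + 1) * (\<Sum>b\<in>Basis. \<integral>x. ?\<psi> L (x \<bullet> b) \<partial>\<mu>')"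
      if \<mu>': "prob_space \<mu>'" "sets \<mu>' = sets borel" for \<mu>' :: "'a measure"
    proof -
      interpret prob_space \<mu>' by fact
      have i1: "integrable \<mu>' f" using \<mu>' f_meas B by (intro integrable_bounded_borel) auto
      have i2: "integrable \<mu>' g"
        using \<mu>' g_meas p(2) by (intro integrable_bounded_borel[where B="B+\<delta>"]) (auto simp: g_def)
      have i3: "integrable \<mu>' (\<lambda>x. ?\<psi> L (x \<bullet> b))" for b
        using \<mu>' by (intro integrable_bounded_borel[where B=1]) auto
      have "\<bar>(\<integral>x. f x \<partial>\<mu>') - (\<integral>x. g x \<partial>\<mu>')\<bar> = \<bar>\<integral>x. f x - g x \<partial>\<mu>'\<bar>" using i1 i2 by simp
      also have "\<dots> \<le> (\<integral>x. \<bar>f x - g x\<bar> \<partial>\<mu>')" by (rule integral_abs_bound)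
      also have "\<dots> \<le> (\<integral>x. \<delta> + (2 * B + 1) * ?W x \<partial>\<mu>')"
        using i1 i2 i3 close by (intro integral_mono) auto
      also have "\<dots> = \<delta> + (2 * B + 1) * (\<Sum>b\<in>Basis. \<integral>x. ?\<psi> L (x \<bullet> b) \<partial>\<mu>')"
        using i3 by (simp add: prob_space)
      finally show ?thesis .
    qed
    have small: "\<delta> + (2 * B + 1) * (\<Sum>b\<in>Basis. I b) \<le> e / 4" if "\<And>b::'a. b \<in> Basis \<Longrightarrow> I b \<le> \<eta>" for I
    proof -
      have "(\<Sum>b\<in>(Basis::'a set). I b) \<le> (\<Sum>b\<in>(Basis::'a set). \<eta>)" using that by (rule sum_mono)
      then have "(\<Sum>b\<in>(Basis::'a set). I b) \<le> d * \<eta>" by (simp add: d_def)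
      then have "(2 * B + 1) * (\<Sum>b\<in>(Basis::'a set). I b) \<le> (2 * B + 1) * (d * \<eta>)"
        using \<open>0 \<le> B\<close> by (intro mult_left_mono) auto
      also have "\<dots> = k * \<eta>" by (simp add: k_def)
      also have "\<dots> = e / 8" using \<open>0 < k\<close> by (simp add: \<eta>_def)
      finally show ?thesis using \<delta> by simp
    qed
    have "eventually (\<lambda>n. (\<integral>x. ?\<psi> L (x \<bullet> b) \<partial>\<nu> n) < \<eta>) sequentially" if "b \<in> Basis" for b
      using order_tendstoD(2)[OF \<psi>_conv[OF \<open>0 < L\<close>] L0(2)[OF L0L[OF that]]] .
    then have ev1: "eventually (\<lambda>n. \<forall>b\<in>Basis. (\<integral>x. ?\<psi> L (x \<bullet> b) \<partial>\<nu> n) < \<eta>) sequentially"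
      by (simp add: eventually_ball_finite)
    have g_conv: "(\<lambda>n. \<integral>x. g x \<partial>\<nu> n) \<longlonglongrightarrow> (\<integral>x. g x \<partial>\<mu>)"
    proof -
      have "(\<lambda>n. \<integral>x. complex_of_real (g x) \<partial>\<nu> n) \<longlonglongrightarrow> (\<integral>x. complex_of_real (g x) \<partial>\<mu>)"
        using trig_poly_integrable_tendsto[OF \<nu> \<mu> conv trig_poly_polynomial_of_sines[OF p(1)]]
        unfolding g_def by blast
      then show ?thesis by (simp only: integral_complex_of_real tendsto_of_real_iff)
    qed
    have "eventually (\<lambda>n. dist (\<integral>x. g x \<partial>\<nu> n) (\<integral>x. g x \<partial>\<mu>) < e / 4) sequentially"
      using g_conv \<open>0 < e\<close> by (intro tendstoD) auto
    with ev1 show "eventually (\<lambda>n. dist (\<integral>x. f x \<partial>\<nu> n) (\<integral>x. f x \<partial>\<mu>) < e) sequentially"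
    proof eventually_elim
      case (elim n)
      have "\<bar>(\<integral>x. f x \<partial>\<nu> n) - (\<integral>x. g x \<partial>\<nu> n)\<bar> \<le> e / 4"
        using int_close[OF \<nu>(1) \<nu>(2), of n] small[of "\<lambda>b. \<integral>x. ?\<psi> L (x \<bullet> b) \<partial>\<nu> n"] elim(1) by force
      moreover have "\<bar>(\<integral>x. f x \<partial>\<mu>) - (\<integral>x. g x \<partial>\<mu>)\<bar> \<le> e / 4"
        using int_close[OF \<mu>] small[of "\<lambda>b. \<integral>x. ?\<psi> L (x \<bullet> b) \<partial>\<mu>"] L0(2) L0L by force
      ultimately show ?case using elim(2) \<open>0 < e\<close> unfolding dist_real_def by linarith
    qed
  qed
qed

section \<open>Gaussian laws\<close>
lemma centered_normal_real_distribution: "0 \<le> v \<Longrightarrow> real_distribution (centered_normal v)"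
  unfolding centered_normal_def real_distribution_def real_distribution_axioms_def
  by (auto intro!: prob_space_return prob_space_normal_density)

lemma char_centered_normal:
  assumes "0 \<le> v"
  shows "char (centered_normal v) t = exp (- v * t\<^sup>2 / 2)"
proof (cases "v = 0")
  case True
  then show ?thesis by (simp add: centered_normal_def char_def integral_return)
next
  case False
  then have v: "0 < v" using assms by simp
  interpret N: prob_space std_normal_distribution
    using real_dist_normal_dist by (simp add: real_distribution_def)
  have "distributed std_normal_distribution lborel (\<lambda>x. x) (normal_density 0 1)"
    by (auto simp: distributed_def intro: distr_id2)
  from N.normal_density_affine[OF this, of "sqrt v" 0] v
  have "distributed std_normal_distribution lborel (\<lambda>x. sqrt v * x) (normal_density 0 (sqrt v))"
    by simp
  then have "distr std_normal_distribution lborel (\<lambda>x. sqrt v * x) = centered_normal v"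
    using v by (simp add: distributed_def centered_normal_def)
  then have "centered_normal v = distr std_normal_distribution borel (\<lambda>x. sqrt v * x)"
    by (simp cong: distr_cong)
  then have "char (centered_normal v) t = char std_normal_distribution (sqrt v * t)"
    unfolding char_def by (simp add: integral_distr ac_simps)
  also have "\<dots> = exp (- v * t\<^sup>2 / 2)"
    using v by (simp add: char_std_normal_distribution power_mult_distrib)
  finally show ?thesis .
qed

text \<open>
The image of two independent standard normal variables under the matrix with rows \<open>(a, 0)\<close> and
\<open>(b, c)\<close>. Comparing characteristic functions treats the degenerate cases along with the others.
\<close>
lemma gaussian_plane_exists:
  fixes a b c :: real
  shows "\<exists>\<mu> :: (real^2) measure. prob_space \<mu> \<and> sets \<mu> = sets borel \<and>
    (\<forall>t. distr \<mu> borel (\<lambda>x. t \<bullet> x) = centered_normal ((t$1 * a + t$2 * b)\<^sup>2 + (t$2 * c)\<^sup>2))"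
proof -
  let ?N = std_normal_distribution
  interpret N: prob_space ?N
    using real_dist_normal_dist by (simp add: real_distribution_def)
  interpret P: pair_prob_space ?N ?N ..
  let ?L = "\<lambda>z::real \<times> real. vector [a * fst z, b * fst z + c * snd z] :: real^2"
  have L_meas: "?L \<in> borel_measurable (?N \<Otimes>\<^sub>M ?N)"
  proof -
    have "?L = (\<lambda>z. (a * fst z) *\<^sub>R axis 1 1 + (b * fst z + c * snd z) *\<^sub>R axis 2 1)"
      by (auto simp: vec_eq_iff forall_2 axis_def)
    then show ?thesis by simp
  qed
  let ?\<mu> = "distr (?N \<Otimes>\<^sub>M ?N) borel ?L"
  have "prob_space ?\<mu>" using L_meas by (rule P.prob_space_distr)
  moreover have "distr ?\<mu> borel (\<lambda>x. t \<bullet> x) = centered_normal ((t$1 * a + t$2 * b)\<^sup>2 + (t$2 * c)\<^sup>2)"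
    (is "?D = centered_normal ?v") for t :: "real^2"
  proof (rule Levy_uniqueness)
    let ?p = "t$1 * a + t$2 * b" and ?q = "t$2 * c"
    have v: "0 \<le> ?v" by simp
    show "real_distribution (centered_normal ?v)" using v by (rule centered_normal_real_distribution)
    have tL: "t \<bullet> ?L z = ?p * fst z + ?q * snd z" for z
      by (simp add: inner_vec_def sum_2 algebra_simps)
    interpret \<mu>: prob_space ?\<mu> by fact
    show "real_distribution ?D" by (rule \<mu>.real_distribution_distr) simp
    show "char ?D = char (centered_normal ?v)"
    proof
      fix s
      have i: "integrable ?N (\<lambda>x. iexp (r * x))" for r
        by (rule N.integrable_const_bound[where B=1]) auto
      have "char ?D s = (\<integral>z. iexp (s * (t \<bullet> ?L z)) \<partial>(?N \<Otimes>\<^sub>M ?N))"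
        unfolding char_def using L_meas by (simp add: integral_distr)
      also have "\<dots> = (\<integral>z. iexp ((s * ?p) * fst z) * iexp ((s * ?q) * snd z) \<partial>(?N \<Otimes>\<^sub>M ?N))"
        by (simp add: tL exp_add[symmetric] algebra_simps del: fst_conv)
      also have "\<dots> = (\<integral>x. \<integral>y. iexp ((s * ?p) * x) * iexp ((s * ?q) * y) \<partial>?N \<partial>?N)"
        by (subst P.integral_fst'[symmetric])
           (auto intro!: P.integrable_const_bound[where B=1] simp: norm_mult)
      also have "\<dots> = (\<integral>x. iexp ((s * ?p) * x) \<partial>?N) * (\<integral>y. iexp ((s * ?q) * y) \<partial>?N)"
        by (simp del: of_real_mult)
      also have "\<dots> = char ?N (s * ?p) * char ?N (s * ?q)" by (simp add: char_def)
      also have "\<dots> = exp (- ?v * s\<^sup>2 / 2)"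
        by (simp add: char_std_normal_distribution exp_add[symmetric] of_real_mult[symmetric] del: of_real_mult)
           (simp add: power2_eq_square algebra_simps add_divide_distrib)
      also have "\<dots> = char (centered_normal ?v) s" using char_centered_normal[OF v] by simp
      finally show "char ?D s = char (centered_normal ?v) s" .
    qed
  qed
  ultimately show ?thesis by (intro exI[of _ ?\<mu>]) auto
qed

section \<open>A central limit theorem for transforms of innovations\<close>
lemma norm_integral_le:
  fixes f :: "'a \<Rightarrow> 'b::{banach, second_countable_topology}"
  assumes "integrable M f" "integrable M g" "\<And>x. x \<in> space M \<Longrightarrow> norm (f x) \<le> g x"
  shows "norm (\<integral>x. f x \<partial>M) \<le> (\<integral>x. g x \<partial>M)"
proof -
  have "norm (\<integral>x. f x \<partial>M) \<le> (\<integral>x. norm (f x) \<partial>M)" by (rule integral_norm_bound)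
  also have "\<dots> \<le> (\<integral>x. g x \<partial>M)" using assms by (intro integral_mono) auto
  finally show ?thesis .
qed

lemma integrable_mult_of_squares:
  fixes f g :: "'a \<Rightarrow> real"
  assumes "f \<in> borel_measurable M" "g \<in> borel_measurable M"
    and "integrable M (\<lambda>x. (f x)\<^sup>2)" "integrable M (\<lambda>x. (g x)\<^sup>2)"
  shows "integrable M (\<lambda>x. f x * g x)"
proof (rule Bochner_Integration.integrable_bound)
  show "integrable M (\<lambda>x. (f x)\<^sup>2 + (g x)\<^sup>2)" using assms by simp
  have "\<bar>a * b\<bar> \<le> a\<^sup>2 + b\<^sup>2" for a b :: real
  proof -
    have "0 \<le> (\<bar>a\<bar> - \<bar>b\<bar>)\<^sup>2" by simp
    then have "2 * (\<bar>a\<bar> * \<bar>b\<bar>) \<le> a\<^sup>2 + b\<^sup>2" by (simp add: power2_diff)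
    then show ?thesis using mult_nonneg_nonneg[of "\<bar>a\<bar>" "\<bar>b\<bar>"] unfolding abs_mult by linarith
  qed
  then show "AE x in M. norm (f x * g x) \<le> norm ((f x)\<^sup>2 + (g x)\<^sup>2)" by auto
qed (use assms in measurable)

lemma iexp_second_order: "cmod (iexp x - 1 - \<i> * x + x\<^sup>2 / 2) \<le> \<bar>x\<bar> ^ 3"
proof -
  have "cmod (iexp x - (\<Sum>k\<le>2. (\<i> * x) ^ k / fact k)) \<le> \<bar>x\<bar> ^ 3 / fact 3"
    using iexp_approx1[of x 2] by (simp add: eval_nat_numeral)
  also have "(\<Sum>k\<le>2. (\<i> * x) ^ k / fact k) = 1 + \<i> * x - x\<^sup>2 / 2"
    by (simp add: eval_nat_numeral power_mult_distrib)
  also have "\<bar>x\<bar> ^ 3 / fact 3 \<le> \<bar>x\<bar> ^ 3" by (simp add: fact_numeral)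
  finally show ?thesis by (simp add: algebra_simps)
qed

text \<open>
The factor \<open>e\<^sup>q\<close> compensates the drift \<open>1 - q\<close> of \<open>e\<^sup>i\<^sup>\<xi>\<close>, \<open>q\<close> being half the conditional variance, up
to second order in \<open>q\<close>.
\<close>
lemma exp_compensation:
  assumes "0 \<le> (q::real)"
  shows "\<bar>exp q * (1 - q) - 1\<bar> \<le> exp q * q\<^sup>2"
proof -
  have "exp (- q) \<le> inverse (1 + q)"
    using exp_ge_add_one_self[of q] assms by (simp add: exp_minus le_imp_inverse_le)
  also have "\<dots> \<le> 1 - q + q\<^sup>2"
  proof -
    have "1 \<le> (1 + q) * (1 - q + q\<^sup>2)" using assms by (simp add: algebra_simps power2_eq_square)
    then show ?thesis using assms by (simp add: field_simps)
  qed
  finally have "exp q * exp (- q) \<le> exp q * (1 - q + q\<^sup>2)" by (intro mult_left_mono) auto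
  then have "1 - exp q * (1 - q) \<le> exp q * q\<^sup>2" by (simp add: exp_minus algebra_simps)
  moreover have "exp q * (1 - q) \<le> exp q * exp (- q)"
    using exp_ge_add_one_self[of "- q"] by (intro mult_left_mono) auto
  then have "exp q * (1 - q) \<le> 1" by (simp add: exp_minus)
  ultimately show ?thesis by linarith
qed

locale filtered_prob_space = prob_space M for M :: "'a measure" +
  fixes F :: "nat \<Rightarrow> 'a measure"
  assumes subalgebra_F: "\<And>k. subalgebra M (F k)"
    and F_mono: "\<And>k l. k \<le> l \<Longrightarrow> subalgebra (F l) (F k)"
begin

lemma measurable_F_M: "f \<in> borel_measurable (F k) \<Longrightarrow> f \<in> borel_measurable M"
  using measurable_from_subalg[OF subalgebra_F] .

lemma measurable_F_le: "f \<in> borel_measurable (F k) \<Longrightarrow> k \<le> l \<Longrightarrow> f \<in> borel_measurable (F l)"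
  using measurable_from_subalg[OF F_mono] .

text \<open>
The index is shifted against the filtration: \<open>U k\<close> is the innovation between the times \<open>k\<close> and
\<open>k + 1\<close>. A weight \<open>W k\<close> for \<open>U k\<close> then has to be measurable at time \<open>k\<close>.
\<close>
definition innovation :: "(nat \<Rightarrow> 'a \<Rightarrow> real) \<Rightarrow> bool" where
  "innovation U \<longleftrightarrow> (\<forall>k. U k \<in> borel_measurable (F (Suc k)) \<and>
     indep_set (sets (F k)) (sets (vimage_algebra (space M) (U k) borel)))"

lemma innovation_measurable:
  "innovation U \<Longrightarrow> U k \<in> borel_measurable (F (Suc k))"
  "innovation U \<Longrightarrow> U k \<in> borel_measurable M"
  by (auto simp: innovation_def intro: measurable_F_M)

lemma innovation_indep_var:
  fixes A :: "'a \<Rightarrow> 'b::topological_space"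
  assumes U: "innovation U" and A: "A \<in> borel_measurable (F k)" and g: "g \<in> borel_measurable borel"
  shows "indep_var borel A borel (\<lambda>\<omega>. g (U k \<omega>))"
  unfolding indep_var_eq
proof (intro conjI)
  show "random_variable borel A" using A by (rule measurable_F_M)
  show "random_variable borel (\<lambda>\<omega>. g (U k \<omega>))"
    using innovation_measurable(2)[OF U] g by measurable
  let ?A = "{A -` S \<inter> space M |S. S \<in> sets borel}"
  let ?B = "{(\<lambda>\<omega>. g (U k \<omega>)) -` S \<inter> space M |S. S \<in> sets borel}"
  have sp: "space (F k) = space M" using subalgebra_F by (simp add: subalgebra_def)
  have "sigma_sets (space M) ?A \<subseteq> sets (F k)"
    using sets.sigma_sets_subset[of ?A "F k"]
      measurable_sets[OF A] by (auto simp: sp)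
  moreover have "sigma_sets (space M) ?B \<subseteq> sets (vimage_algebra (space M) (U k) borel)"
  proof -
    have "(\<lambda>\<omega>. g (U k \<omega>)) -` S \<inter> space M \<in> sets (vimage_algebra (space M) (U k) borel)"
      if "S \<in> sets borel" for S
    proof -
      have "g -` S \<in> sets borel" using measurable_sets[OF g that] by simp
      moreover have "(\<lambda>\<omega>. g (U k \<omega>)) -` S \<inter> space M = U k -` (g -` S) \<inter> space M" by auto
      ultimately show ?thesis by (auto intro!: in_vimage_algebra)
    qed
    then show ?thesis
      using sets.sigma_sets_subset[of ?B "vimage_algebra (space M) (U k) borel"] by auto
  qed
  moreover have "indep_set (sets (F k)) (sets (vimage_algebra (space M) (U k) borel))"
    using U by (simp add: innovation_def)
  ultimately show "indep_set (sigma_sets (space M) ?A) (sigma_sets (space M) ?B)"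
    unfolding indep_sets2_eq by blast
qed

lemma
  fixes A :: "'a \<Rightarrow> 'b::{real_normed_field, banach, second_countable_topology}"
  assumes U: "innovation U" and A: "A \<in> borel_measurable (F k)" and g: "g \<in> borel_measurable borel"
    and int: "integrable M A" "integrable M (\<lambda>\<omega>. g (U k \<omega>))"
  shows innovation_integrable: "integrable M (\<lambda>\<omega>. A \<omega> * g (U k \<omega>))"
    and innovation_expectation:
      "(\<integral>\<omega>. A \<omega> * g (U k \<omega>) \<partial>M) = (\<integral>\<omega>. A \<omega> \<partial>M) * (\<integral>\<omega>. g (U k \<omega>) \<partial>M)"
  using indep_var_integrable[OF innovation_indep_var[OF U A g] int]
    indep_var_lebesgue_integral[OF innovation_indep_var[OF U A g] int] by auto

lemma innovation_compose:
  assumes U: "innovation U" and g: "g \<in> borel_measurable borel"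
  shows "innovation (\<lambda>k \<omega>. g (U k \<omega>))"
  unfolding innovation_def
proof (intro allI conjI)
  fix k
  show "(\<lambda>\<omega>. g (U k \<omega>)) \<in> borel_measurable (F (Suc k))"
    using innovation_measurable(1)[OF U] g by measurable
  have "g -` S \<in> sets borel" if "S \<in> sets borel" for S
    using measurable_sets[OF g that] by simp
  moreover have "(\<lambda>\<omega>. g (U k \<omega>)) -` S \<inter> space M = U k -` (g -` S) \<inter> space M" for S by auto
  ultimately have "sets (vimage_algebra (space M) (\<lambda>\<omega>. g (U k \<omega>)) borel) \<subseteq> sets (vimage_algebra (space M) (U k) borel)"
    by (auto simp: sets_vimage_algebra2)
  moreover have "indep_set (sets (F k)) (sets (vimage_algebra (space M) (U k) borel))"
    using U by (simp add: innovation_def)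
  ultimately show "indep_set (sets (F k)) (sets (vimage_algebra (space M) (\<lambda>\<omega>. g (U k \<omega>)) borel))"
    unfolding indep_sets2_eq by blast
qed

text \<open>
The mixed terms vanish, since \<open>U k\<close> is centered and independent of everything that multiplies it.
\<close>
lemma innovation_sum_second_moment:
  assumes U: "innovation U" and W: "\<And>k. W k \<in> borel_measurable (F k)"
    and W2: "\<And>k. integrable M (\<lambda>\<omega>. (W k \<omega>)\<^sup>2)" and U2: "\<And>k. integrable M (\<lambda>\<omega>. (U k \<omega>)\<^sup>2)"
    and mean: "\<And>k. expectation (U k) = 0"
  shows "integrable M (\<lambda>\<omega>. (\<Sum>k<n. W k \<omega> * U k \<omega>)\<^sup>2) \<and>
    expectation (\<lambda>\<omega>. (\<Sum>k<n. W k \<omega> * U k \<omega>)\<^sup>2) =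
      (\<Sum>k<n. expectation (\<lambda>\<omega>. (W k \<omega>)\<^sup>2) * expectation (\<lambda>\<omega>. (U k \<omega>)\<^sup>2))"
proof (induction n)
  case (Suc n)
  let ?S = "\<lambda>\<omega>. \<Sum>k<n. W k \<omega> * U k \<omega>"
  have U_F: "U k \<in> borel_measurable (F n)" "W k \<in> borel_measurable (F n)" if "k < n" for k
    using that measurable_F_le[OF innovation_measurable(1)[OF U]] measurable_F_le[OF W]
    by auto
  have S_F: "?S \<in> borel_measurable (F n)" using U_F by (intro borel_measurable_sum borel_measurable_times) auto
  note [measurable] = measurable_F_M[OF W] innovation_measurable(2)[OF U] measurable_F_M[OF S_F]
  have SW: "(\<lambda>\<omega>. ?S \<omega> * W n \<omega>) \<in> borel_measurable (F n)" using S_F W by measurable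
  have W2F: "(\<lambda>\<omega>. (W n \<omega>)\<^sup>2) \<in> borel_measurable (F n)" using W by measurable
  have SW_int: "integrable M (\<lambda>\<omega>. ?S \<omega> * W n \<omega>)"
    by (rule integrable_mult_of_squares) (use Suc W2 in auto)
  have U_int: "integrable M (U n)" by (rule square_integrable_imp_integrable[OF _ U2]) simp
  have 1: "integrable M (\<lambda>\<omega>. (?S \<omega> * W n \<omega>) * U n \<omega>)"
     "expectation (\<lambda>\<omega>. (?S \<omega> * W n \<omega>) * U n \<omega>) = 0"
    using innovation_integrable[OF U SW, of "\<lambda>x. x"] innovation_expectation[OF U SW, of "\<lambda>x. x"]
      SW_int U_int mean by auto
  have 2: "integrable M (\<lambda>\<omega>. (W n \<omega>)\<^sup>2 * (U n \<omega>)\<^sup>2)"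
     "expectation (\<lambda>\<omega>. (W n \<omega>)\<^sup>2 * (U n \<omega>)\<^sup>2) = expectation (\<lambda>\<omega>. (W n \<omega>)\<^sup>2) * expectation (\<lambda>\<omega>. (U n \<omega>)\<^sup>2)"
    using innovation_integrable[OF U W2F, of "\<lambda>x. x\<^sup>2"] innovation_expectation[OF U W2F, of "\<lambda>x. x\<^sup>2"]
      W2 U2 by auto
  have eq: "(\<Sum>k<Suc n. W k \<omega> * U k \<omega>)\<^sup>2 =
     (?S \<omega>)\<^sup>2 + 2 * ((?S \<omega> * W n \<omega>) * U n \<omega>) + (W n \<omega>)\<^sup>2 * (U n \<omega>)\<^sup>2" for \<omega>
    by (simp add: power2_sum power_mult_distrib)
  show ?case unfolding eq using 1 2 Suc by simp
qed simp

text \<open>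
The exponential \<open>H n = exp (i \<Sum> W\<^sub>k U\<^sub>k + v/2 \<Sum> W\<^sub>k\<^sup>2)\<close> is almost a martingale. In the increment
\<open>H (n + 1) - H n\<close> the terms of first order in \<open>U n\<close> and in \<open>v - (U n)\<^sup>2\<close> have expectation zero by
independence, and the remainder is of third order in the weight. The bound \<open>T\<close> on the compensator
keeps \<open>H\<close> bounded.
\<close>
lemma compensated_exponential_expectation:
  assumes U: "innovation U" and W: "\<And>k. W k \<in> borel_measurable (F k)"
    and mean: "\<And>k. expectation (U k) = 0"
    and U2: "\<And>k. integrable M (\<lambda>\<omega>. (U k \<omega>)\<^sup>2)" "\<And>k. expectation (\<lambda>\<omega>. (U k \<omega>)\<^sup>2) = v"
    and U3: "\<And>k. integrable M (\<lambda>\<omega>. \<bar>U k \<omega>\<bar> ^ 3)" "\<And>k. expectation (\<lambda>\<omega>. \<bar>U k \<omega>\<bar> ^ 3) \<le> \<beta>"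
    and W3: "\<And>k. expectation (\<lambda>\<omega>. \<bar>W k \<omega>\<bar> ^ 3) \<le> C"
    and T: "\<And>n \<omega>. \<omega> \<in> space M \<Longrightarrow> (\<Sum>k<n. (W k \<omega>)\<^sup>2) \<le> T"
  shows "cmod ((\<integral>\<omega>. iexp (\<Sum>k<n. W k \<omega> * U k \<omega>) * exp (v / 2 * (\<Sum>k<n. (W k \<omega>)\<^sup>2)) \<partial>M) - 1)
    \<le> real n * (exp (v * T / 2) * (\<beta> + v\<^sup>2 * (1 + T)) * C)"
proof (induction n)
  case 0
  then show ?case by (simp add: prob_space)
next
  case (Suc n)
  have v: "0 \<le> v" unfolding U2(2)[of 0, symmetric] by simp
  define E0 where "E0 = exp (v * T / 2)"
  define S where "S n \<omega> = (\<Sum>k<n. W k \<omega> * U k \<omega>)" for n \<omega>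
  define Q where "Q n \<omega> = v / 2 * (\<Sum>k<n. (W k \<omega>)\<^sup>2)" for n \<omega>
  define H where "H n \<omega> = iexp (S n \<omega>) * complex_of_real (exp (Q n \<omega>))" for n \<omega>
  define q where "q \<omega> = v / 2 * (W n \<omega>)\<^sup>2" for \<omega>
  define A1 where "A1 \<omega> = H n \<omega> * complex_of_real (exp (q \<omega>)) * \<i> * complex_of_real (W n \<omega>)" for \<omega>
  define A2 where "A2 \<omega> = H n \<omega> * complex_of_real (exp (q \<omega>) * (W n \<omega>)\<^sup>2 / 2)" for \<omega>
  define R where "R \<omega> = H (Suc n) \<omega> - H n \<omega> - A1 \<omega> * U n \<omega> - A2 \<omega> * complex_of_real (v - (U n \<omega>)\<^sup>2)" for \<omega>
  have "0 \<le> T" if "\<omega> \<in> space M" for \<omega> using T[OF that, of 0] by simp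
  then have "0 \<le> T" using not_empty by blast
  have W_le: "(W n \<omega>)\<^sup>2 \<le> T" "\<bar>W n \<omega>\<bar> \<le> 1 + T" if "\<omega> \<in> space M" for \<omega>
  proof -
    have "(W n \<omega>)\<^sup>2 \<le> (\<Sum>k<Suc n. (W k \<omega>)\<^sup>2)" by (simp add: sum_nonneg)
    then show *: "(W n \<omega>)\<^sup>2 \<le> T" using T[OF that, of "Suc n"] by linarith
    have "0 \<le> (\<bar>W n \<omega>\<bar> - 1)\<^sup>2" by simp
    then have "2 * \<bar>W n \<omega>\<bar> \<le> (W n \<omega>)\<^sup>2 + 1" by (simp add: power2_diff)
    then show "\<bar>W n \<omega>\<bar> \<le> 1 + T" using * \<open>0 \<le> T\<close> by linarith
  qed
  have H_F: "H n \<in> borel_measurable (F n)"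
  proof -
    have "U k \<in> borel_measurable (F n)" "W k \<in> borel_measurable (F n)" if "k < n" for k
      using that measurable_F_le[OF innovation_measurable(1)[OF U]] measurable_F_le[OF W] by auto
    then have "S n \<in> borel_measurable (F n)" "Q n \<in> borel_measurable (F n)"
      unfolding S_def Q_def by (auto intro!: borel_measurable_sum borel_measurable_times borel_measurable_power)
    then show ?thesis unfolding H_def by measurable
  qed
  have A_F: "A1 \<in> borel_measurable (F n)" "A2 \<in> borel_measurable (F n)"
    unfolding A1_def A2_def q_def using H_F W by measurable
  note [measurable] = measurable_F_M[OF W] innovation_measurable(2)[OF U]
  have [measurable]: "H k \<in> borel_measurable M" for k unfolding H_def S_def Q_def by measurable
  have [measurable]: "A1 \<in> borel_measurable M" "A2 \<in> borel_measurable M" "q \<in> borel_measurable M"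
    using A_F by (auto intro: measurable_F_M simp: q_def[abs_def])
  have Q_le: "Q k \<omega> \<le> v * T / 2" if "\<omega> \<in> space M" for k \<omega>
    unfolding Q_def using mult_left_mono[OF T[OF that, of k], of "v/2"] v by simp
  have H_norm: "cmod (H k \<omega>) \<le> E0" if "\<omega> \<in> space M" for k \<omega>
    using Q_le[OF that, of k] by (simp add: H_def norm_mult E0_def)
  have Q_Suc: "Q (Suc n) \<omega> = Q n \<omega> + q \<omega>" for \<omega> by (simp add: Q_def q_def algebra_simps)
  have Hq_norm: "cmod (H n \<omega>) * exp (q \<omega>) \<le> E0" if "\<omega> \<in> space M" for \<omega>
    using Q_le[OF that, of "Suc n"] by (simp add: H_def norm_mult E0_def Q_Suc exp_add[symmetric])
  have int_H: "integrable M (H k)" for k using H_norm by (intro integrable_const_bound[where B=E0]) auto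
  have int_A1: "integrable M A1"
  proof (rule integrable_const_bound[where B="E0 * (1 + T)"])
    show "AE \<omega> in M. cmod (A1 \<omega>) \<le> E0 * (1 + T)"
      using Hq_norm W_le by (intro AE_I2) (auto simp: A1_def norm_mult E0_def intro!: mult_mono)
  qed simp
  have int_A2: "integrable M A2"
  proof (rule integrable_const_bound[where B="E0 * T"])
    have "cmod (A2 \<omega>) \<le> E0 * T" if "\<omega> \<in> space M" for \<omega>
    proof -
      have "cmod (A2 \<omega>) = (cmod (H n \<omega>) * exp (q \<omega>)) * ((W n \<omega>)\<^sup>2 / 2)"
        by (simp add: A2_def norm_mult norm_divide norm_power)
      also have "\<dots> \<le> E0 * T" using Hq_norm[OF that] W_le[OF that] \<open>0 \<le> T\<close>
        by (intro mult_mono) (auto simp: E0_def)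
      finally show ?thesis .
    qed
    then show "AE \<omega> in M. cmod (A2 \<omega>) \<le> E0 * T" by auto
  qed simp
  have int_U: "integrable M (U n)" by (rule square_integrable_imp_integrable[OF _ U2(1)]) simp
  have A1U: "integrable M (\<lambda>\<omega>. A1 \<omega> * complex_of_real (U n \<omega>))" "(\<integral>\<omega>. A1 \<omega> * complex_of_real (U n \<omega>) \<partial>M) = 0"
    using innovation_integrable[OF U A_F(1), of complex_of_real] innovation_expectation[OF U A_F(1), of complex_of_real]
      int_A1 int_U mean by auto
  have A2U: "integrable M (\<lambda>\<omega>. A2 \<omega> * complex_of_real (v - (U n \<omega>)\<^sup>2))" "(\<integral>\<omega>. A2 \<omega> * complex_of_real (v - (U n \<omega>)\<^sup>2) \<partial>M) = 0"
    using innovation_integrable[OF U A_F(2), of "\<lambda>x. complex_of_real (v - x\<^sup>2)"]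
      innovation_expectation[OF U A_F(2), of "\<lambda>x. complex_of_real (v - x\<^sup>2)"]
      int_A2 U2 by (auto simp: prob_space simp del: of_real_diff of_real_power)
  have int_R: "integrable M R" unfolding R_def using int_H A1U(1) A2U(1) by (intro Bochner_Integration.integrable_diff)
  have EH: "(\<integral>\<omega>. H (Suc n) \<omega> \<partial>M) = (\<integral>\<omega>. H n \<omega> \<partial>M) + (\<integral>\<omega>. R \<omega> \<partial>M)"
    unfolding R_def using int_H A1U A2U by (simp del: of_real_diff of_real_power)
  let ?EW = "expectation (\<lambda>\<omega>. \<bar>W n \<omega>\<bar> ^ 3)" and ?EU = "expectation (\<lambda>\<omega>. \<bar>U n \<omega>\<bar> ^ 3)"
  have W3_bdd: "integrable M (\<lambda>\<omega>. \<bar>W n \<omega>\<bar> ^ 3)"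
    using W_le(2) by (intro integrable_const_bound[where B="(1 + T) ^ 3"]) (auto intro!: power_mono)
  have WF3: "(\<lambda>\<omega>. \<bar>W n \<omega>\<bar> ^ 3) \<in> borel_measurable (F n)" using W by measurable
  have WU3: "integrable M (\<lambda>\<omega>. \<bar>W n \<omega>\<bar> ^ 3 * \<bar>U n \<omega>\<bar> ^ 3)"
    "expectation (\<lambda>\<omega>. \<bar>W n \<omega>\<bar> ^ 3 * \<bar>U n \<omega>\<bar> ^ 3) = ?EW * ?EU"
    using innovation_integrable[OF U WF3, of "\<lambda>x. \<bar>x\<bar> ^ 3"] innovation_expectation[OF U WF3, of "\<lambda>x. \<bar>x\<bar> ^ 3"]
      W3_bdd U3(1) by auto
  have R_le: "cmod (R \<omega>) \<le> E0 * (\<bar>W n \<omega>\<bar> ^ 3 * \<bar>U n \<omega>\<bar> ^ 3 + v\<^sup>2 * (1 + T) * \<bar>W n \<omega>\<bar> ^ 3)" if "\<omega> \<in> space M" for \<omega>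
  proof -
    let ?e = "complex_of_real (exp (q \<omega>))" and ?x = "W n \<omega> * U n \<omega>"
    have S_Suc: "iexp (S (Suc n) \<omega>) = iexp (S n \<omega>) * iexp ?x"
      by (simp add: S_def exp_add distrib_left)
    have "H (Suc n) \<omega> = H n \<omega> * ?e * iexp ?x"
      unfolding H_def Q_Suc exp_add of_real_mult S_Suc by (simp only: mult_ac)
    then have "R \<omega> = H n \<omega> * ?e * (iexp ?x - 1 - \<i> * ?x + ?x\<^sup>2 / 2) + H n \<omega> * complex_of_real (exp (q \<omega>) * (1 - q \<omega>) - 1)"
      by (simp add: R_def A1_def A2_def q_def field_simps power2_eq_square)
    then have "cmod (R \<omega>) \<le> cmod (H n \<omega> * ?e * (iexp ?x - 1 - \<i> * ?x + ?x\<^sup>2 / 2)) + cmod (H n \<omega> * complex_of_real (exp (q \<omega>) * (1 - q \<omega>) - 1))"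
      using norm_triangle_ineq by metis
    also have "\<dots> = (cmod (H n \<omega>) * exp (q \<omega>)) * cmod (iexp ?x - 1 - \<i> * ?x + ?x\<^sup>2 / 2)
        + cmod (H n \<omega>) * \<bar>exp (q \<omega>) * (1 - q \<omega>) - 1\<bar>"
      unfolding norm_mult norm_of_real by simp
    also have "\<dots> \<le> (cmod (H n \<omega>) * exp (q \<omega>)) * \<bar>?x\<bar> ^ 3 + cmod (H n \<omega>) * (exp (q \<omega>) * (q \<omega>)\<^sup>2)"
      using iexp_second_order[of ?x] exp_compensation[of "q \<omega>"] v by (intro add_mono mult_left_mono) (auto simp: q_def)
    also have "\<dots> = (cmod (H n \<omega>) * exp (q \<omega>)) * (\<bar>?x\<bar> ^ 3 + (q \<omega>)\<^sup>2)" by (simp add: algebra_simps)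
    also have "\<dots> \<le> E0 * (\<bar>?x\<bar> ^ 3 + (q \<omega>)\<^sup>2)" using Hq_norm[OF that] by (intro mult_right_mono) auto
    also have "\<dots> \<le> E0 * (\<bar>W n \<omega>\<bar> ^ 3 * \<bar>U n \<omega>\<bar> ^ 3 + v\<^sup>2 * (1 + T) * \<bar>W n \<omega>\<bar> ^ 3)"
    proof (intro mult_left_mono add_mono)
      show "\<bar>?x\<bar> ^ 3 \<le> \<bar>W n \<omega>\<bar> ^ 3 * \<bar>U n \<omega>\<bar> ^ 3" by (simp add: abs_mult power_mult_distrib)
      have "(q \<omega>)\<^sup>2 = (v\<^sup>2 / 4) * (\<bar>W n \<omega>\<bar> * \<bar>W n \<omega>\<bar> ^ 3)"
        by (simp add: q_def power_mult_distrib power_divide power4_eq_xxxx power3_eq_cube flip: power_mult)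
      also have "\<dots> \<le> v\<^sup>2 * ((1 + T) * \<bar>W n \<omega>\<bar> ^ 3)"
        using W_le(2)[OF that] by (intro mult_mono) auto
      finally show "(q \<omega>)\<^sup>2 \<le> v\<^sup>2 * (1 + T) * \<bar>W n \<omega>\<bar> ^ 3" by (simp add: mult.assoc)
    qed (simp add: E0_def)
    finally show ?thesis .
  qed
  have "cmod (\<integral>\<omega>. R \<omega> \<partial>M) \<le> (\<integral>\<omega>. E0 * (\<bar>W n \<omega>\<bar> ^ 3 * \<bar>U n \<omega>\<bar> ^ 3 + v\<^sup>2 * (1 + T) * \<bar>W n \<omega>\<bar> ^ 3) \<partial>M)"
    using WU3(1) W3_bdd R_le int_R by (intro norm_integral_le) auto
  also have "\<dots> = E0 * (?EW * ?EU + v\<^sup>2 * (1 + T) * ?EW)"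
    using WU3 W3_bdd by simp
  also have "\<dots> \<le> E0 * (C * \<beta> + v\<^sup>2 * (1 + T) * C)"
  proof -
    have "0 \<le> ?EW" "0 \<le> ?EU" by (auto intro: integral_nonneg)
    moreover have "0 \<le> C" using calculation(1) W3[of n] by linarith
    ultimately show ?thesis using W3[of n] U3(2)[of n] \<open>0 \<le> T\<close> by (intro mult_left_mono add_mono mult_mono) (auto simp: E0_def)
  qed
  finally have ER: "cmod (\<integral>\<omega>. R \<omega> \<partial>M) \<le> E0 * (\<beta> + v\<^sup>2 * (1 + T)) * C" by (simp add: algebra_simps)
  have "cmod ((\<integral>\<omega>. H (Suc n) \<omega> \<partial>M) - 1) \<le> cmod ((\<integral>\<omega>. H n \<omega> \<partial>M) - 1) + cmod (\<integral>\<omega>. R \<omega> \<partial>M)"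
    unfolding EH using norm_triangle_ineq[of "(\<integral>\<omega>. H n \<omega> \<partial>M) - 1" "\<integral>\<omega>. R \<omega> \<partial>M"] by (simp add: algebra_simps)
  also have "\<dots> \<le> real n * (E0 * (\<beta> + v\<^sup>2 * (1 + T)) * C) + E0 * (\<beta> + v\<^sup>2 * (1 + T)) * C"
    using Suc.IH ER by (intro add_mono) (simp_all add: H_def S_def Q_def E0_def)
  also have "\<dots> = real (Suc n) * (E0 * (\<beta> + v\<^sup>2 * (1 + T)) * C)" by (simp add: algebra_simps)
  finally show ?case by (simp add: H_def S_def Q_def E0_def)
qed

text \<open>
Switching a weight off as soon as the running sum of squares exceeds \<open>T\<close> keeps the sum of the
remaining squares below \<open>T\<close>; the decision uses no square beyond the current one, so truncated
weights stay adapted.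
\<close>
lemma truncated_sum_squares_le:
  fixes x :: "nat \<Rightarrow> real"
  assumes "0 \<le> T"
  shows "(\<Sum>k<n. (if (\<Sum>j\<le>k. (x j)\<^sup>2) \<le> T then x k else 0)\<^sup>2) \<le> T"
proof (induction n)
  case (Suc n)
  show ?case
  proof (cases "(\<Sum>j\<le>n. (x j)\<^sup>2) \<le> T")
    case True
    have "(\<Sum>k<Suc n. (if (\<Sum>j\<le>k. (x j)\<^sup>2) \<le> T then x k else 0)\<^sup>2) \<le> (\<Sum>k<Suc n. (x k)\<^sup>2)"
      by (intro sum_mono) auto
    also have "\<dots> \<le> T" using True by (simp add: lessThan_Suc_atMost)
    finally show ?thesis .
  qed (use Suc in simp)
qed (use assms in simp)

text \<open>
The normalised weights are truncated at \<open>T = \<tau> + 1\<close>. By the law of large numbers for the squares the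
truncation acts with vanishing probability only, and the exponential of the compensator is
asymptotically the constant \<open>e\<^sup>v\<^sup>\<tau>\<^sup>/\<^sup>2\<close>. It can therefore be pulled out of the expectation of the
compensated exponential, which tends to 1 since the \<open>n\<close> errors are of order \<open>n\<^sup>-\<^sup>3\<^sup>/\<^sup>2\<close> each.
\<close>
theorem innovation_transform_clt:
  assumes U: "innovation U" and W: "\<And>k. W k \<in> borel_measurable (F k)"
    and mean: "\<And>k. expectation (U k) = 0"
    and U2: "\<And>k. integrable M (\<lambda>\<omega>. (U k \<omega>)\<^sup>2)" "\<And>k. expectation (\<lambda>\<omega>. (U k \<omega>)\<^sup>2) = v"
    and U3: "\<And>k. integrable M (\<lambda>\<omega>. \<bar>U k \<omega>\<bar> ^ 3)" "\<And>k. expectation (\<lambda>\<omega>. \<bar>U k \<omega>\<bar> ^ 3) \<le> \<beta>"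
    and W3: "\<And>k. integrable M (\<lambda>\<omega>. \<bar>W k \<omega>\<bar> ^ 3)" "\<And>k. expectation (\<lambda>\<omega>. \<bar>W k \<omega>\<bar> ^ 3) \<le> C"
    and "0 \<le> \<tau>" and lln: "negligible_seq (\<lambda>n \<omega>. (\<Sum>k<n. (W k \<omega>)\<^sup>2) / real n - \<tau>)"
  shows "(\<lambda>n. \<integral>\<omega>. iexp ((\<Sum>k<n. W k \<omega> * U k \<omega>) / sqrt (real n)) \<partial>M) \<longlonglongrightarrow> exp (- (v * \<tau> / 2))"
proof -
  have v: "0 \<le> v" unfolding U2(2)[of 0, symmetric] by simp
  define T where "T = \<tau> + 1"
  have "0 \<le> T" using \<open>0 \<le> \<tau>\<close> by (simp add: T_def)
  define x where "x n k \<omega> = W k \<omega> / sqrt (real n)" for n k \<omega>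
  define w where "w n k \<omega> = (if (\<Sum>j\<le>k. (x n j \<omega>)\<^sup>2) \<le> T then x n k \<omega> else 0)" for n k \<omega>
  define B where "B n \<omega> \<longleftrightarrow> T < (\<Sum>k<n. (x n k \<omega>)\<^sup>2)" for n \<omega>
  define S where "S n \<omega> = (\<Sum>k<n. w n k \<omega> * U k \<omega>)" for n \<omega>
  define Q where "Q n \<omega> = v / 2 * (\<Sum>k<n. (w n k \<omega>)\<^sup>2)" for n \<omega>
  define c where "c = exp (v * \<tau> / 2)"
  have x_F: "x n j \<in> borel_measurable (F k)" if "j \<le> k" for n j k
    unfolding x_def[abs_def] using measurable_F_le[OF W that] by measurable
  have w_F: "w n k \<in> borel_measurable (F k)" for n k
  proof -
    have [measurable]: "x n k \<in> borel_measurable (F k)" by (rule x_F) simp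
    have [measurable]: "(\<lambda>\<omega>. \<Sum>j\<le>k. (x n j \<omega>)\<^sup>2) \<in> borel_measurable (F k)"
      by (intro borel_measurable_sum borel_measurable_power x_F) auto
    show ?thesis unfolding w_def[abs_def] by measurable
  qed
  note [measurable] = measurable_F_M[OF W] innovation_measurable(2)[OF U] measurable_F_M[OF w_F] measurable_F_M[OF x_F[OF order_refl]]
  have [measurable]: "S n \<in> borel_measurable M" "Q n \<in> borel_measurable M" "Measurable.pred M (B n)" for n
    unfolding S_def Q_def B_def[abs_def] by measurable
  have w_eq: "w n k \<omega> = x n k \<omega>" if "\<not> B n \<omega>" "k < n" for n k \<omega>
  proof -
    have "(\<Sum>j\<le>k. (x n j \<omega>)\<^sup>2) \<le> (\<Sum>j<n. (x n j \<omega>)\<^sup>2)"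
      using that by (intro sum_mono2) auto
    then show ?thesis using that by (simp add: w_def B_def)
  qed
  have sum_x: "(\<Sum>k<n. (x n k \<omega>)\<^sup>2) = (\<Sum>k<n. (W k \<omega>)\<^sup>2) / real n" for n \<omega>
    by (simp add: x_def power_divide sum_divide_distrib)
  have B_prob: "(\<lambda>n. prob {\<omega>\<in>space M. B n \<omega>}) \<longlonglongrightarrow> 0"
  proof (rule tendsto_sandwich[where f="\<lambda>_. 0"])
    let ?L = "\<lambda>n. prob {\<omega>\<in>space M. 1 < \<bar>(\<Sum>k<n. (W k \<omega>)\<^sup>2) / real n - \<tau>\<bar>}"
    show "?L \<longlonglongrightarrow> 0"
      using lln by (simp add: negligible_seq_def)
    have "prob {\<omega>\<in>space M. B n \<omega>} \<le> ?L n" for n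
      unfolding B_def sum_x T_def by (intro finite_measure_mono) auto
    then show "\<forall>\<^sub>F n in sequentially. prob {\<omega>\<in>space M. B n \<omega>} \<le> ?L n"
      by simp
  qed auto
  have T_w: "(\<Sum>k<m. (w n k \<omega>)\<^sup>2) \<le> T" for n m \<omega>
    unfolding w_def using truncated_sum_squares_le[OF \<open>0 \<le> T\<close>] .
  have Q_le: "Q n \<omega> \<le> v * T / 2" for n \<omega>
    unfolding Q_def using mult_left_mono[OF T_w, of "v/2"] v by simp
  let ?ES = "\<lambda>n. \<integral>\<omega>. iexp (S n \<omega>) \<partial>M"
  let ?EH = "\<lambda>n. \<integral>\<omega>. iexp (S n \<omega>) * complex_of_real (exp (Q n \<omega>)) \<partial>M"
  define K where "K = exp (v * T / 2) * (\<beta> + v\<^sup>2 * (1 + T)) * C"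
  have H_lim: "?EH \<longlonglongrightarrow> 1"
  proof -
    have bound: "cmod (?EH n - 1) \<le> K * inverse (sqrt (real n))"
      if "0 < n" for n
    proof -
      have "expectation (\<lambda>\<omega>. \<bar>w n k \<omega>\<bar> ^ 3) \<le> C / (sqrt (real n)) ^ 3" for k
      proof -
        have x3: "\<bar>x n k \<omega>\<bar> ^ 3 = \<bar>W k \<omega>\<bar> ^ 3 / (sqrt (real n)) ^ 3" for \<omega>
          by (simp add: x_def power_divide)
        have i: "integrable M (\<lambda>\<omega>. \<bar>x n k \<omega>\<bar> ^ 3)" unfolding x3 using W3 by simp
        have "expectation (\<lambda>\<omega>. \<bar>w n k \<omega>\<bar> ^ 3) \<le> expectation (\<lambda>\<omega>. \<bar>x n k \<omega>\<bar> ^ 3)"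
          by (rule integral_mono_AE'[OF i]) (auto simp: w_def)
        also have "\<dots> \<le> C / (sqrt (real n)) ^ 3"
          unfolding x3 using W3(2)[of k] by (simp add: divide_right_mono)
        finally show ?thesis .
      qed
      from compensated_exponential_expectation[OF U w_F mean U2 U3 this T_w]
      have "cmod (?EH n - 1)
          \<le> real n * (exp (v * T / 2) * (\<beta> + v\<^sup>2 * (1 + T)) * (C / (sqrt (real n)) ^ 3))"
        unfolding S_def Q_def .
      also have "\<dots> = K * (real n / (sqrt (real n)) ^ 3)" by (simp add: K_def)
      also have "real n / (sqrt (real n)) ^ 3 = inverse (sqrt (real n))"
        using that by (simp add: power3_eq_cube field_simps)
      finally show ?thesis .
    qed
    have "(\<lambda>n. K * inverse (sqrt (real n))) \<longlonglongrightarrow> K * 0"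
      by (intro tendsto_mult tendsto_const) real_asymp
    then have "(\<lambda>n. K * inverse (sqrt (real n))) \<longlonglongrightarrow> 0" by simp
    then have "(\<lambda>n. ?EH n - 1) \<longlonglongrightarrow> 0"
      by (rule Lim_null_comparison[rotated]) (use bound in \<open>auto simp: eventually_sequentially intro!: exI[of _ 1]\<close>)
    then show ?thesis by (rule LIM_zero_cancel)
  qed
  have Z_negl: "negligible_seq (\<lambda>n \<omega>. exp (Q n \<omega>) - c)"
  proof (rule negligible_seq_transfer[where A=B])
    let ?Y = "\<lambda>n \<omega>. exp (v / 2 * ((\<Sum>k<n. (W k \<omega>)\<^sup>2) / real n)) - c"
    show "negligible_seq ?Y"
      unfolding c_def using negligible_seq_continuous[OF lln, of "\<lambda>y. exp (v / 2 * y)"] by simp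
    fix n \<omega> assume "\<not> B n \<omega>"
    then have "Q n \<omega> = v / 2 * (\<Sum>k<n. (x n k \<omega>)\<^sup>2)" using w_eq by (simp add: Q_def)
    then show "exp (Q n \<omega>) - c = ?Y n \<omega>" unfolding sum_x by simp
  qed (use B_prob in auto)
  have Z_lim: "(\<lambda>n. expectation (\<lambda>\<omega>. \<bar>exp (Q n \<omega>) - c\<bar>)) \<longlonglongrightarrow> 0"
  proof (rule expectation_bounded_negligible[OF Z_negl])
    fix n \<omega>
    have "0 \<le> exp (Q n \<omega>)" "exp (Q n \<omega>) \<le> exp (v * T / 2)" "0 \<le> c" using Q_le by (auto simp: c_def)
    then show "\<bar>exp (Q n \<omega>) - c\<bar> \<le> exp (v * T / 2) + c" by linarith
  qed
  have int_S: "integrable M (\<lambda>\<omega>. iexp (S n \<omega>))" for n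
    by (rule integrable_const_bound[where B=1]) auto
  have int_Q: "integrable M (\<lambda>\<omega>. exp (Q n \<omega>))" for n
    by (rule integrable_const_bound[where B="exp (v * T / 2)"]) (use Q_le in auto)
  have int_H: "integrable M (\<lambda>\<omega>. iexp (S n \<omega>) * complex_of_real (exp (Q n \<omega>)))" for n
    by (rule integrable_const_bound[where B="exp (v * T / 2)"]) (use Q_le in \<open>auto simp: norm_mult\<close>)
  have S_lim: "(\<lambda>n. ?ES n * c) \<longlonglongrightarrow> 1"
  proof -
    have "(\<lambda>n. ?EH n - ?ES n * c) \<longlonglongrightarrow> 0"
    proof (rule Lim_null_comparison[OF _ Z_lim], rule always_eventually, rule allI)
      fix n
      have "?EH n - ?ES n * c
         = (\<integral>\<omega>. iexp (S n \<omega>) * complex_of_real (exp (Q n \<omega>) - c) \<partial>M)"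
        using int_H int_S by (simp add: algebra_simps)
      also have "cmod \<dots> \<le> expectation (\<lambda>\<omega>. \<bar>exp (Q n \<omega>) - c\<bar>)"
      proof (rule norm_integral_le)
        show "integrable M (\<lambda>\<omega>. iexp (S n \<omega>) * complex_of_real (exp (Q n \<omega>) - c))"
          using int_H int_S by (simp add: algebra_simps)
        fix \<omega>
        show "cmod (iexp (S n \<omega>) * complex_of_real (exp (Q n \<omega>) - c)) \<le> \<bar>exp (Q n \<omega>) - c\<bar>"
          unfolding norm_mult norm_of_real by simp
      qed (use int_Q in auto)
      finally show "cmod (?EH n - ?ES n * c)
        \<le> expectation (\<lambda>\<omega>. \<bar>exp (Q n \<omega>) - c\<bar>)" .
    qed
    from tendsto_diff[OF H_lim this] show ?thesis by simp
  qed
  let ?X = "\<lambda>n \<omega>. iexp ((\<Sum>k<n. W k \<omega> * U k \<omega>) / sqrt (real n))"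
  let ?EX = "\<lambda>n. \<integral>\<omega>. ?X n \<omega> \<partial>M"
  have X_lim: "(\<lambda>n. ?EX n - ?ES n) \<longlonglongrightarrow> 0"
  proof (rule Lim_null_comparison)
    show "(\<lambda>n. 2 * prob {\<omega>\<in>space M. B n \<omega>}) \<longlonglongrightarrow> 0" using tendsto_mult[OF tendsto_const[of 2] B_prob] by simp
    have "cmod (?EX n - ?ES n) \<le> 2 * prob {\<omega>\<in>space M. B n \<omega>}" for n
    proof -
      have int_X: "integrable M (?X n)" by (rule integrable_const_bound[where B=1]) auto
      have "?EX n - ?ES n = (\<integral>\<omega>. ?X n \<omega> - iexp (S n \<omega>) \<partial>M)"
        using int_X int_S by simp
      also have "cmod \<dots> \<le> (\<integral>\<omega>. 2 * indicator {\<omega>\<in>space M. B n \<omega>} \<omega> \<partial>M)"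
      proof (rule norm_integral_le)
        fix \<omega> assume "\<omega> \<in> space M"
        show "cmod (?X n \<omega> - iexp (S n \<omega>)) \<le> 2 * indicator {\<omega>\<in>space M. B n \<omega>} \<omega>"
        proof (cases "B n \<omega>")
          case True
          have "cmod (?X n \<omega> - iexp (S n \<omega>)) \<le> cmod (?X n \<omega>) + cmod (iexp (S n \<omega>))" by (rule norm_triangle_ineq4)
          then show ?thesis using True \<open>\<omega> \<in> space M\<close> by simp
        next
          case False
          then have "S n \<omega> = (\<Sum>k<n. x n k \<omega> * U k \<omega>)" using w_eq by (simp add: S_def)
          then have "S n \<omega> = (\<Sum>k<n. W k \<omega> * U k \<omega>) / sqrt (real n)"
            by (simp add: x_def sum_divide_distrib)
          then show ?thesis by simp
        qed
      qed (use int_X int_S in \<open>auto simp: emeasure_eq_measure\<close>)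
      also have "\<dots> = 2 * prob {\<omega>\<in>space M. B n \<omega>}" by simp
      finally show ?thesis .
    qed
    then show "\<forall>\<^sub>F n in sequentially. cmod (?EX n - ?ES n) \<le> 2 * prob {\<omega>\<in>space M. B n \<omega>}"
      by simp
  qed
  have "(\<lambda>n. (?EX n - ?ES n) + ?ES n * c * complex_of_real (exp (- (v * \<tau> / 2))))
     \<longlonglongrightarrow> 0 + 1 * complex_of_real (exp (- (v * \<tau> / 2)))"
    by (intro tendsto_add tendsto_mult X_lim S_lim tendsto_const)
  moreover have "?ES n * c * complex_of_real (exp (- (v * \<tau> / 2))) = ?ES n" for n
  proof -
    have "c * exp (- (v * \<tau> / 2)) = 1" unfolding c_def exp_add[symmetric] by simp
    then have "complex_of_real c * complex_of_real (exp (- (v * \<tau> / 2))) = 1" by (metis of_real_1 of_real_mult)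
    then show ?thesis by (simp only: mult.assoc mult_1_right)
  qed
  ultimately show ?thesis by simp
qed
end

section \<open>Identities and bounds for autoregressions\<close>

text \<open>
Convexity of the fourth power: \<open>p x + y\<close> is, up to signs, the mixture of \<open>x\<close> and \<open>y / (1 - \<bar>p\<bar>)\<close> with
weights \<open>\<bar>p\<bar>\<close> and \<open>1 - \<bar>p\<bar>\<close>. The factor \<open>\<bar>p\<bar> < 1\<close> in front of \<open>x\<^sup>4\<close> makes the fourth moments of an
autoregression bounded.
\<close>
lemma fourth_power_convex_bound:
  fixes p x y :: real
  assumes "\<bar>p\<bar> < 1"
  shows "(p * x + y) ^ 4 \<le> \<bar>p\<bar> * x ^ 4 + y ^ 4 / (1 - \<bar>p\<bar>) ^ 3"
proof -
  have sq: "(\<bar>p\<bar> * s + (1 - \<bar>p\<bar>) * t)\<^sup>2 \<le> \<bar>p\<bar> * s\<^sup>2 + (1 - \<bar>p\<bar>) * t\<^sup>2" for s t :: real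
  proof -
    have "\<bar>p\<bar> * s\<^sup>2 + (1 - \<bar>p\<bar>) * t\<^sup>2 - (\<bar>p\<bar> * s + (1 - \<bar>p\<bar>) * t)\<^sup>2 = \<bar>p\<bar> * (1 - \<bar>p\<bar>) * (s - t)\<^sup>2"
      by (simp add: power2_eq_square algebra_simps)
    also have "\<dots> \<ge> 0" using assms by simp
    finally show ?thesis by linarith
  qed
  define s where "s = (if p < 0 then - x else x)"
  define t where "t = y / (1 - \<bar>p\<bar>)"
  have "p * x = \<bar>p\<bar> * s" by (simp add: s_def)
  moreover have "y = (1 - \<bar>p\<bar>) * t" using assms by (simp add: t_def)
  ultimately have "(p * x + y) ^ 4 = ((\<bar>p\<bar> * s + (1 - \<bar>p\<bar>) * t)\<^sup>2)\<^sup>2" by simp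
  also have "\<dots> \<le> (\<bar>p\<bar> * s\<^sup>2 + (1 - \<bar>p\<bar>) * t\<^sup>2)\<^sup>2" by (intro power_mono sq) simp
  also have "\<dots> \<le> \<bar>p\<bar> * (s\<^sup>2)\<^sup>2 + (1 - \<bar>p\<bar>) * (t\<^sup>2)\<^sup>2" by (rule sq)
  also have "\<dots> = \<bar>p\<bar> * x ^ 4 + y ^ 4 / (1 - \<bar>p\<bar>) ^ 3"
    using assms by (simp add: s_def t_def power_divide power4_eq_xxxx power3_eq_cube)
  finally show ?thesis .
qed

lemma (in prob_space) autoregression_fourth_moment:
  fixes p C :: real and N Z :: "nat \<Rightarrow> 'a \<Rightarrow> real"
  assumes p: "\<bar>p\<bar> < 1"
    and [measurable]: "\<And>k. N (Suc k) \<in> borel_measurable M"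
    and N4: "\<And>k. integrable M (\<lambda>\<omega>. N (Suc k) \<omega> ^ 4)" "\<And>k. expectation (\<lambda>\<omega>. N (Suc k) \<omega> ^ 4) \<le> C"
    and Z: "\<And>\<omega>. Z 0 \<omega> = 0" "\<And>k \<omega>. Z (Suc k) \<omega> = p * Z k \<omega> + N (Suc k) \<omega>"
  shows "Z k \<in> borel_measurable M \<and> integrable M (\<lambda>\<omega>. Z k \<omega> ^ 4) \<and>
    expectation (\<lambda>\<omega>. Z k \<omega> ^ 4) \<le> C / (1 - \<bar>p\<bar>) ^ 4"
proof (induction k)
  case 0
  have "0 \<le> expectation (\<lambda>\<omega>. N (Suc 0) \<omega> ^ 4)" by (intro Bochner_Integration.integral_nonneg) simp
  then have "0 \<le> C" using N4(2)[of 0] by linarith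
  then show ?case using p Z(1) by simp
next
  case (Suc k)
  define d where "d = 1 - \<bar>p\<bar>"
  have "0 < d" using p by (simp add: d_def)
  have Z_eq: "Z (Suc k) = (\<lambda>\<omega>. p * Z k \<omega> + N (Suc k) \<omega>)" using Z(2) by auto
  have [measurable]: "Z k \<in> borel_measurable M" using Suc by simp
  have bound: "Z (Suc k) \<omega> ^ 4 \<le> \<bar>p\<bar> * Z k \<omega> ^ 4 + N (Suc k) \<omega> ^ 4 / d ^ 3" for \<omega>
    unfolding Z_eq d_def by (rule fourth_power_convex_bound[OF p])
  have int: "integrable M (\<lambda>\<omega>. \<bar>p\<bar> * Z k \<omega> ^ 4 + N (Suc k) \<omega> ^ 4 / d ^ 3)"
    using Suc N4 by simp
  have int': "integrable M (\<lambda>\<omega>. Z (Suc k) \<omega> ^ 4)"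
  proof (rule Bochner_Integration.integrable_bound[OF int])
    show "AE \<omega> in M. norm (Z (Suc k) \<omega> ^ 4) \<le> norm (\<bar>p\<bar> * Z k \<omega> ^ 4 + N (Suc k) \<omega> ^ 4 / d ^ 3)"
      using bound by (intro AE_I2) (simp add: order_trans[OF _ abs_ge_self])
  qed (simp add: Z_eq)
  have "expectation (\<lambda>\<omega>. Z (Suc k) \<omega> ^ 4) \<le> expectation (\<lambda>\<omega>. \<bar>p\<bar> * Z k \<omega> ^ 4 + N (Suc k) \<omega> ^ 4 / d ^ 3)"
    using int int' bound by (intro integral_mono)
  also have "\<dots> = \<bar>p\<bar> * expectation (\<lambda>\<omega>. Z k \<omega> ^ 4) + expectation (\<lambda>\<omega>. N (Suc k) \<omega> ^ 4) / d ^ 3"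
    using Suc N4 by simp
  also have "\<dots> \<le> \<bar>p\<bar> * (C / d ^ 4) + C / d ^ 3"
    using Suc N4 \<open>0 < d\<close> by (intro add_mono mult_left_mono divide_right_mono) (auto simp: d_def)
  also have "C / d ^ 3 = d * (C / d ^ 4)" using \<open>0 < d\<close> by (simp add: power4_eq_xxxx power3_eq_cube)
  also have "\<bar>p\<bar> * (C / d ^ 4) + d * (C / d ^ 4) = (\<bar>p\<bar> + d) * (C / d ^ 4)" by (simp only: distrib_right)
  also have "\<dots> = C / d ^ 4" by (simp add: d_def)
  finally show ?case using int' by (simp add: Z_eq d_def)
qed

lemma ar_second_order:
  fixes x e v :: "nat \<Rightarrow> real"
  assumes "\<And>n. x (Suc n) = \<theta> * x n + e (Suc n)" "\<And>n. e (Suc n) = \<rho> * e n + v (Suc n)"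
  shows "x (Suc (Suc n)) = (\<theta> + \<rho>) * x (Suc n) - \<theta> * \<rho> * x n + v (Suc (Suc n))"
proof -
  have e: "e (Suc n) = x (Suc n) - \<theta> * x n" using assms(1)[of n] by simp
  show ?thesis unfolding assms(1)[of "Suc n"] assms(2)[of "Suc n"] e by (simp add: algebra_simps)
qed

text \<open>
The effect of the initial values decays geometrically. The rate \<open>q\<close> must exceed \<open>\<bar>\<theta>\<bar>\<close> strictly: for
\<open>\<theta> = \<rho> \<noteq> 0\<close> the difference is of order \<open>n \<theta>\<^sup>n\<close>.
\<close>
lemma ar_difference_bound:
  fixes r :: "nat \<Rightarrow> real"
  assumes rec: "\<And>n. r (Suc n) = \<theta> * r n + \<rho> ^ Suc n * c" and q: "\<bar>\<theta>\<bar> < q" "\<bar>\<rho>\<bar> \<le> q"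
  shows "\<bar>r n\<bar> \<le> (\<bar>r 0\<bar> + \<bar>c\<bar> * q / (q - \<bar>\<theta>\<bar>)) * q ^ n"
proof (induction n)
  case 0
  then show ?case using q by simp
next
  case (Suc n)
  define K where "K = \<bar>r 0\<bar> + \<bar>c\<bar> * q / (q - \<bar>\<theta>\<bar>)"
  have "0 < q" using q by linarith
  have "\<bar>r (Suc n)\<bar> \<le> \<bar>\<theta>\<bar> * \<bar>r n\<bar> + \<bar>\<rho>\<bar> ^ Suc n * \<bar>c\<bar>"
    unfolding rec using abs_triangle_ineq[of "\<theta> * r n" "\<rho> ^ Suc n * c"] by (simp add: abs_mult power_abs)
  also have "\<dots> \<le> \<bar>\<theta>\<bar> * (K * q ^ n) + q ^ Suc n * \<bar>c\<bar>"
    using Suc q by (intro add_mono mult_left_mono mult_right_mono power_mono) (auto simp: K_def)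
  also have "\<dots> = q ^ n * (\<bar>\<theta>\<bar> * K + q * \<bar>c\<bar>)" by (simp add: algebra_simps)
  also have "\<dots> \<le> q ^ n * (q * K)"
  proof (intro mult_left_mono)
    have "\<bar>c\<bar> * q = (q - \<bar>\<theta>\<bar>) * (\<bar>c\<bar> * q / (q - \<bar>\<theta>\<bar>))" using q by simp
    also have "\<dots> \<le> (q - \<bar>\<theta>\<bar>) * K" using q by (intro mult_left_mono) (auto simp: K_def)
    finally show "\<bar>\<theta>\<bar> * K + q * \<bar>c\<bar> \<le> q * K" by (simp add: algebra_simps)
  qed (use \<open>0 < q\<close> in simp)
  finally show ?case by (simp add: K_def mult_ac)
qed

text \<open>
The recursion multiplied by \<open>x (k + 1)\<close> and summed. The lag one products occur on both sides, which
is where the factor \<open>1 + b\<close> comes from.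
\<close>
lemma ar2_cross_identity:
  fixes x v :: "nat \<Rightarrow> real"
  assumes rec: "\<And>n. x (Suc (Suc n)) = a * x (Suc n) - b * x n + v (Suc (Suc n))"
  shows "(1 + b) * (\<Sum>k<Suc m. x (Suc k) * x k) = a * (\<Sum>k<Suc m. (x k)\<^sup>2) + (\<Sum>k<m. x (Suc k) * v (Suc (Suc k)))
    + (x 1 * x 0 - a * (x 0)\<^sup>2 + b * (x (Suc m) * x m))"
proof (induction m)
  case (Suc m)
  have v: "v (Suc (Suc m)) = x (Suc (Suc m)) - a * x (Suc m) + b * x m" using rec[of m] by simp
  show ?case using Suc by (simp add: v power2_eq_square algebra_simps)
qed (simp add: power2_eq_square algebra_simps)

text \<open>
The recursion squared and summed: \<open>v\<^sup>2 + 2 v (a y - b z) = u\<^sup>2 - (a y - b z)\<^sup>2\<close> for consecutive values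
\<open>z, y, u\<close> of \<open>x\<close>, and what remains telescopes into the boundary terms.
\<close>
lemma ar2_energy_identity:
  fixes x v :: "nat \<Rightarrow> real"
  assumes rec: "\<And>n. x (Suc (Suc n)) = a * x (Suc n) - b * x n + v (Suc (Suc n))"
  shows "(1 - a\<^sup>2 - b\<^sup>2) * (\<Sum>k<Suc m. (x k)\<^sup>2) + 2 * a * b * (\<Sum>k<Suc m. x (Suc k) * x k) =
    (\<Sum>k<m. (v (Suc (Suc k)))\<^sup>2) + 2 * a * (\<Sum>k<m. x (Suc k) * v (Suc (Suc k))) - 2 * b * (\<Sum>k<m. x k * v (Suc (Suc k)))
    + ((x 1)\<^sup>2 + (1 - a\<^sup>2) * (x 0)\<^sup>2 - (x (Suc m))\<^sup>2 - b\<^sup>2 * (x m)\<^sup>2 + 2 * a * b * (x (Suc m) * x m))"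
proof (induction m)
  case (Suc m)
  have v: "v (Suc (Suc m)) = x (Suc (Suc m)) - a * x (Suc m) + b * x m" using rec[of m] by simp
  show ?case using Suc by (simp add: v power2_eq_square algebra_simps)
qed (simp add: power2_eq_square algebra_simps)

lemma ar2_lag_two_identity:
  fixes x v :: "nat \<Rightarrow> real"
  assumes rec: "\<And>n. x (Suc (Suc n)) = a * x (Suc n) - b * x n + v (Suc (Suc n))"
  shows "(\<Sum>k<m. x (Suc (Suc k)) * x k) =
    a * (\<Sum>k<m. x (Suc k) * x k) - b * (\<Sum>k<m. (x k)\<^sup>2) + (\<Sum>k<m. x k * v (Suc (Suc k)))"
  by (simp add: rec sum.distrib sum_distrib_left sum_subtractf algebra_simps power2_eq_square)

text \<open>
Eliminating the lag one products from the cross and the energy identity determines the sum of squares from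
the sum of the squared innovations, the two scores and boundary terms.
\<close>
lemma ar2_sum_squares_identity:
  fixes x v :: "nat \<Rightarrow> real"
  assumes rec: "\<And>n. x (Suc (Suc n)) = a * x (Suc n) - b * x n + v (Suc (Suc n))"
  shows "(1 - b) * ((1 + b)\<^sup>2 - a\<^sup>2) * (\<Sum>k<Suc m. (x k)\<^sup>2) =
    (1 + b) * (\<Sum>k<m. (v (Suc (Suc k)))\<^sup>2) + 2 * a * (\<Sum>k<m. x (Suc k) * v (Suc (Suc k)))
    - 2 * b * (1 + b) * (\<Sum>k<m. x k * v (Suc (Suc k)))
    + (1 + b) * ((x 1)\<^sup>2 + (1 - a\<^sup>2) * (x 0)\<^sup>2 - (x (Suc m))\<^sup>2 - b\<^sup>2 * (x m)\<^sup>2 + 2 * a * b * (x (Suc m) * x m))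
    - 2 * a * b * (x 1 * x 0 - a * (x 0)\<^sup>2 + b * (x (Suc m) * x m))" (is "_ = ?R")
proof -
  let ?S = "\<Sum>k<Suc m. (x k)\<^sup>2" and ?P = "\<Sum>k<Suc m. x (Suc k) * x k"
  have "(1 - b) * ((1 + b)\<^sup>2 - a\<^sup>2) * ?S
     = (1 + b) * ((1 - a\<^sup>2 - b\<^sup>2) * ?S + 2 * a * b * ?P) - 2 * a * b * ((1 + b) * ?P - a * ?S)"
    by (simp only: power2_eq_square, algebra)
  also have "\<dots> = ?R"
    unfolding ar2_energy_identity[of x a b v, OF rec] ar2_cross_identity[of x a b v, OF rec]
    by (simp only: power2_eq_square, algebra)
  finally show ?thesis .
qed

section \<open>Independent innovations and the law of large numbers\<close>
lemma power_le_one_plus_fourth_power: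
  fixes z :: real
  assumes "j \<le> 4"
  shows "\<bar>z\<bar> ^ j \<le> 1 + z ^ 4"
proof (cases "\<bar>z\<bar> \<le> 1")
  case True
  then have "\<bar>z\<bar> ^ j \<le> 1" by (simp add: power_le_one)
  moreover have "0 \<le> z ^ 4" by simp
  ultimately show ?thesis by linarith
next
  case False
  then have "\<bar>z\<bar> ^ j \<le> \<bar>z\<bar> ^ 4" using assms by (intro power_increasing) auto
  then show ?thesis by (simp add: power_even_abs)
qed

lemma (in prob_space) moments_below_fourth:
  fixes Z :: "'a \<Rightarrow> real"
  assumes [measurable]: "Z \<in> borel_measurable M" and int: "integrable M (\<lambda>\<omega>. Z \<omega> ^ 4)" and "j \<le> 4"
  shows "integrable M (\<lambda>\<omega>. \<bar>Z \<omega>\<bar> ^ j)"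
    and "expectation (\<lambda>\<omega>. \<bar>Z \<omega>\<bar> ^ j) \<le> 1 + expectation (\<lambda>\<omega>. Z \<omega> ^ 4)"
proof -
  have i: "integrable M (\<lambda>\<omega>. 1 + Z \<omega> ^ 4)" using int by simp
  have le: "\<bar>Z \<omega>\<bar> ^ j \<le> 1 + Z \<omega> ^ 4" for \<omega> using power_le_one_plus_fourth_power[OF \<open>j \<le> 4\<close>] .
  show "integrable M (\<lambda>\<omega>. \<bar>Z \<omega>\<bar> ^ j)"
    by (rule Bochner_Integration.integrable_bound[OF i]) (use le in \<open>auto intro!: AE_I2 order_trans[OF _ abs_ge_self]\<close>)
  then have "expectation (\<lambda>\<omega>. \<bar>Z \<omega>\<bar> ^ j) \<le> expectation (\<lambda>\<omega>. 1 + Z \<omega> ^ 4)"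
    using i le by (intro integral_mono)
  then show "expectation (\<lambda>\<omega>. \<bar>Z \<omega>\<bar> ^ j) \<le> 1 + expectation (\<lambda>\<omega>. Z \<omega> ^ 4)"
    using int by (simp add: prob_space)
qed

text \<open>
By orthogonality the second moment of the sum grows at most linearly.
\<close>
lemma (in filtered_prob_space) innovation_sum_tight:
  assumes U: "innovation U" and W: "\<And>k. W k \<in> borel_measurable (F k)"
    and W2: "\<And>k. integrable M (\<lambda>\<omega>. (W k \<omega>)\<^sup>2)" "\<And>k. expectation (\<lambda>\<omega>. (W k \<omega>)\<^sup>2) \<le> C"
    and U2: "\<And>k. integrable M (\<lambda>\<omega>. (U k \<omega>)\<^sup>2)" "\<And>k. expectation (\<lambda>\<omega>. (U k \<omega>)\<^sup>2) \<le> D"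
    and mean: "\<And>k. expectation (U k) = 0"
  shows "tight_seq (\<lambda>n \<omega>. (\<Sum>k<n. W k \<omega> * U k \<omega>) / sqrt (real n))"
proof (rule tight_seq_of_bounded_second_moment)
  note [measurable] = measurable_F_M[OF W] innovation_measurable(2)[OF U]
  note S = innovation_sum_second_moment[OF U W W2(1) U2(1) mean]
  fix n
  have eq: "((\<Sum>k<n. W k \<omega> * U k \<omega>) / sqrt (real n))\<^sup>2 = (\<Sum>k<n. W k \<omega> * U k \<omega>)\<^sup>2 / real n" for \<omega>
    by (simp add: power_divide)
  show "integrable M (\<lambda>\<omega>. ((\<Sum>k<n. W k \<omega> * U k \<omega>) / sqrt (real n))\<^sup>2)" unfolding eq using S by simp
  have nonneg: "0 \<le> expectation (\<lambda>\<omega>. (W k \<omega>)\<^sup>2)" "0 \<le> expectation (\<lambda>\<omega>. (U k \<omega>)\<^sup>2)" for k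
    by (intro Bochner_Integration.integral_nonneg; simp)+
  have "(\<Sum>k<n. expectation (\<lambda>\<omega>. (W k \<omega>)\<^sup>2) * expectation (\<lambda>\<omega>. (U k \<omega>)\<^sup>2)) \<le> (\<Sum>k<n. C * D)"
    using W2(2) U2(2) nonneg order_trans[OF nonneg(1) W2(2)] by (intro sum_mono mult_mono) auto
  then have "expectation (\<lambda>\<omega>. (\<Sum>k<n. W k \<omega> * U k \<omega>)\<^sup>2) / real n \<le> (real n * (C * D)) / real n"
    using S[of n] by (intro divide_right_mono) auto
  also have "\<dots> \<le> C * D"
    using order_trans[OF nonneg(1) W2(2)] order_trans[OF nonneg(2) U2(2)] by (cases "n = 0") auto
  finally show "expectation (\<lambda>\<omega>. ((\<Sum>k<n. W k \<omega> * U k \<omega>) / sqrt (real n))\<^sup>2) \<le> C * D" unfolding eq by simp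
  show "(\<lambda>\<omega>. (\<Sum>k<n. W k \<omega> * U k \<omega>) / sqrt (real n)) \<in> borel_measurable M" by measurable
qed

fun ar1_filter :: "real \<Rightarrow> (nat \<Rightarrow> real) \<Rightarrow> nat \<Rightarrow> real" where
  "ar1_filter p z 0 = 0"
| "ar1_filter p z (Suc k) = p * ar1_filter p z k + z (Suc k)"

locale iid_innovations = prob_space M for M :: "'a measure" +
  fixes V :: "nat \<Rightarrow> 'a \<Rightarrow> real" and v :: real
  assumes indep: "indep_vars (\<lambda>_. borel) V {1..}"
    and ident: "\<And>n. n \<ge> 1 \<Longrightarrow> distr M borel (V n) = distr M borel (V 1)"
    and moment4: "\<And>n. n \<ge> 1 \<Longrightarrow> integrable M (\<lambda>\<omega>. (V n \<omega>) ^ 4)"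
    and mean: "\<And>n. n \<ge> 1 \<Longrightarrow> expectation (V n) = 0"
    and second_moment: "\<And>n. n \<ge> 1 \<Longrightarrow> expectation (\<lambda>\<omega>. (V n \<omega>)\<^sup>2) = v"
begin

abbreviation history :: "nat \<Rightarrow> 'a \<Rightarrow> nat \<Rightarrow> real" where
  "history k \<omega> \<equiv> \<lambda>i\<in>{1..k}. V i \<omega>"

abbreviation history_space :: "nat \<Rightarrow> (nat \<Rightarrow> real) measure" where
  "history_space k \<equiv> PiM {1..k} (\<lambda>_. borel)"

text \<open>The sigma-algebra generated by \<open>V\<^sub>1, \<dots>, V\<^sub>k\<close>.\<close>
definition past :: "nat \<Rightarrow> 'a measure" where
  "past k = vimage_algebra (space M) (history k) (history_space k)"

lemma V_measurable [measurable]: "V (Suc k) \<in> borel_measurable M"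
  using indep by (auto simp: indep_vars_def)

lemma history_measurable: "history k \<in> measurable M (history_space k)"
  using indep by (intro measurable_restrict) (auto simp: indep_vars_def)

lemma history_past: "history k \<in> measurable (past k) (history_space k)"
  unfolding past_def by (rule measurable_vimage_algebra1) (use measurable_space[OF history_measurable] in auto)

lemma V_past: "1 \<le> j \<Longrightarrow> j \<le> k \<Longrightarrow> V j \<in> borel_measurable (past k)"
  using measurable_compose[OF history_past measurable_component_singleton[of j "{1..k}" "\<lambda>_. borel"]]
  by simp

lemma space_past [simp]: "space (past k) = space M"
  by (simp add: past_def)

lemma past_sets_subset:
  assumes "space N = space M" "history k \<in> measurable N (history_space k)"
  shows "subalgebra N (past k)"
proof -
  have "sets (past k) \<subseteq> sets N"
    unfolding past_def
    using measurable_sets[OF assms(2)] assms(1) measurable_space[OF assms(2)]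
    by (subst sets_vimage_algebra2) auto
  then show ?thesis using assms(1) by (simp add: subalgebra_def)
qed

sublocale filtered_prob_space M past
proof
  show "subalgebra M (past k)" for k by (rule past_sets_subset[OF refl history_measurable])
  show "subalgebra (past l) (past k)" if "k \<le> l" for k l
    using that by (intro past_sets_subset measurable_restrict V_past) auto
qed

lemma innovation_V: "innovation (\<lambda>k. V (Suc k))"
  unfolding innovation_def
proof (intro allI conjI)
  fix k
  let ?R = "{(history k) -` A \<inter> space M |A. A \<in> sets (history_space k)}"
  let ?S = "{(\<lambda>\<omega>. \<lambda>i\<in>{Suc k}. V i \<omega>) -` A \<inter> space M |A. A \<in> sets (PiM {Suc k} (\<lambda>_. borel))}"
  show "V (Suc k) \<in> borel_measurable (past (Suc k))" by (rule V_past) auto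
  have "indep_var (history_space k) (\<lambda>\<omega>. restrict (\<lambda>i. V i \<omega>) {1..k})
      (PiM {Suc k} (\<lambda>_. borel)) (\<lambda>\<omega>. restrict (\<lambda>i. V i \<omega>) {Suc k})"
    by (rule indep_var_restrict[OF indep]) auto
  then have ind: "indep_set (sigma_sets (space M) ?R) (sigma_sets (space M) ?S)"
    unfolding indep_var_eq by simp
  have "sets (vimage_algebra (space M) (V (Suc k)) borel) \<subseteq> sigma_sets (space M) ?S"
  proof
    fix B assume "B \<in> sets (vimage_algebra (space M) (V (Suc k)) borel)"
    then obtain S where S: "S \<in> sets borel" "B = V (Suc k) -` S \<inter> space M"
      by (auto simp: sets_vimage_algebra2)
    let ?A = "(\<lambda>f. f (Suc k)) -` S \<inter> space (PiM {Suc k} (\<lambda>_. borel :: real measure))"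
    have "?A \<in> sets (PiM {Suc k} (\<lambda>_. borel))"
      using S(1) by (intro measurable_sets[OF measurable_component_singleton]) auto
    moreover have "B = (\<lambda>\<omega>. \<lambda>i\<in>{Suc k}. V i \<omega>) -` ?A \<inter> space M"
      using S(2) by (auto simp: space_PiM)
    ultimately have "B \<in> ?S"
      by blast
    then show "B \<in> sigma_sets (space M) ?S"
      by (rule sigma_sets.Basic)
  qed
  moreover have "sets (past k) = sigma_sets (space M) ?R"
    by (simp add: past_def sets_vimage_algebra)
  ultimately show "indep_set (sets (past k)) (sets (vimage_algebra (space M) (V (Suc k)) borel))"
    using ind unfolding indep_sets2_eq by blast
qed

lemma moment_ident:
  fixes f :: "real \<Rightarrow> real"
  assumes "f \<in> borel_measurable borel"
  shows "expectation (\<lambda>\<omega>. f (V (Suc k) \<omega>)) = expectation (\<lambda>\<omega>. f (V 1 \<omega>))"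
  using ident[of "Suc k"] integral_distr[OF V_measurable[of k] assms] integral_distr[OF V_measurable[of 0] assms]
  by simp

lemma V_moment4: "integrable M (\<lambda>\<omega>. V (Suc k) \<omega> ^ 4)"
    "expectation (\<lambda>\<omega>. V (Suc k) \<omega> ^ 4) = expectation (\<lambda>\<omega>. V 1 \<omega> ^ 4)"
  using moment4 moment_ident[of "\<lambda>x. x ^ 4"] by auto

lemma V_square_integrable: "integrable M (\<lambda>\<omega>. (V (Suc k) \<omega>)\<^sup>2)"
  using moments_below_fourth(1)[OF V_measurable V_moment4(1), of 2] by simp

lemma V_lln: "negligible_seq (\<lambda>n \<omega>. (\<Sum>k<n. (V (Suc k) \<omega>)\<^sup>2) / real n - v)"
proof (rule negligible_seq_eventually)
  let ?U = "\<lambda>k \<omega>. (V (Suc k) \<omega>)\<^sup>2 - v"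
  have U: "innovation ?U" using innovation_compose[OF innovation_V, of "\<lambda>x. x\<^sup>2 - v"] by simp
  have sq: "(?U k \<omega>)\<^sup>2 = V (Suc k) \<omega> ^ 4 - 2 * v * (V (Suc k) \<omega>)\<^sup>2 + v\<^sup>2" for k \<omega>
    by (simp add: power2_eq_square power4_eq_xxxx algebra_simps)
  have i: "integrable M (\<lambda>\<omega>. (?U k \<omega>)\<^sup>2)" for k
    unfolding sq using V_moment4 V_square_integrable by simp
  have "expectation (\<lambda>\<omega>. (?U k \<omega>)\<^sup>2) \<le> expectation (\<lambda>\<omega>. ((V 1 \<omega>)\<^sup>2 - v)\<^sup>2)" for k
    using moment_ident[of "\<lambda>x. (x\<^sup>2 - v)\<^sup>2" k] by simp
  from innovation_sum_tight[OF U, of "\<lambda>_ _. 1" 1, OF _ _ _ i this]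
  have "tight_seq (\<lambda>n \<omega>. (\<Sum>k<n. 1 * ?U k \<omega>) / sqrt (real n))"
    using V_square_integrable second_moment by (simp add: prob_space)
  then show "negligible_seq (\<lambda>n \<omega>. inverse (sqrt (real n)) * ((\<Sum>k<n. 1 * ?U k \<omega>) / sqrt (real n)))"
    by (intro tight_scaled_negligible)
  show "\<forall>\<^sub>F n in sequentially. \<forall>\<omega>\<in>space M. (\<Sum>k<n. (V (Suc k) \<omega>)\<^sup>2) / real n - v =
      inverse (sqrt (real n)) * ((\<Sum>k<n. 1 * ?U k \<omega>) / sqrt (real n))"
    using eventually_gt_at_top[of 0]
  proof eventually_elim
    case (elim n)
    then have "inverse (sqrt (real n)) * (x / sqrt (real n)) = x / real n" for x
      by (simp add: divide_inverse mult_ac flip: inverse_mult_distrib)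
    note sq = this
    have "(\<Sum>k<n. 1 * ?U k \<omega>) = (\<Sum>k<n. (V (Suc k) \<omega>)\<^sup>2) - real n * v" for \<omega>
      by (simp add: sum_subtractf)
    then show ?case unfolding sq using elim by (simp add: diff_divide_distrib)
  qed
qed simp

text \<open>
The normalised scores. The number of terms is \<open>n - 1\<close> because the second order recursion is
available from the time 2 on.
\<close>
abbreviation score1 :: "(nat \<Rightarrow> 'a \<Rightarrow> real) \<Rightarrow> nat \<Rightarrow> 'a \<Rightarrow> real" where
  "score1 Z n \<omega> \<equiv> (\<Sum>k<n - 1. Z (Suc k) \<omega> * V (Suc (Suc k)) \<omega>) / sqrt (real n)"

abbreviation score2 :: "(nat \<Rightarrow> 'a \<Rightarrow> real) \<Rightarrow> nat \<Rightarrow> 'a \<Rightarrow> real" where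
  "score2 Z n \<omega> \<equiv> (\<Sum>k<n - 1. Z k \<omega> * V (Suc (Suc k)) \<omega>) / sqrt (real n)"

context
  fixes a b :: real and X :: "nat \<Rightarrow> 'a \<Rightarrow> real"
  assumes X_rec: "\<And>n \<omega>. \<omega> \<in> space M \<Longrightarrow> X (Suc (Suc n)) \<omega> = a * X (Suc n) \<omega> - b * X n \<omega> + V (Suc (Suc n)) \<omega>"
    and X_tight: "tight_seq X"
    and M_tight: "tight_seq (score1 X)"
    and N_tight: "tight_seq (score2 X)"
    and ab: "(1 - b) * ((1 + b)\<^sup>2 - a\<^sup>2) \<noteq> 0" "1 + b \<noteq> 0"
begin

lemma X_meas [measurable]: "X k \<in> borel_measurable M" using tight_seq_measurable[OF X_tight] .

lemmas tight_boundary_intros = tight_seq_add tight_seq_diff tight_seq_mult tight_seq_const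
  tight_seq_constant[OF X_meas] X_tight tight_seq_pred[OF X_tight] tight_seq_constant[OF V_measurable]

text \<open>
In the identity for the sum of squares the scores are of order \<open>\<surd>n\<close> and the boundary terms of order 1,
so after division by \<open>n\<close> the squared innovations alone contribute to the limit.
\<close>
lemma ar2_sum_squares_lln:
  "negligible_seq (\<lambda>n \<omega>. (\<Sum>k<n. (X k \<omega>)\<^sup>2) / real n - (1 + b) * v / ((1 - b) * ((1 + b)\<^sup>2 - a\<^sup>2)))"
proof -
  let ?\<kappa> = "(1 - b) * ((1 + b)\<^sup>2 - a\<^sup>2)"
  let ?M = "score1 X"
  let ?N = "score2 X"
  define Bd where "Bd n \<omega> = (1 + b) * (X 1 \<omega> * X 1 \<omega> + (1 - a\<^sup>2) * (X 0 \<omega> * X 0 \<omega>) - X n \<omega> * X n \<omega>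
       - b\<^sup>2 * (X (n - 1) \<omega> * X (n - 1) \<omega>) + 2 * a * b * (X n \<omega> * X (n - 1) \<omega>))
    - 2 * a * b * (X 1 \<omega> * X 0 \<omega> - a * (X 0 \<omega> * X 0 \<omega>) + b * (X n \<omega> * X (n - 1) \<omega>))
    - (1 + b) * (V (Suc 0) \<omega> * V (Suc 0) \<omega>)" for n \<omega>
  let ?R = "\<lambda>n \<omega>. inverse ?\<kappa> * ((1 + b) * ((\<Sum>k<n. (V (Suc k) \<omega>)\<^sup>2) / real n - v)
     + inverse (sqrt (real n)) * (2 * a * ?M n \<omega> - 2 * b * (1 + b) * ?N n \<omega>) + inverse (real n) * Bd n \<omega>)"
  have "tight_seq Bd" unfolding Bd_def by (intro tight_boundary_intros)
  then have "negligible_seq ?R"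
    by (intro negligible_seq_cmult negligible_seq_add tight_scaled_negligible V_lln tight_seq_diff
          tight_seq_mult tight_seq_const M_tight N_tight)
  then show ?thesis
  proof (rule negligible_seq_eventually)
    show "\<forall>\<^sub>F n in sequentially. \<forall>\<omega>\<in>space M.
      (\<Sum>k<n. (X k \<omega>)\<^sup>2) / real n - (1 + b) * v / ?\<kappa> = ?R n \<omega>"
      using eventually_gt_at_top[of 0]
    proof (eventually_elim, intro ballI)
      fix n :: nat and \<omega> assume "0 < n" and \<omega>: "\<omega> \<in> space M"
      then obtain m where n: "n = Suc m" using gr0_implies_Suc by blast
      define S where "S = (\<Sum>k<n. (X k \<omega>)\<^sup>2)"
      define VV where "VV = (\<Sum>k<n. (V (Suc k) \<omega>)\<^sup>2)"
      define A where "A = (\<Sum>k<n - 1. X (Suc k) \<omega> * V (Suc (Suc k)) \<omega>)"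
      define B where "B = (\<Sum>k<n - 1. X k \<omega> * V (Suc (Suc k)) \<omega>)"
      have VV: "(\<Sum>k<m. (V (Suc (Suc k)) \<omega>)\<^sup>2) = VV - V (Suc 0) \<omega> * V (Suc 0) \<omega>"
        unfolding VV_def n by (simp add: sum.lessThan_Suc_shift power2_eq_square del: sum.lessThan_Suc)
      have key: "?\<kappa> * S = (1 + b) * VV + (2 * a * A - 2 * b * (1 + b) * B) + Bd n \<omega>"
        using ar2_sum_squares_identity[of "\<lambda>k. X k \<omega>" a b "\<lambda>k. V k \<omega>" m, OF X_rec[OF \<omega>]]
        unfolding VV S_def A_def B_def Bd_def n diff_Suc_1 power2_eq_square[of "X _ \<omega>"] by (simp only: algebra_simps)
      have sq: "inverse (sqrt (real n)) * (c * (x / sqrt (real n)) - d * (y / sqrt (real n))) = (c * x - d * y) / real n" for c d x y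
      proof -
        have "inverse (sqrt (real n)) * inverse (sqrt (real n)) = inverse (real n)"
          by (simp flip: inverse_mult_distrib)
        then show ?thesis by (simp add: divide_inverse algebra_simps)
      qed
      have "?\<kappa> * (S / real n - (1 + b) * v / ?\<kappa>) = (?\<kappa> * S) / real n - (1 + b) * v"
        using ab(1) by (simp add: right_diff_distrib)
      also have "\<dots> = (1 + b) * (VV / real n - v) + (2 * a * A - 2 * b * (1 + b) * B) / real n + inverse (real n) * Bd n \<omega>"
        unfolding key by (simp add: divide_inverse algebra_simps)
      finally have "?\<kappa> * (S / real n - (1 + b) * v / ?\<kappa>) = (1 + b) * (VV / real n - v)
         + (2 * a * A - 2 * b * (1 + b) * B) / real n + inverse (real n) * Bd n \<omega>" .
      moreover have "L = inverse k * R" if "k \<noteq> 0" "k * L = R" for k L R :: real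
        using that by (auto simp: mult.assoc[symmetric])
      ultimately have "S / real n - (1 + b) * v / ?\<kappa> = inverse ?\<kappa> * ((1 + b) * (VV / real n - v)
         + (2 * a * A - 2 * b * (1 + b) * B) / real n + inverse (real n) * Bd n \<omega>)"
        using ab(1) by blast
      then show "(\<Sum>k<n. (X k \<omega>)\<^sup>2) / real n - (1 + b) * v / ?\<kappa> = ?R n \<omega>"
        unfolding S_def[symmetric] VV_def[symmetric] A_def[symmetric] B_def[symmetric] sq .
    qed
  qed simp
qed

lemma ar2_cross_products_lln:
  "negligible_seq (\<lambda>n \<omega>. (\<Sum>k<n. X (Suc k) \<omega> * X k \<omega>) / real n
     - a / (1 + b) * ((1 + b) * v / ((1 - b) * ((1 + b)\<^sup>2 - a\<^sup>2))))"
proof -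
  let ?l = "(1 + b) * v / ((1 - b) * ((1 + b)\<^sup>2 - a\<^sup>2))"
  let ?M = "score1 X"
  define Bd where "Bd n \<omega> = X 1 \<omega> * X 0 \<omega> - a * (X 0 \<omega> * X 0 \<omega>) + b * (X n \<omega> * X (n - 1) \<omega>)" for n \<omega>
  let ?R = "\<lambda>n \<omega>. inverse (1 + b) * (a * ((\<Sum>k<n. (X k \<omega>)\<^sup>2) / real n - ?l)
     + inverse (sqrt (real n)) * ?M n \<omega> + inverse (real n) * Bd n \<omega>)"
  have "tight_seq Bd" unfolding Bd_def by (intro tight_boundary_intros)
  then have "negligible_seq ?R"
    by (intro negligible_seq_cmult negligible_seq_add tight_scaled_negligible ar2_sum_squares_lln M_tight)
  then show ?thesis
  proof (rule negligible_seq_eventually)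
    show "\<forall>\<^sub>F n in sequentially. \<forall>\<omega>\<in>space M.
      (\<Sum>k<n. X (Suc k) \<omega> * X k \<omega>) / real n - a / (1 + b) * ?l = ?R n \<omega>"
      using eventually_gt_at_top[of 0]
    proof (eventually_elim, intro ballI)
      fix n :: nat and \<omega> assume "0 < n" and \<omega>: "\<omega> \<in> space M"
      then obtain m where n: "n = Suc m" using gr0_implies_Suc by blast
      define S where "S = (\<Sum>k<n. (X k \<omega>)\<^sup>2)"
      define P where "P = (\<Sum>k<n. X (Suc k) \<omega> * X k \<omega>)"
      define A where "A = (\<Sum>k<n - 1. X (Suc k) \<omega> * V (Suc (Suc k)) \<omega>)"
      define l where "l = ?l"
      have key: "(1 + b) * P = a * S + A + Bd n \<omega>"
        using ar2_cross_identity[of "\<lambda>k. X k \<omega>" a b "\<lambda>k. V k \<omega>" m, OF X_rec[OF \<omega>]]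
        unfolding S_def A_def P_def Bd_def n diff_Suc_1 power2_eq_square[of "X 0 \<omega>"] .
      have sq: "inverse (sqrt (real n)) * (x / sqrt (real n)) = x / real n" for x
      proof -
        have "inverse (sqrt (real n)) * inverse (sqrt (real n)) = inverse (real n)"
          by (simp flip: inverse_mult_distrib)
        then show ?thesis by (simp add: divide_inverse algebra_simps)
      qed
      have "P = inverse (1 + b) * ((1 + b) * P)" using ab(2) by simp
      then have "P / real n - a / (1 + b) * l = inverse (1 + b) * ((a * S + A + Bd n \<omega>) / real n - a * l)"
        unfolding key by (simp add: divide_inverse algebra_simps)
      also have "\<dots> = inverse (1 + b) * (a * (S / real n - l) + A / real n + inverse (real n) * Bd n \<omega>)"
        by (simp add: divide_inverse algebra_simps)
      finally show "(\<Sum>k<n. X (Suc k) \<omega> * X k \<omega>) / real n - a / (1 + b) * ?l = ?R n \<omega>"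
        unfolding S_def[symmetric] P_def[symmetric] A_def[symmetric] sq l_def .
    qed
  qed simp
qed

end

end

section \<open>The correlated autoregression\<close>
lemma sum_lessThan_shift_zero:
  fixes f :: "nat \<Rightarrow> real"
  assumes "f 0 = 0"
  shows "(\<Sum>k<n. f k) = (\<Sum>k<n - 1. f (Suc k))"
proof (cases n)
  case (Suc m)
  have "(\<Sum>k<Suc m. f k) = f 0 + (\<Sum>k<m. f (Suc k))" by (rule sum.lessThan_Suc_shift)
  then show ?thesis using Suc assms by simp
qed simp

lemma fourth_power_sum_le: "(x + y :: real) ^ 4 \<le> 8 * (x ^ 4 + y ^ 4)"
proof -
  have sq: "(s + t)\<^sup>2 \<le> 2 * (s\<^sup>2 + t\<^sup>2)" for s t :: real
    using zero_le_power2[of "s - t"] by (simp add: power2_sum power2_diff)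
  have "(x + y) ^ 4 = ((x + y)\<^sup>2)\<^sup>2" by simp
  also have "\<dots> \<le> (2 * (x\<^sup>2 + y\<^sup>2))\<^sup>2" by (intro power_mono sq) simp
  also have "\<dots> = 4 * (x\<^sup>2 + y\<^sup>2)\<^sup>2" by (simp only: power_mult_distrib) simp
  also have "\<dots> \<le> 4 * (2 * ((x\<^sup>2)\<^sup>2 + (y\<^sup>2)\<^sup>2))" by (intro mult_left_mono sq) simp
  finally show ?thesis by simp
qed

lemma ar2_predictor_sum_squares:
  fixes y :: "nat \<Rightarrow> real"
  assumes "y 0 = 0"
  shows "(\<Sum>k<Suc m. (c * y k + d * y (k - 1))\<^sup>2) = c\<^sup>2 * (\<Sum>k<Suc m. (y k)\<^sup>2)
    + d\<^sup>2 * ((\<Sum>k<Suc m. (y k)\<^sup>2) - (y m)\<^sup>2) + 2 * c * d * ((\<Sum>k<Suc m. y (Suc k) * y k) - y (Suc m) * y m)"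
proof (induction m)
  case (Suc m)
  show ?case unfolding sum.lessThan_Suc[of _ "Suc m"] Suc diff_Suc_1
    by (simp add: power2_eq_square algebra_simps)
qed (use assms in simp)

locale correlated_ar = iid_innovations M V v for M :: "'a measure" and V v +
  fixes \<theta> \<rho> :: real
  assumes \<theta>: "\<bar>\<theta>\<bar> < 1" and \<rho>: "\<bar>\<rho>\<bar> < 1"
begin

definition noise0 :: "nat \<Rightarrow> 'a \<Rightarrow> real" where
  "noise0 k \<omega> = ar1_filter \<rho> (\<lambda>j. V j \<omega>) k"

text \<open>The process with \<open>X\<^sub>0 = \<epsilon>\<^sub>0 = 0\<close>; unlike the observed one it is adapted to the innovations.\<close>
definition Y :: "nat \<Rightarrow> 'a \<Rightarrow> real" where
  "Y k \<omega> = ar1_filter \<theta> (\<lambda>j. noise0 j \<omega>) k"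

text \<open>The limit of the mean of the squared observations.\<close>
definition ell :: real where
  "ell = (1 + \<theta> * \<rho>) * v / ((1 - \<theta> * \<rho>) * ((1 + \<theta> * \<rho>)\<^sup>2 - (\<theta> + \<rho>)\<^sup>2))"

lemma noise0_simps: "noise0 0 \<omega> = 0" "noise0 (Suc k) \<omega> = \<rho> * noise0 k \<omega> + V (Suc k) \<omega>"
  by (simp_all add: noise0_def)

lemma Y_simps: "Y 0 \<omega> = 0" "Y (Suc k) \<omega> = \<theta> * Y k \<omega> + noise0 (Suc k) \<omega>"
  by (simp_all add: Y_def)

lemma Y_rec: "Y (Suc (Suc n)) \<omega> = (\<theta> + \<rho>) * Y (Suc n) \<omega> - \<theta> * \<rho> * Y n \<omega> + V (Suc (Suc n)) \<omega>"
  by (rule ar_second_order[where e="\<lambda>k. noise0 k \<omega>" and v="\<lambda>k. V k \<omega>"]) (auto simp: Y_simps noise0_simps)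

lemma parameters:
  "\<bar>\<theta> * \<rho>\<bar> < 1" "0 < 1 + \<theta> * \<rho>" "0 < 1 - \<theta> * \<rho>"
  "(1 + \<theta> * \<rho>)\<^sup>2 - (\<theta> + \<rho>)\<^sup>2 = (1 - \<theta>\<^sup>2) * (1 - \<rho>\<^sup>2)" "0 < 1 - \<theta>\<^sup>2" "0 < 1 - \<rho>\<^sup>2"
proof -
  have "\<bar>\<theta>\<bar> * \<bar>\<rho>\<bar> \<le> \<bar>\<theta>\<bar> * 1" using \<rho> by (intro mult_left_mono) auto
  then show "\<bar>\<theta> * \<rho>\<bar> < 1" using \<theta> by (simp add: abs_mult)
  then show "0 < 1 + \<theta> * \<rho>" "0 < 1 - \<theta> * \<rho>" by linarith+
  show "(1 + \<theta> * \<rho>)\<^sup>2 - (\<theta> + \<rho>)\<^sup>2 = (1 - \<theta>\<^sup>2) * (1 - \<rho>\<^sup>2)"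
    by (simp add: power2_eq_square algebra_simps)
  show "0 < 1 - \<theta>\<^sup>2" "0 < 1 - \<rho>\<^sup>2" using \<theta> \<rho> by (simp_all add: abs_square_less_1)
qed

lemma ab: "(1 - \<theta> * \<rho>) * ((1 + \<theta> * \<rho>)\<^sup>2 - (\<theta> + \<rho>)\<^sup>2) \<noteq> 0" "1 + \<theta> * \<rho> \<noteq> 0"
  using parameters by auto

lemma noise0_past: "noise0 k \<in> borel_measurable (past k)"
proof (induction k)
  case (Suc k)
  have [measurable]: "noise0 k \<in> borel_measurable (past (Suc k))" "V (Suc k) \<in> borel_measurable (past (Suc k))"
    using measurable_F_le[OF Suc] V_past by auto
  have "noise0 (Suc k) = (\<lambda>\<omega>. \<rho> * noise0 k \<omega> + V (Suc k) \<omega>)" by (auto simp: noise0_simps)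
  then show ?case by simp
qed (simp add: noise0_def[abs_def])

lemma Y_past: "Y k \<in> borel_measurable (past k)"
proof (induction k)
  case (Suc k)
  have [measurable]: "Y k \<in> borel_measurable (past (Suc k))" "noise0 (Suc k) \<in> borel_measurable (past (Suc k))"
    using measurable_F_le[OF Suc] noise0_past by auto
  have "Y (Suc k) = (\<lambda>\<omega>. \<theta> * Y k \<omega> + noise0 (Suc k) \<omega>)" by (auto simp: Y_simps)
  then show ?case by simp
qed (simp add: Y_def[abs_def])

lemma Y_measurable [measurable]: "Y k \<in> borel_measurable M"
  by (rule measurable_F_M[OF Y_past])

lemma Y_moment4: "\<exists>C. \<forall>k. integrable M (\<lambda>\<omega>. Y k \<omega> ^ 4) \<and> expectation (\<lambda>\<omega>. Y k \<omega> ^ 4) \<le> C"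
proof -
  let ?C = "expectation (\<lambda>\<omega>. V 1 \<omega> ^ 4) / (1 - \<bar>\<rho>\<bar>) ^ 4"
  have V4: "expectation (\<lambda>\<omega>. V (Suc k) \<omega> ^ 4) \<le> expectation (\<lambda>\<omega>. V 1 \<omega> ^ 4)" for k
    by (rule eq_refl[OF V_moment4(2)])
  have noise: "noise0 k \<in> borel_measurable M \<and> integrable M (\<lambda>\<omega>. noise0 k \<omega> ^ 4) \<and> expectation (\<lambda>\<omega>. noise0 k \<omega> ^ 4) \<le> ?C" for k
    by (rule autoregression_fourth_moment[OF \<rho>, where N=V])
       (use V_measurable V_moment4(1) V4 in \<open>auto simp: noise0_simps\<close>)
  have "Y k \<in> borel_measurable M \<and> integrable M (\<lambda>\<omega>. Y k \<omega> ^ 4) \<and> expectation (\<lambda>\<omega>. Y k \<omega> ^ 4) \<le> ?C / (1 - \<bar>\<theta>\<bar>) ^ 4" for k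
    by (rule autoregression_fourth_moment[OF \<theta>, where N=noise0]) (use noise in \<open>auto simp: Y_simps\<close>)
  then show ?thesis by blast
qed

lemma Y_tight: "tight_seq Y"
proof -
  obtain C where C: "\<And>k. integrable M (\<lambda>\<omega>. Y k \<omega> ^ 4)" "\<And>k. expectation (\<lambda>\<omega>. Y k \<omega> ^ 4) \<le> C"
    using Y_moment4 by blast
  show ?thesis
  proof (rule tight_seq_of_bounded_mean)
    fix k
    show "integrable M (Y k)"
      using moments_below_fourth(1)[of "Y k" 1] C[of k] by (simp add: integrable_abs_iff)
    show "expectation (\<lambda>\<omega>. \<bar>Y k \<omega>\<bar>) \<le> 1 + C"
      using moments_below_fourth(2)[of "Y k" 1] C[of k] by simp
  qed
qed

lemma Y_predecessor_past: "Y (k - 1) \<in> borel_measurable (past k)"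
  using measurable_F_le[OF Y_past] by simp

lemma Y_score_tight:
  "tight_seq (score1 Y)"
  "tight_seq (score2 Y)"
proof -
  obtain C where C: "\<And>k. integrable M (\<lambda>\<omega>. Y k \<omega> ^ 4)" "\<And>k. expectation (\<lambda>\<omega>. Y k \<omega> ^ 4) \<le> C"
    using Y_moment4 by blast
  have Y2: "integrable M (\<lambda>\<omega>. (Y k \<omega>)\<^sup>2)" "expectation (\<lambda>\<omega>. (Y k \<omega>)\<^sup>2) \<le> 1 + C" for k
    using moments_below_fourth[of "Y k" 2] C[of k] by auto
  note tight = innovation_sum_tight[OF innovation_V _ _ _ V_square_integrable, of _ "1 + C" v]
  have "tight_seq (\<lambda>n \<omega>. (\<Sum>k<n. Y k \<omega> * V (Suc k) \<omega>) / sqrt (real n))"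
    by (rule tight) (use Y_past Y2 second_moment mean in auto)
  then show "tight_seq (score1 Y)"
    by (subst (asm) sum_lessThan_shift_zero) (auto simp: Y_simps(1))
  have "tight_seq (\<lambda>n \<omega>. (\<Sum>k<n. Y (k - 1) \<omega> * V (Suc k) \<omega>) / sqrt (real n))"
    by (rule tight) (use Y_predecessor_past Y2 second_moment mean in auto)
  then show "tight_seq (score2 Y)"
    by (subst (asm) sum_lessThan_shift_zero) (auto simp: Y_simps(1))
qed

text \<open>
The linear combination of the scores is the transform with weights \<open>c Y\<^sub>k + d Y\<^sub>k\<^sub>-\<^sub>1\<close>. For \<open>k = 0\<close> the
truncated difference \<open>0 - 1 = 0\<close> yields \<open>Y\<^sub>0 = 0\<close> as predecessor, so the first weight vanishes.
\<close>
lemma Y_clt: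
  fixes c d :: real
  defines "r \<equiv> (\<theta> + \<rho>) / (1 + \<theta> * \<rho>)"
  assumes nonneg: "0 \<le> (c\<^sup>2 + d\<^sup>2 + 2 * c * d * r) * ell"
  shows "(\<lambda>n. \<integral>\<omega>. iexp (c * score1 Y n \<omega> + d * score2 Y n \<omega>) \<partial>M)
     \<longlonglongrightarrow> exp (- (v * ((c\<^sup>2 + d\<^sup>2 + 2 * c * d * r) * ell) / 2))"
proof -
  define W where "W k \<omega> = c * Y k \<omega> + d * Y (k - 1) \<omega>" for k \<omega>
  obtain C where C: "\<And>k. integrable M (\<lambda>\<omega>. Y k \<omega> ^ 4)" "\<And>k. expectation (\<lambda>\<omega>. Y k \<omega> ^ 4) \<le> C"
    using Y_moment4 by blast
  have W_past: "W k \<in> borel_measurable (past k)" for k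
    unfolding W_def[abs_def] using Y_past Y_predecessor_past by measurable
  have [measurable]: "W k \<in> borel_measurable M" for k by (rule measurable_F_M[OF W_past])
  define D where "D = 8 * (c ^ 4 * C + d ^ 4 * C)"
  have W4: "integrable M (\<lambda>\<omega>. W k \<omega> ^ 4)" "expectation (\<lambda>\<omega>. W k \<omega> ^ 4) \<le> D" for k
  proof -
    have le: "W k \<omega> ^ 4 \<le> 8 * (c ^ 4 * Y k \<omega> ^ 4 + d ^ 4 * Y (k - 1) \<omega> ^ 4)" for \<omega>
      unfolding W_def using fourth_power_sum_le[of "c * Y k \<omega>" "d * Y (k - 1) \<omega>"] by (simp add: power_mult_distrib)
    have i: "integrable M (\<lambda>\<omega>. 8 * (c ^ 4 * Y k \<omega> ^ 4 + d ^ 4 * Y (k - 1) \<omega> ^ 4))" using C by simp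
    show W4: "integrable M (\<lambda>\<omega>. W k \<omega> ^ 4)"
      by (rule Bochner_Integration.integrable_bound[OF i]) (use le in \<open>auto intro!: AE_I2 order_trans[OF _ abs_ge_self]\<close>)
    have "expectation (\<lambda>\<omega>. W k \<omega> ^ 4) \<le> expectation (\<lambda>\<omega>. 8 * (c ^ 4 * Y k \<omega> ^ 4 + d ^ 4 * Y (k - 1) \<omega> ^ 4))"
      using i W4 le by (intro integral_mono)
    also have "\<dots> = 8 * (c ^ 4 * expectation (\<lambda>\<omega>. Y k \<omega> ^ 4) + d ^ 4 * expectation (\<lambda>\<omega>. Y (k - 1) \<omega> ^ 4))"
      using C(1) by simp
    also have "\<dots> \<le> D" unfolding D_def using C(2) by (intro mult_left_mono add_mono) auto
    finally show "expectation (\<lambda>\<omega>. W k \<omega> ^ 4) \<le> D" .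
  qed
  have W3: "integrable M (\<lambda>\<omega>. \<bar>W k \<omega>\<bar> ^ 3)" "expectation (\<lambda>\<omega>. \<bar>W k \<omega>\<bar> ^ 3) \<le> 1 + D" for k
    using moments_below_fourth[of "W k" 3] W4[of k] by auto
  have V3: "integrable M (\<lambda>\<omega>. \<bar>V (Suc k) \<omega>\<bar> ^ 3)"
    "expectation (\<lambda>\<omega>. \<bar>V (Suc k) \<omega>\<bar> ^ 3) \<le> 1 + expectation (\<lambda>\<omega>. V 1 \<omega> ^ 4)" for k
    using moments_below_fourth[of "V (Suc k)" 3] V_moment4[of k] by auto
  have lln: "negligible_seq (\<lambda>n \<omega>. (\<Sum>k<n. (W k \<omega>)\<^sup>2) / real n - (c\<^sup>2 + d\<^sup>2 + 2 * c * d * r) * ell)"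
  proof -
    let ?S = "\<lambda>n \<omega>. (\<Sum>k<n. (Y k \<omega>)\<^sup>2) / real n" and ?P = "\<lambda>n \<omega>. (\<Sum>k<n. Y (Suc k) \<omega> * Y k \<omega>) / real n"
    have S: "negligible_seq (\<lambda>n \<omega>. ?S n \<omega> - ell)"
      unfolding ell_def by (rule ar2_sum_squares_lln[OF Y_rec Y_tight Y_score_tight ab])
    have P: "negligible_seq (\<lambda>n \<omega>. ?P n \<omega> - r * ell)"
      unfolding ell_def r_def by (rule ar2_cross_products_lln[OF Y_rec Y_tight Y_score_tight ab])
    let ?B = "\<lambda>n \<omega>. - d\<^sup>2 * (Y (n - 1) \<omega> * Y (n - 1) \<omega>) - 2 * c * d * (Y n \<omega> * Y (n - 1) \<omega>)"
    let ?R = "\<lambda>n \<omega>. (c\<^sup>2 + d\<^sup>2) * (?S n \<omega> - ell) + 2 * c * d * (?P n \<omega> - r * ell) + inverse (real n) * ?B n \<omega>"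
    have B: "tight_seq ?B"
      by (intro tight_seq_diff tight_seq_mult tight_seq_const Y_tight tight_seq_pred[OF Y_tight])
    have "negligible_seq ?R"
      by (intro negligible_seq_add negligible_seq_cmult tight_scaled_negligible S P B)
    then show ?thesis
    proof (rule negligible_seq_eventually)
      show "\<forall>\<^sub>F n in sequentially. \<forall>\<omega>\<in>space M. (\<Sum>k<n. (W k \<omega>)\<^sup>2) / real n - (c\<^sup>2 + d\<^sup>2 + 2 * c * d * r) * ell
        = ?R n \<omega>"
        using eventually_gt_at_top[of 0]
      proof (eventually_elim, intro ballI)
        fix n :: nat and \<omega> assume "0 < n"
        then obtain m where n: "n = Suc m" using gr0_implies_Suc by blast
        define S where "S = (\<Sum>k<n. (Y k \<omega>)\<^sup>2)"
        define P where "P = (\<Sum>k<n. Y (Suc k) \<omega> * Y k \<omega>)"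
        have key: "(\<Sum>k<n. (W k \<omega>)\<^sup>2) = c\<^sup>2 * S + d\<^sup>2 * (S - (Y (n - 1) \<omega>)\<^sup>2) + 2 * c * d * (P - Y n \<omega> * Y (n - 1) \<omega>)"
          using ar2_predictor_sum_squares[of "\<lambda>k. Y k \<omega>" c d m, OF Y_simps(1)]
          unfolding W_def S_def P_def n diff_Suc_1 .
        then show "(\<Sum>k<n. (W k \<omega>)\<^sup>2) / real n - (c\<^sup>2 + d\<^sup>2 + 2 * c * d * r) * ell
          = ?R n \<omega>"
          unfolding key S_def[symmetric] P_def[symmetric] by (simp add: divide_inverse power2_eq_square algebra_simps)
      qed
    qed simp
  qed
  have "(\<lambda>n. \<integral>\<omega>. iexp ((\<Sum>k<n. W k \<omega> * V (Suc k) \<omega>) / sqrt (real n)) \<partial>M)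
     \<longlonglongrightarrow> exp (- (v * ((c\<^sup>2 + d\<^sup>2 + 2 * c * d * r) * ell) / 2))"
    by (rule innovation_transform_clt[OF innovation_V W_past _ V_square_integrable _ V3 W3 nonneg lln])
       (use mean second_moment in auto)
  moreover have "(\<Sum>k<n. W k \<omega> * V (Suc k) \<omega>) / sqrt (real n) =
      c * score1 Y n \<omega> + d * score2 Y n \<omega>" for n \<omega>
  proof -
    have "(\<Sum>k<n. W k \<omega> * V (Suc k) \<omega>) = (\<Sum>k<n - 1. W (Suc k) \<omega> * V (Suc (Suc k)) \<omega>)"
      by (rule sum_lessThan_shift_zero) (simp add: W_def Y_simps(1))
    also have "\<dots> = c * (\<Sum>k<n - 1. Y (Suc k) \<omega> * V (Suc (Suc k)) \<omega>) + d * (\<Sum>k<n - 1. Y k \<omega> * V (Suc (Suc k)) \<omega>)"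
      by (simp add: W_def sum.distrib sum_distrib_left distrib_right mult.assoc)
    finally show ?thesis by (simp add: add_divide_distrib)
  qed
  ultimately show ?thesis by simp
qed

end

locale correlated_ar_path = correlated_ar M V v \<theta> \<rho>
  for M :: "'a measure" and V v \<theta> \<rho> +
  fixes X \<epsilon> :: "nat \<Rightarrow> 'a \<Rightarrow> real"
  assumes X0 [measurable]: "X 0 \<in> borel_measurable M" and \<epsilon>0 [measurable]: "\<epsilon> 0 \<in> borel_measurable M"
    and X_step: "\<And>n \<omega>. \<omega> \<in> space M \<Longrightarrow> X (Suc n) \<omega> = \<theta> * X n \<omega> + \<epsilon> (Suc n) \<omega>"
    and \<epsilon>_step: "\<And>n \<omega>. \<omega> \<in> space M \<Longrightarrow> \<epsilon> (Suc n) \<omega> = \<rho> * \<epsilon> n \<omega> + V (Suc n) \<omega>"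
begin

lemma X_rec: "\<omega> \<in> space M \<Longrightarrow>
    X (Suc (Suc n)) \<omega> = (\<theta> + \<rho>) * X (Suc n) \<omega> - \<theta> * \<rho> * X n \<omega> + V (Suc (Suc n)) \<omega>"
  by (rule ar_second_order[where e="\<lambda>k. \<epsilon> k \<omega>" and v="\<lambda>k. V k \<omega>"]) (auto simp: X_step \<epsilon>_step)

lemma X_measurable [measurable]: "X n \<in> borel_measurable M"
proof -
  have "X n \<in> borel_measurable M \<and> \<epsilon> n \<in> borel_measurable M"
  proof (induction n)
    case (Suc n)
    then have [measurable]: "X n \<in> borel_measurable M" "\<epsilon> n \<in> borel_measurable M" by auto
    have [measurable]: "\<epsilon> (Suc n) \<in> borel_measurable M"
      by (subst measurable_cong[OF \<epsilon>_step]) auto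
    have "X (Suc n) \<in> borel_measurable M"
      by (subst measurable_cong[OF X_step]) auto
    then show ?case by simp
  qed simp
  then show ?thesis ..
qed

lemma initial_effect_bound:
  "\<exists>K q. K \<in> borel_measurable M \<and> 0 < q \<and> q < 1 \<and> (\<forall>\<omega>. 0 \<le> K \<omega>) \<and> (\<forall>n. \<forall>\<omega>\<in>space M. \<bar>X n \<omega> - Y n \<omega>\<bar> \<le> K \<omega> * q ^ n)"
proof -
  define q where "q = (1 + max \<bar>\<theta>\<bar> \<bar>\<rho>\<bar>) / 2"
  have q: "0 < q" "q < 1" "\<bar>\<theta>\<bar> < q" "\<bar>\<rho>\<bar> \<le> q" using \<theta> \<rho> by (auto simp: q_def)
  define K where "K \<omega> = \<bar>X 0 \<omega>\<bar> + \<bar>\<epsilon> 0 \<omega>\<bar> * q / (q - \<bar>\<theta>\<bar>)" for \<omega>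
  have "\<bar>X n \<omega> - Y n \<omega>\<bar> \<le> K \<omega> * q ^ n" if \<omega>: "\<omega> \<in> space M" for n \<omega>
  proof -
    have noise: "\<epsilon> k \<omega> - noise0 k \<omega> = \<rho> ^ k * \<epsilon> 0 \<omega>" for k
      by (induction k) (simp_all add: noise0_simps \<epsilon>_step[OF \<omega>] algebra_simps)
    have "X (Suc k) \<omega> - Y (Suc k) \<omega> = \<theta> * (X k \<omega> - Y k \<omega>) + \<rho> ^ Suc k * \<epsilon> 0 \<omega>" for k
      unfolding X_step[OF \<omega>] Y_simps noise[symmetric] by (simp add: algebra_simps)
    from ar_difference_bound[of "\<lambda>k. X k \<omega> - Y k \<omega>", OF this q(3,4)]
    show ?thesis by (simp add: K_def Y_simps)
  qed
  moreover have "K \<in> borel_measurable M" unfolding K_def by measurable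
  moreover have "0 \<le> K \<omega>" for \<omega> using q by (simp add: K_def)
  ultimately show ?thesis using q by blast
qed

lemma X_tight: "tight_seq X"
proof -
  obtain K q where K [measurable]: "K \<in> borel_measurable M" and q: "0 < q" "q < 1" and K0: "\<And>\<omega>. 0 \<le> K \<omega>"
    and bound: "\<And>n \<omega>. \<omega> \<in> space M \<Longrightarrow> \<bar>X n \<omega> - Y n \<omega>\<bar> \<le> K \<omega> * q ^ n"
    using initial_effect_bound by blast
  have "tight_seq (\<lambda>n \<omega>. X n \<omega> - Y n \<omega>)"
  proof (rule tight_seq_mono[OF tight_seq_constant[OF K]])
    fix n \<omega> assume "\<omega> \<in> space M"
    then have "\<bar>X n \<omega> - Y n \<omega>\<bar> \<le> K \<omega> * q ^ n" by (rule bound)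
    also have "\<dots> \<le> K \<omega> * 1" using K0 q by (intro mult_left_mono power_le_one) auto
    finally show "\<bar>X n \<omega> - Y n \<omega>\<bar> \<le> \<bar>K \<omega>\<bar>" by simp
  qed simp
  from tight_seq_add[OF this Y_tight] show ?thesis by simp
qed

text \<open>
The scores differ by at most \<open>K \<Sum> q\<^sup>k \<bar>V\<^sub>k\<^sub>+\<^sub>2\<bar> / \<surd>n\<close> with \<open>K\<close> depending on the initial values. The sum
has bounded expectation and \<open>K\<close> is finite, so \<open>K \<Sum> q\<^sup>k \<bar>V\<^sub>k\<^sub>+\<^sub>2\<bar>\<close> is tight.
\<close>
lemma score_difference_negligible:
  "negligible_seq (\<lambda>n \<omega>. (\<Sum>k<n - 1. X (k + j) \<omega> * V (Suc (Suc k)) \<omega>) / sqrt (real n)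
     - (\<Sum>k<n - 1. Y (k + j) \<omega> * V (Suc (Suc k)) \<omega>) / sqrt (real n))"
proof -
  obtain K q where K [measurable]: "K \<in> borel_measurable M" and q: "0 < q" "q < 1" and K0: "\<And>\<omega>. 0 \<le> K \<omega>"
    and bound: "\<And>n \<omega>. \<omega> \<in> space M \<Longrightarrow> \<bar>X n \<omega> - Y n \<omega>\<bar> \<le> K \<omega> * q ^ n"
    using initial_effect_bound by blast
  have V1: "integrable M (\<lambda>\<omega>. \<bar>V (Suc k) \<omega>\<bar>)" for k
    using moments_below_fourth(1)[of "V (Suc k)" 1] V_moment4[of k] by simp
  have V1E: "expectation (\<lambda>\<omega>. \<bar>V (Suc k) \<omega>\<bar>) = expectation (\<lambda>\<omega>. \<bar>V 1 \<omega>\<bar>)" for k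
    using moment_ident[of "\<lambda>x. \<bar>x\<bar>" k] by simp
  let ?G = "\<lambda>n \<omega>. \<Sum>k<n - 1. q ^ k * \<bar>V (Suc (Suc k)) \<omega>\<bar>"
  have G: "tight_seq ?G"
  proof (rule tight_seq_of_bounded_mean)
    fix n
    show "integrable M (?G n)" using V1 by simp
    have "expectation (\<lambda>\<omega>. \<bar>?G n \<omega>\<bar>) = expectation (?G n)"
      using q by (intro Bochner_Integration.integral_cong) (auto intro!: abs_of_nonneg sum_nonneg)
    also have "\<dots> = (\<Sum>k<n - 1. q ^ k * expectation (\<lambda>\<omega>. \<bar>V 1 \<omega>\<bar>))"
      using V1 by (simp only: Bochner_Integration.integral_sum integrable_mult_right integral_mult_right_zero V1E)
    also have "\<dots> = (\<Sum>k<n - 1. q ^ k) * expectation (\<lambda>\<omega>. \<bar>V 1 \<omega>\<bar>)" by (simp add: sum_distrib_right)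
    also have "\<dots> \<le> (1 / (1 - q)) * expectation (\<lambda>\<omega>. \<bar>V 1 \<omega>\<bar>)"
    proof (intro mult_right_mono)
      have "(\<Sum>k<n - 1. q ^ k) = (1 - q ^ (n - 1)) / (1 - q)" using q by (simp add: sum_gp_strict)
      also have "\<dots> \<le> 1 / (1 - q)" using q by (intro divide_right_mono) auto
      finally show "(\<Sum>k<n - 1. q ^ k) \<le> 1 / (1 - q)" .
    qed simp
    finally show "expectation (\<lambda>\<omega>. \<bar>?G n \<omega>\<bar>) \<le> (1 / (1 - q)) * expectation (\<lambda>\<omega>. \<bar>V 1 \<omega>\<bar>)" .
  qed
  have "tight_seq (\<lambda>n \<omega>. \<Sum>k<n - 1. (X (k + j) \<omega> - Y (k + j) \<omega>) * V (Suc (Suc k)) \<omega>)"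
  proof (rule tight_seq_mono[OF tight_seq_mult[OF tight_seq_constant[OF K] G]])
    fix n \<omega> assume \<omega>: "\<omega> \<in> space M"
    have "\<bar>\<Sum>k<n - 1. (X (k + j) \<omega> - Y (k + j) \<omega>) * V (Suc (Suc k)) \<omega>\<bar>
        \<le> (\<Sum>k<n - 1. \<bar>X (k + j) \<omega> - Y (k + j) \<omega>\<bar> * \<bar>V (Suc (Suc k)) \<omega>\<bar>)"
      using sum_abs[of "\<lambda>k. (X (k + j) \<omega> - Y (k + j) \<omega>) * V (Suc (Suc k)) \<omega>"] by (simp add: abs_mult)
    also have "\<dots> \<le> (\<Sum>k<n - 1. K \<omega> * (q ^ k * \<bar>V (Suc (Suc k)) \<omega>\<bar>))"
    proof (rule sum_mono)
      fix k
      have "\<bar>X (k + j) \<omega> - Y (k + j) \<omega>\<bar> \<le> K \<omega> * q ^ (k + j)" by (rule bound[OF \<omega>])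
      also have "\<dots> \<le> K \<omega> * q ^ k" using q K0 by (intro mult_left_mono power_decreasing) auto
      finally show "\<bar>X (k + j) \<omega> - Y (k + j) \<omega>\<bar> * \<bar>V (Suc (Suc k)) \<omega>\<bar> \<le> K \<omega> * (q ^ k * \<bar>V (Suc (Suc k)) \<omega>\<bar>)"
        by (simp add: mult.assoc[symmetric] mult_right_mono)
    qed
    also have "\<dots> = K \<omega> * ?G n \<omega>" by (simp add: sum_distrib_left)
    finally show "\<bar>\<Sum>k<n - 1. (X (k + j) \<omega> - Y (k + j) \<omega>) * V (Suc (Suc k)) \<omega>\<bar> \<le> \<bar>K \<omega> * ?G n \<omega>\<bar>" by linarith
  qed simp
  then have "negligible_seq (\<lambda>n \<omega>. inverse (sqrt (real n)) * (\<Sum>k<n - 1. (X (k + j) \<omega> - Y (k + j) \<omega>) * V (Suc (Suc k)) \<omega>))"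
    by (intro tight_scaled_negligible)
  then show ?thesis by (simp add: left_diff_distrib sum_subtractf divide_inverse algebra_simps)
qed

lemma X_score_tight:
  "tight_seq (score1 X)"
  "tight_seq (score2 X)"
proof -
  show "tight_seq (score1 X)"
    using tight_seq_add[OF negligible_imp_tight[OF score_difference_negligible[of 1]]
        Y_score_tight(1)[folded Suc_eq_plus1]]
    unfolding diff_add_cancel Suc_eq_plus1 .
  show "tight_seq (score2 X)"
    using tight_seq_add[OF negligible_imp_tight[OF score_difference_negligible[of 0, unfolded add_0_right]]
        Y_score_tight(2)]
    unfolding diff_add_cancel .
qed

lemma X_score_clt:
  fixes c d :: real
  defines "r \<equiv> (\<theta> + \<rho>) / (1 + \<theta> * \<rho>)"
  assumes nonneg: "0 \<le> (c\<^sup>2 + d\<^sup>2 + 2 * c * d * r) * ell"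
  shows "(\<lambda>n. \<integral>\<omega>. iexp (c * score1 X n \<omega> + d * score2 X n \<omega>) \<partial>M)
     \<longlonglongrightarrow> exp (- (v * ((c\<^sup>2 + d\<^sup>2 + 2 * c * d * r) * ell) / 2))"
proof (rule char_limit_negligible_diff[OF Y_clt[OF nonneg[unfolded r_def], folded r_def]])
  show "negligible_seq (\<lambda>n \<omega>.
      (c * score1 X n \<omega> + d * score2 X n \<omega>)
    - (c * score1 Y n \<omega> + d * score2 Y n \<omega>))"
    using negligible_seq_add[OF negligible_seq_cmult[OF score_difference_negligible[of 1], of c]
        negligible_seq_cmult[OF score_difference_negligible[of 0], of d]]
    by (simp add: algebra_simps)
qed simp_all

end

section \<open>The estimators\<close>
lemma theta_hat_sums: "theta_hat x n = (\<Sum>k<n. x (Suc k) * x k) / (\<Sum>k<n. (x k)\<^sup>2)"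
  by (simp add: theta_hat_def sum.atLeast1_atMost_eq)

lemma residual_cross_sum:
  fixes x :: "nat \<Rightarrow> real"
  shows "(x 1 - t * x 0) * x 0 + (\<Sum>k<m. (x (Suc (Suc k)) - t * x (Suc k)) * (x (Suc k) - t * x k)) =
    (\<Sum>k<Suc m. x (Suc k) * x k) - t * (\<Sum>k<m. x (Suc (Suc k)) * x k) - t * (\<Sum>k<Suc m. (x k)\<^sup>2)
    + t\<^sup>2 * ((\<Sum>k<Suc m. x (Suc k) * x k) - x (Suc m) * x m)"
  by (induction m) (simp_all add: power2_eq_square algebra_simps)

lemma residual_square_sum:
  fixes x :: "nat \<Rightarrow> real"
  shows "(x 0)\<^sup>2 + (\<Sum>k<m. (x (Suc k) - t * x k)\<^sup>2) =
    (\<Sum>k<Suc m. (x k)\<^sup>2) - 2 * t * ((\<Sum>k<Suc m. x (Suc k) * x k) - x (Suc m) * x m)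
    + t\<^sup>2 * ((\<Sum>k<Suc m. (x k)\<^sup>2) - (x m)\<^sup>2)"
  by (induction m) (simp_all add: power2_eq_square algebra_simps)

lemma rho_hat_sums:
  fixes x :: "nat \<Rightarrow> real" and m :: nat
  defines "t \<equiv> theta_hat x (Suc m)"
  shows "rho_hat x (Suc m) =
    ((\<Sum>k<Suc m. x (Suc k) * x k) - t * (\<Sum>k<m. x (Suc (Suc k)) * x k) - t * (\<Sum>k<Suc m. (x k)\<^sup>2)
      + t\<^sup>2 * ((\<Sum>k<Suc m. x (Suc k) * x k) - x (Suc m) * x m)) /
    ((\<Sum>k<Suc m. (x k)\<^sup>2) - 2 * t * ((\<Sum>k<Suc m. x (Suc k) * x k) - x (Suc m) * x m)
      + t\<^sup>2 * ((\<Sum>k<Suc m. (x k)\<^sup>2) - (x m)\<^sup>2))"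
proof -
  let ?r = "residual x (Suc m)"
  have r0: "?r 0 = x 0" and r: "?r (Suc k) = x (Suc k) - t * x k" for k
    by (simp_all add: residual_def t_def)
  have "(\<Sum>k=1..Suc m. ?r k * ?r (k - 1)) = (\<Sum>k<Suc m. ?r (Suc k) * ?r k)"
    by (simp add: sum.atLeast1_atMost_eq)
  also have "\<dots> = (x 1 - t * x 0) * x 0 + (\<Sum>k<m. (x (Suc (Suc k)) - t * x (Suc k)) * (x (Suc k) - t * x k))"
    by (simp add: sum.lessThan_Suc_shift r r0 del: sum.lessThan_Suc)
  finally have num: "(\<Sum>k=1..Suc m. ?r k * ?r (k - 1)) = \<dots>" .
  have "(\<Sum>k=1..Suc m. (?r (k - 1))\<^sup>2) = (\<Sum>k<Suc m. (?r k)\<^sup>2)"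
    by (simp add: sum.atLeast1_atMost_eq)
  also have "\<dots> = (x 0)\<^sup>2 + (\<Sum>k<m. (x (Suc k) - t * x k)\<^sup>2)"
    by (simp add: sum.lessThan_Suc_shift r r0 del: sum.lessThan_Suc)
  finally have den: "(\<Sum>k=1..Suc m. (?r (k - 1))\<^sup>2) = \<dots>" .
  show ?thesis unfolding rho_hat_def num den residual_cross_sum residual_square_sum ..
qed

text \<open>
The reason for the second formula is the factorisation
\<open>z\<^sup>3 - a z\<^sup>2 + b z - b \<tau> (1 - z\<^sup>2) = (z - \<tau>) (z\<^sup>2 + b)\<close>, valid as \<open>a = (1 + b) \<tau>\<close>: it turns the part of
the numerator that is of order \<open>n\<close> into a multiple of \<open>s (t - \<tau>)\<close>, which the first formula expresses
through the score.
\<close>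
lemma estimators_exact_expansion:
  fixes x v :: "nat \<Rightarrow> real" and a b :: real and m n :: nat
  assumes rec: "\<And>n. x (Suc (Suc n)) = a * x (Suc n) - b * x n + v (Suc (Suc n))"
    and b: "1 + b \<noteq> 0" and n: "n = Suc m"
  defines "t \<equiv> theta_hat x n" and "s \<equiv> (\<Sum>k<n. (x k)\<^sup>2) / real n"
    and "\<tau> \<equiv> a / (1 + b)"
    and "e0 \<equiv> (x 1 * x 0 - a * (x 0 * x 0)) / sqrt (real n)"
    and "e1 \<equiv> (x n * x (n - 1)) / sqrt (real n)" and "e2 \<equiv> (x (n - 1) * x (n - 1)) / sqrt (real n)"
  defines "\<mu> \<equiv> ((\<Sum>k<n - 1. x (Suc k) * v (Suc (Suc k))) / sqrt (real n) + e0 + b * e1) / (1 + b)"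
    and "\<nu> \<equiv> (\<Sum>k<n - 1. x k * v (Suc (Suc k))) / sqrt (real n) + b * e2 - a * e1"
  defines "D \<equiv> s * (1 - t\<^sup>2) + inverse (sqrt (real n)) * (2 * t * e1 - t\<^sup>2 * e2)"
    and "N \<equiv> \<mu> * (t\<^sup>2 + b) - t * \<nu> - t\<^sup>2 * e1 - b * \<tau> * (2 * t * e1 - t\<^sup>2 * e2)"
  assumes s: "s \<noteq> 0"
  shows "sqrt (real n) * (t - \<tau>) = \<mu> * inverse s"
    and "D \<noteq> 0 \<Longrightarrow> sqrt (real n) * (rho_hat x n - b * \<tau>) = N * inverse D"
proof -
  define H where "H = sqrt (real n)"
  have H: "0 < H" "real n = H * H" using n by (auto simp: H_def)
  define S where "S = (\<Sum>k<n. (x k)\<^sup>2)"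
  define P where "P = (\<Sum>k<n. x (Suc k) * x k)"
  define A where "A = (\<Sum>k<n - 1. x (Suc k) * v (Suc (Suc k)))"
  define B where "B = (\<Sum>k<n - 1. x k * v (Suc (Suc k)))"
  define Q where "Q = (\<Sum>k<n - 1. x (Suc (Suc k)) * x k)"
  have S: "S = H * H * s" using H by (simp add: s_def S_def)
  then have "S \<noteq> 0" using s H by simp
  then have P: "P = t * S" by (simp add: t_def theta_hat_sums S_def P_def)
  have e: "x n * x (n - 1) = H * e1" "x (n - 1) * x (n - 1) = H * e2" "x 1 * x 0 - a * (x 0 * x 0) = H * e0"
    using H(1) by (simp_all add: e1_def e2_def e0_def H_def)
  have \<mu>: "(1 + b) * H * \<mu> = A + H * e0 + b * (H * e1)"
  proof -
    have "(1 + b) * H * \<mu> = H * (A / H + e0 + b * e1)"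
      unfolding \<mu>_def A_def[symmetric] H_def[symmetric] using b by simp
    also have "\<dots> = A + H * e0 + b * (H * e1)" using H(1) by (simp add: distrib_left)
    finally show ?thesis .
  qed
  have \<nu>: "H * \<nu> = B + b * (H * e2) - a * (H * e1)"
    unfolding \<nu>_def B_def[symmetric] H_def[symmetric] using H(1) by (simp add: algebra_simps)
  have a: "a = (1 + b) * \<tau>" using b by (simp add: \<tau>_def)
  have "(1 + b) * P = a * S + A + (x 1 * x 0 - a * (x 0 * x 0) + b * (x n * x (n - 1)))"
    using ar2_cross_identity[of x a b v m, OF rec]
    unfolding S_def A_def P_def n diff_Suc_1 power2_eq_square[of "x 0"] .
  then have "(1 + b) * (t * S) = a * S + (1 + b) * H * \<mu>" unfolding e P \<mu> by simp
  then have "(1 + b) * (H * \<mu>) = (1 + b) * (H * ((t - \<tau>) * H * s))" unfolding a S by (simp add: algebra_simps)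
  then have mu: "\<mu> = (t - \<tau>) * H * s" using b H(1) by simp
  then show "sqrt (real n) * (t - \<tau>) = \<mu> * inverse s" using s by (simp add: H_def)
  have HD: "H * D = H * s * (1 - t\<^sup>2) + (2 * t * e1 - t\<^sup>2 * e2)"
    using H(1) by (simp add: D_def H_def[symmetric] distrib_left)
  have Q: "Q = a * (P - H * e1) - b * (S - H * e2) + B"
  proof -
    have "P - H * e1 = (\<Sum>k<m. x (Suc k) * x k)" "S - H * e2 = (\<Sum>k<m. (x k)\<^sup>2)"
      unfolding e(1,2)[symmetric] P_def S_def n by (simp_all add: power2_eq_square)
    then show ?thesis using ar2_lag_two_identity[of x a b v m, OF rec] unfolding Q_def B_def n diff_Suc_1 by simp
  qed
  have rho: "rho_hat x n = (P - t * Q - t * S + t\<^sup>2 * (P - H * e1)) / (S - 2 * t * (P - H * e1) + t\<^sup>2 * (S - H * e2))"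
    using rho_hat_sums[of x m] unfolding e(1,2)[symmetric] P_def S_def Q_def t_def n diff_Suc_1 power2_eq_square[of "x m"] .
  have den: "S - 2 * t * (P - H * e1) + t\<^sup>2 * (S - H * e2) = H * (H * D)"
    unfolding HD P S by (simp add: power2_eq_square algebra_simps)
  have num: "P - t * Q - t * S + t\<^sup>2 * (P - H * e1) = b * \<tau> * (H * (H * D)) + H * N"
  proof -
    have "H * N = (H * \<mu>) * (t\<^sup>2 + b) - t * (H * \<nu>) - H * (t\<^sup>2 * e1 + b * \<tau> * (2 * t * e1 - t\<^sup>2 * e2))"
      by (simp add: N_def algebra_simps)
    then show ?thesis
      unfolding HD Q P S mu \<nu> a by (simp add: power2_eq_square algebra_simps)
  qed
  assume "D \<noteq> 0"
  have "H * (rho_hat x n - b * \<tau>) = N * inverse D"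
    unfolding rho den num using \<open>D \<noteq> 0\<close> H(1) by (simp add: field_simps)
  then show "sqrt (real n) * (rho_hat x n - b * \<tau>) = N * inverse D" by (simp add: H_def)
qed

lemma (in prob_space) prob_vanishing_null:
  assumes Z: "negligible_seq (\<lambda>n \<omega>. Z n \<omega> - c)" and "c \<noteq> 0"
  shows "(\<lambda>n. prob {\<omega>\<in>space M. Z n \<omega> = 0}) \<longlonglongrightarrow> 0"
proof (rule tendsto_sandwich[where f="\<lambda>_. 0"])
  have [measurable]: "Z n \<in> borel_measurable M" for n
    using tight_seq_measurable[OF tight_seq_of_negligible_diff[OF Z]] .
  show "(\<lambda>n. prob {\<omega>\<in>space M. \<bar>c\<bar> / 2 < \<bar>Z n \<omega> - c\<bar>}) \<longlonglongrightarrow> 0"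
  proof -
    have "0 < \<bar>c\<bar> / 2" using \<open>c \<noteq> 0\<close> by simp
    then show ?thesis using Z unfolding negligible_seq_def by blast
  qed
  show "\<forall>\<^sub>F n in sequentially. prob {\<omega>\<in>space M. Z n \<omega> = 0} \<le> prob {\<omega>\<in>space M. \<bar>c\<bar> / 2 < \<bar>Z n \<omega> - c\<bar>}"
    using \<open>c \<noteq> 0\<close> by (intro always_eventually allI finite_measure_mono) auto
qed auto

text \<open>
With \<open>D = 1 - \<tau>\<^sup>2\<close> one has \<open>(1 - \<theta>\<^sup>2) (1 - \<rho>\<^sup>2) = (1 + b)\<^sup>2 D\<close>, and all quantities become rational in
\<open>b\<close>, \<open>\<tau>\<close>, \<open>D\<close> and \<open>v\<close>. The numbers \<open>c\<close> and \<open>d\<close> are the coefficients of the two normalised scores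
in the linearisation of \<open>p\<close> times the first plus \<open>q\<close> times the second normalised error.
\<close>
lemma asymptotic_variance_identity:
  fixes \<theta> \<rho> v p q :: real
  assumes pos: "0 < 1 + \<theta> * \<rho>" "0 < 1 - \<theta> * \<rho>" "0 < 1 - \<theta>\<^sup>2" "0 < 1 - \<rho>\<^sup>2" "0 < v"
  defines "b \<equiv> \<theta> * \<rho>" and "\<tau> \<equiv> (\<theta> + \<rho>) / (1 + \<theta> * \<rho>)"
  defines "l \<equiv> (1 + b) * v / ((1 - b) * ((1 - \<theta>\<^sup>2) * (1 - \<rho>\<^sup>2)))"
  defines "c \<equiv> p / ((1 + b) * l) + q * (\<tau>\<^sup>2 + b) / ((1 + b) * l * (1 - \<tau>\<^sup>2))"
    and "d \<equiv> - (q * \<tau>) / (l * (1 - \<tau>\<^sup>2))"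
  shows "0 < l" and "0 < 1 - \<tau>\<^sup>2"
    and "v * ((c\<^sup>2 + d\<^sup>2 + 2 * c * d * \<tau>) * l) =
      p\<^sup>2 * var_theta \<theta> \<rho> + 2 * p * q * (b * var_theta \<theta> \<rho>) + q\<^sup>2 * var_rho \<theta> \<rho>"
    and "0 \<le> (c\<^sup>2 + d\<^sup>2 + 2 * c * d * \<tau>) * l"
proof -
  have b: "0 < 1 + b" "0 < 1 - b" using pos by (auto simp: b_def)
  define D where "D = 1 - \<tau>\<^sup>2"
  have a: "\<theta> + \<rho> = (1 + b) * \<tau>" using b by (simp add: \<tau>_def b_def)
  have prod: "(1 - \<theta>\<^sup>2) * (1 - \<rho>\<^sup>2) = (1 + b)\<^sup>2 * D"
  proof -
    have "(1 - \<theta>\<^sup>2) * (1 - \<rho>\<^sup>2) = (1 + b)\<^sup>2 - (\<theta> + \<rho>)\<^sup>2"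
      by (simp add: b_def power2_eq_square algebra_simps)
    then show ?thesis unfolding a D_def by (simp add: power2_eq_square algebra_simps)
  qed
  have "0 < (1 + b)\<^sup>2 * D" unfolding prod[symmetric] using pos by simp
  then have D: "0 < D" using b by (simp add: zero_less_mult_iff)
  then show "0 < 1 - \<tau>\<^sup>2" by (simp add: D_def)
  have l: "l = v / ((1 - b) * (1 + b) * D)"
    unfolding l_def prod using b by (simp add: power2_eq_square)
  then show "0 < l" using b D pos by simp
  define w where "w = (1 - b) * D / (1 + b)"
  have vt: "var_theta \<theta> \<rho> = w"
  proof -
    have "var_theta \<theta> \<rho> = ((1 - \<theta>\<^sup>2) * (1 - \<rho>\<^sup>2)) * (1 - b) / (1 + b) ^ 3"
      by (simp add: var_theta_def b_def mult_ac)
    also have "\<dots> = w" unfolding prod w_def using b by (simp add: power2_eq_square power3_eq_cube)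
    finally show ?thesis .
  qed
  have vr: "var_rho \<theta> \<rho> = (1 - b) / (1 + b) * ((1 + b)\<^sup>2 * \<tau>\<^sup>2 + b\<^sup>2 * D)"
  proof -
    have "var_rho \<theta> \<rho> = (1 - b) / (1 + b) ^ 3 * ((\<theta> + \<rho>)\<^sup>2 * (1 + b)\<^sup>2 + b\<^sup>2 * ((1 - \<theta>\<^sup>2) * (1 - \<rho>\<^sup>2)))"
      by (simp add: var_rho_def b_def mult_ac)
    also have "\<dots> = (1 - b) / (1 + b) ^ 3 * ((1 + b)\<^sup>2 * ((1 + b)\<^sup>2 * \<tau>\<^sup>2 + b\<^sup>2 * D))"
    proof -
      have "(\<theta> + \<rho>)\<^sup>2 * (1 + b)\<^sup>2 + b\<^sup>2 * ((1 - \<theta>\<^sup>2) * (1 - \<rho>\<^sup>2)) = (1 + b)\<^sup>2 * ((1 + b)\<^sup>2 * \<tau>\<^sup>2 + b\<^sup>2 * D)"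
        unfolding prod a by (simp add: power2_eq_square algebra_simps)
      then show ?thesis by (rule arg_cong)
    qed
    also have "\<dots> = (1 - b) / (1 + b) * ((1 + b)\<^sup>2 * \<tau>\<^sup>2 + b\<^sup>2 * D)"
      using b by (simp add: power2_eq_square power3_eq_cube)
    finally show ?thesis .
  qed
  define \<alpha> where "\<alpha> = p * D + q * (\<tau>\<^sup>2 + b)"
  define \<beta> where "\<beta> = - (q * \<tau> * (1 + b))"
  have cd: "c = \<alpha> * ((1 - b) / v)" "d = \<beta> * ((1 - b) / v)"
  proof -
    have l1: "(1 + b) * l = v / ((1 - b) * D)" and l2: "l * D = v / ((1 - b) * (1 + b))"
      unfolding l using b D by simp_all
    have "c = p / (v / ((1 - b) * D)) + q * (\<tau>\<^sup>2 + b) / (v / ((1 - b) * D) * D)"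
      unfolding c_def D_def[symmetric] l1 ..
    also have "v / ((1 - b) * D) * D = v / (1 - b)" using D by simp
    finally show "c = \<alpha> * ((1 - b) / v)" by (simp add: \<alpha>_def divide_inverse algebra_simps)
    have "d = - (q * \<tau>) / (v / ((1 - b) * (1 + b)))"
      unfolding d_def D_def[symmetric] l2 ..
    then show "d = \<beta> * ((1 - b) / v)" by (simp add: \<beta>_def mult_ac)
  qed
  have "v * ((c\<^sup>2 + d\<^sup>2 + 2 * c * d * \<tau>) * l) = (\<alpha>\<^sup>2 + \<beta>\<^sup>2 + 2 * \<alpha> * \<beta> * \<tau>) * (v * ((1 - b) / v)\<^sup>2 * l)"
  proof -
    have "v * (((\<alpha> * k)\<^sup>2 + (\<beta> * k)\<^sup>2 + 2 * (\<alpha> * k) * (\<beta> * k) * \<tau>) * l)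
        = (\<alpha>\<^sup>2 + \<beta>\<^sup>2 + 2 * \<alpha> * \<beta> * \<tau>) * (v * k\<^sup>2 * l)" for k
      by (simp add: power2_eq_square algebra_simps)
    then show ?thesis unfolding cd .
  qed
  also have "v * ((1 - b) / v)\<^sup>2 * l = (1 - b) / ((1 + b) * D)"
    unfolding l using b D pos by (simp add: power2_eq_square)
  also have "\<alpha>\<^sup>2 + \<beta>\<^sup>2 + 2 * \<alpha> * \<beta> * \<tau> = D * (p\<^sup>2 * D + 2 * p * q * (b * D) + q\<^sup>2 * ((1 + b)\<^sup>2 * \<tau>\<^sup>2 + b\<^sup>2 * D))"
    unfolding \<alpha>_def \<beta>_def D_def by (simp add: power2_eq_square algebra_simps)
  also have "\<dots> * ((1 - b) / ((1 + b) * D)) =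
     p\<^sup>2 * w + 2 * p * q * (b * w) + q\<^sup>2 * ((1 - b) / (1 + b) * ((1 + b)\<^sup>2 * \<tau>\<^sup>2 + b\<^sup>2 * D))"
  proof -
    define k where "k = (1 - b) / (1 + b)"
    have "D * Z * ((1 - b) / ((1 + b) * D)) = Z * k" for Z using D by (simp add: k_def)
    moreover have "w = k * D" by (simp add: w_def k_def)
    moreover have "(p\<^sup>2 * D + 2 * p * q * (b * D) + q\<^sup>2 * E) * k = p\<^sup>2 * (k * D) + 2 * p * q * (b * (k * D)) + q\<^sup>2 * (k * E)" for E
      by (simp add: algebra_simps)
    ultimately show ?thesis unfolding k_def[symmetric] by simp
  qed
  finally show "v * ((c\<^sup>2 + d\<^sup>2 + 2 * c * d * \<tau>) * l) =
      p\<^sup>2 * var_theta \<theta> \<rho> + 2 * p * q * (b * var_theta \<theta> \<rho>) + q\<^sup>2 * var_rho \<theta> \<rho>" unfolding vt vr .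
  have "c\<^sup>2 + d\<^sup>2 + 2 * c * d * \<tau> = (c + d * \<tau>)\<^sup>2 + d\<^sup>2 * D"
    by (simp add: D_def power2_eq_square algebra_simps)
  then show "0 \<le> (c\<^sup>2 + d\<^sup>2 + 2 * c * d * \<tau>) * l" using \<open>0 < l\<close> D by simp
qed

context correlated_ar_path
begin

lemma estimators_measurable [measurable]:
  "(\<lambda>\<omega>. theta_hat (\<lambda>k. X k \<omega>) n) \<in> borel_measurable M"
  "(\<lambda>\<omega>. rho_hat (\<lambda>k. X k \<omega>) n) \<in> borel_measurable M"
proof -
  show [measurable]: "(\<lambda>\<omega>. theta_hat (\<lambda>k. X k \<omega>) n) \<in> borel_measurable M"
    unfolding theta_hat_def by measurable
  have [measurable]: "(\<lambda>\<omega>. residual (\<lambda>k. X k \<omega>) n k) \<in> borel_measurable M" for k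
    unfolding residual_def by measurable
  show "(\<lambda>\<omega>. rho_hat (\<lambda>k. X k \<omega>) n) \<in> borel_measurable M"
    unfolding rho_hat_def by measurable
qed

text \<open>
In the exact expansion every random quantity other than the scores is replaced by its limit in
probability.
\<close>
lemma estimators_linearization:
  fixes p q :: real
  assumes "0 < v"
  defines "b \<equiv> \<theta> * \<rho>" and "\<tau> \<equiv> (\<theta> + \<rho>) / (1 + \<theta> * \<rho>)"
  defines "c \<equiv> p / ((1 + b) * ell) + q * (\<tau>\<^sup>2 + b) / ((1 + b) * ell * (1 - \<tau>\<^sup>2))"
    and "d \<equiv> - (q * \<tau>) / (ell * (1 - \<tau>\<^sup>2))"
  shows "negligible_seq (\<lambda>n \<omega>.
    (p * (sqrt (real n) * (theta_hat (\<lambda>k. X k \<omega>) n - \<tau>)) + q * (sqrt (real n) * (rho_hat (\<lambda>k. X k \<omega>) n - b * \<tau>)))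
    - (c * score1 X n \<omega> + d * score2 X n \<omega>))"
proof -
  define a where "a = \<theta> + \<rho>"
  have \<tau>: "\<tau> = a / (1 + b)" by (simp add: \<tau>_def a_def b_def)
  define h where "h n = inverse (sqrt (real n))" for n :: nat
  have h: "h \<longlonglongrightarrow> 0" unfolding h_def by real_asymp
  define s where "s n \<omega> = (\<Sum>k<n. (X k \<omega>)\<^sup>2) / real n" for n \<omega>
  define A where "A n \<omega> = score1 X n \<omega>" for n \<omega>
  define B where "B n \<omega> = score2 X n \<omega>" for n \<omega>
  define e0 where "e0 n \<omega> = (X 1 \<omega> * X 0 \<omega> - a * (X 0 \<omega> * X 0 \<omega>)) / sqrt (real n)" for n \<omega>
  define e1 where "e1 n \<omega> = (X n \<omega> * X (n - 1) \<omega>) / sqrt (real n)" for n \<omega>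
  define e2 where "e2 n \<omega> = (X (n - 1) \<omega> * X (n - 1) \<omega>) / sqrt (real n)" for n \<omega>
  define \<mu> where "\<mu> n \<omega> = (A n \<omega> + e0 n \<omega> + b * e1 n \<omega>) / (1 + b)" for n \<omega>
  define \<nu> where "\<nu> n \<omega> = B n \<omega> + b * e2 n \<omega> - a * e1 n \<omega>" for n \<omega>
  define G where "G n \<omega> = \<mu> n \<omega> * inverse (s n \<omega>)" for n \<omega>
  (* The estimator of theta wherever s is nonzero; unlike it, t is within a negligible error of
     tau by construction. *)
  define t where "t n \<omega> = \<tau> + h n * G n \<omega>" for n \<omega>
  define r where "r n \<omega> = 2 * t n \<omega> * e1 n \<omega> - (t n \<omega>)\<^sup>2 * e2 n \<omega>" for n \<omega>
  define D where "D n \<omega> = s n \<omega> * (1 - (t n \<omega>)\<^sup>2) + h n * r n \<omega>" for n \<omega>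
  define N where "N n \<omega> = \<mu> n \<omega> * ((t n \<omega>)\<^sup>2 + b) - t n \<omega> * \<nu> n \<omega> - (t n \<omega>)\<^sup>2 * e1 n \<omega> - b * \<tau> * r n \<omega>" for n \<omega>

  have ell: "ell = (1 + b) * v / ((1 - b) * ((1 - \<theta>\<^sup>2) * (1 - \<rho>\<^sup>2)))"
    unfolding ell_def b_def parameters(4) ..
  have "0 < ell" "0 < 1 - \<tau>\<^sup>2"
    using asymptotic_variance_identity(1,2)[OF parameters(2,3,5,6) \<open>0 < v\<close>]
    by (simp_all add: ell b_def \<tau>_def)
  have b1: "1 + b \<noteq> 0" using parameters(2) by (simp add: b_def)

  have s: "negligible_seq (\<lambda>n \<omega>. s n \<omega> - ell)"
    unfolding s_def ell_def by (rule ar2_sum_squares_lln[OF X_rec X_tight X_score_tight ab])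
  have [measurable]: "s n \<in> borel_measurable M" for n
    using tight_seq_measurable[OF tight_seq_of_negligible_diff[OF s]] .
  have A: "tight_seq A" and B: "tight_seq B" unfolding A_def B_def by (rule X_score_tight)+
  have e: "negligible_seq e0" "negligible_seq e1" "negligible_seq e2"
  proof -
    have Xc: "tight_seq (\<lambda>n. X j)" for j by (rule tight_seq_constant) simp
    have "negligible_seq (\<lambda>n \<omega>. h n * (X 1 \<omega> * X 0 \<omega> - a * (X 0 \<omega> * X 0 \<omega>)))"
      "negligible_seq (\<lambda>n \<omega>. h n * (X n \<omega> * X (n - 1) \<omega>))"
      "negligible_seq (\<lambda>n \<omega>. h n * (X (n - 1) \<omega> * X (n - 1) \<omega>))"
      by (intro null_mult_tight h tight_seq_diff tight_seq_mult tight_seq_const X_tight tight_seq_pred[OF X_tight] Xc)+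
    then show "negligible_seq e0" "negligible_seq e1" "negligible_seq e2"
      unfolding e0_def e1_def e2_def h_def by (simp_all add: divide_inverse mult.commute)
  qed
  note e_tight = e[THEN negligible_imp_tight]
  have \<mu>: "negligible_seq (\<lambda>n \<omega>. \<mu> n \<omega> - A n \<omega> / (1 + b))"
  proof -
    have "negligible_seq (\<lambda>n \<omega>. inverse (1 + b) * (e0 n \<omega> + b * e1 n \<omega>))"
      by (intro negligible_seq_cmult negligible_seq_add e)
    then show ?thesis by (simp add: \<mu>_def divide_inverse algebra_simps)
  qed
  have A': "tight_seq (\<lambda>n \<omega>. A n \<omega> / (1 + b))"
    using tight_seq_mult[OF tight_seq_const[of "inverse (1 + b)"] A] by (simp add: divide_inverse mult.commute)
  have \<mu>_tight: "tight_seq \<mu>"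
    using tight_seq_add[OF negligible_imp_tight[OF \<mu>] A'] by simp
  have \<nu>: "negligible_seq (\<lambda>n \<omega>. \<nu> n \<omega> - B n \<omega>)"
  proof -
    have "negligible_seq (\<lambda>n \<omega>. b * e2 n \<omega> - a * e1 n \<omega>)"
      by (intro negligible_seq_cmult negligible_seq_diff e)
    then show ?thesis by (simp add: \<nu>_def algebra_simps)
  qed
  have \<nu>_tight: "tight_seq \<nu>"
    using tight_seq_add[OF negligible_imp_tight[OF \<nu>] B] by simp
  have s_inv: "negligible_seq (\<lambda>n \<omega>. inverse (s n \<omega>) - inverse ell)"
    using \<open>0 < ell\<close> by (intro negligible_seq_inverse[OF s]) simp
  note s_inv_tight = tight_seq_of_negligible_diff[OF s_inv]
  have G: "negligible_seq (\<lambda>n \<omega>. G n \<omega> - A n \<omega> / (1 + b) * inverse ell)"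
    unfolding G_def by (rule negligible_seq_mult_limit[OF \<mu> s_inv A' s_inv_tight])
  have G_tight: "tight_seq G" unfolding G_def by (rule tight_seq_mult[OF \<mu>_tight s_inv_tight])
  have t: "negligible_seq (\<lambda>n \<omega>. t n \<omega> - \<tau>)"
    using null_mult_tight[OF h G_tight] by (simp add: t_def)
  note t_tight = tight_seq_of_negligible_diff[OF t]
  have t2: "negligible_seq (\<lambda>n \<omega>. (t n \<omega>)\<^sup>2 - \<tau>\<^sup>2)"
    using negligible_seq_mult_limit[OF t t tight_seq_const t_tight] by (simp add: power2_eq_square)
  note t2_tight = tight_seq_of_negligible_diff[OF t2]
  have r: "negligible_seq r"
  proof -
    have "negligible_seq (\<lambda>n \<omega>. (2 * t n \<omega>) * e1 n \<omega> - (t n \<omega>)\<^sup>2 * e2 n \<omega>)"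
      by (intro negligible_seq_diff tight_mult_negligible tight_seq_mult tight_seq_const t_tight t2_tight e)
    then show ?thesis by (simp add: r_def[abs_def])
  qed
  have D: "negligible_seq (\<lambda>n \<omega>. D n \<omega> - ell * (1 - \<tau>\<^sup>2))"
  proof -
    have t2': "negligible_seq (\<lambda>n \<omega>. (1 - (t n \<omega>)\<^sup>2) - (1 - \<tau>\<^sup>2))"
      using negligible_seq_uminus[OF t2] by simp
    have "negligible_seq (\<lambda>n \<omega>. (s n \<omega> * (1 - (t n \<omega>)\<^sup>2) - ell * (1 - \<tau>\<^sup>2)) + h n * r n \<omega>)"
      by (intro negligible_seq_add negligible_seq_mult_limit[OF s t2'] tight_seq_const tight_seq_diff t2_tight
          null_mult_tight h negligible_imp_tight[OF r])
    then show ?thesis by (simp add: D_def algebra_simps)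
  qed
  have [measurable]: "D n \<in> borel_measurable M" for n
    using tight_seq_measurable[OF tight_seq_of_negligible_diff[OF D]] .
  have D_inv: "negligible_seq (\<lambda>n \<omega>. inverse (D n \<omega>) - inverse (ell * (1 - \<tau>\<^sup>2)))"
    using \<open>0 < ell\<close> \<open>0 < 1 - \<tau>\<^sup>2\<close> by (intro negligible_seq_inverse[OF D]) simp
  define N' where "N' n \<omega> = A n \<omega> / (1 + b) * (\<tau>\<^sup>2 + b) - \<tau> * B n \<omega>" for n \<omega>
  have N: "negligible_seq (\<lambda>n \<omega>. N n \<omega> - N' n \<omega>)"
  proof -
    have t2b: "negligible_seq (\<lambda>n \<omega>. ((t n \<omega>)\<^sup>2 + b) - (\<tau>\<^sup>2 + b))" using t2 by simp
    have "negligible_seq (\<lambda>n \<omega>. (\<mu> n \<omega> * ((t n \<omega>)\<^sup>2 + b) - A n \<omega> / (1 + b) * (\<tau>\<^sup>2 + b))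
       - (t n \<omega> * \<nu> n \<omega> - \<tau> * B n \<omega>) - (t n \<omega>)\<^sup>2 * e1 n \<omega> - b * \<tau> * r n \<omega>)"
      by (intro negligible_seq_diff negligible_seq_mult_limit[OF \<mu> t2b] negligible_seq_mult_limit[OF t \<nu>]
          A' \<nu>_tight tight_seq_const tight_seq_add t2_tight tight_mult_negligible e negligible_seq_cmult r)
    then show ?thesis by (simp add: N_def N'_def algebra_simps)
  qed
  have N'_tight: "tight_seq N'"
    unfolding N'_def by (intro tight_seq_diff tight_seq_mult A' B tight_seq_const)
  have ND: "negligible_seq (\<lambda>n \<omega>. N n \<omega> * inverse (D n \<omega>) - N' n \<omega> * inverse (ell * (1 - \<tau>\<^sup>2)))"
    by (rule negligible_seq_mult_limit[OF N D_inv N'_tight tight_seq_of_negligible_diff[OF D_inv]])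

  let ?Z = "\<lambda>n \<omega>. (p * (sqrt (real n) * (theta_hat (\<lambda>k. X k \<omega>) n - \<tau>)) + q * (sqrt (real n) * (rho_hat (\<lambda>k. X k \<omega>) n - b * \<tau>)))
    - (c * A n \<omega> + d * B n \<omega>)"
  have "negligible_seq (\<lambda>n \<omega>. p * (G n \<omega> - A n \<omega> / (1 + b) * inverse ell)
      + q * (N n \<omega> * inverse (D n \<omega>) - N' n \<omega> * inverse (ell * (1 - \<tau>\<^sup>2))))"
    by (intro negligible_seq_add negligible_seq_cmult G ND)
  moreover define j where "j = inverse (ell * (1 - \<tau>\<^sup>2))"
  have c_j: "c = p * (inverse (1 + b) * inverse ell) + q * (\<tau>\<^sup>2 + b) * (inverse (1 + b) * j)"
    and d_j: "d = - (q * \<tau>) * j"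
    by (simp_all add: c_def d_def j_def divide_inverse mult.assoc)
  have "p * (G n \<omega> - A n \<omega> / (1 + b) * inverse ell)
      + q * (N n \<omega> * inverse (D n \<omega>) - N' n \<omega> * inverse (ell * (1 - \<tau>\<^sup>2)))
     = (p * G n \<omega> + q * (N n \<omega> * inverse (D n \<omega>))) - (c * A n \<omega> + d * B n \<omega>)" for n \<omega>
    unfolding c_j d_j N'_def j_def[symmetric] by (simp add: divide_inverse algebra_simps)
  ultimately have lin: "negligible_seq (\<lambda>n \<omega>. (p * G n \<omega> + q * (N n \<omega> * inverse (D n \<omega>))) - (c * A n \<omega> + d * B n \<omega>))"
    by simp
  have "negligible_seq ?Z"
  proof (rule negligible_seq_transfer[OF lin, where A="\<lambda>n \<omega>. s n \<omega> = 0 \<or> D n \<omega> = 0"])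
    note [measurable] = tight_seq_measurable[OF A] tight_seq_measurable[OF B]
    show "?Z n \<in> borel_measurable M" for n by measurable
    show "Measurable.pred M (\<lambda>\<omega>. s n \<omega> = 0 \<or> D n \<omega> = 0)" for n by measurable
    show "(\<lambda>n. prob {\<omega>\<in>space M. s n \<omega> = 0 \<or> D n \<omega> = 0}) \<longlonglongrightarrow> 0"
    proof (rule tendsto_sandwich[where f="\<lambda>_. 0"])
      let ?p = "\<lambda>n. prob {\<omega>\<in>space M. s n \<omega> = 0} + prob {\<omega>\<in>space M. D n \<omega> = 0}"
      have "?p \<longlonglongrightarrow> 0 + 0"
        using \<open>0 < ell\<close> \<open>0 < 1 - \<tau>\<^sup>2\<close>
        by (intro tendsto_add prob_vanishing_null[OF s] prob_vanishing_null[OF D]) auto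
      then show "?p \<longlonglongrightarrow> 0" by simp
      have "prob {\<omega>\<in>space M. s n \<omega> = 0 \<or> D n \<omega> = 0} \<le> ?p n" for n
        by (rule prob_le_add) measurable
      then show "\<forall>\<^sub>F n in sequentially. prob {\<omega>\<in>space M. s n \<omega> = 0 \<or> D n \<omega> = 0} \<le> ?p n"
        by simp
    qed auto
    fix n \<omega> assume \<omega>: "\<omega> \<in> space M" and ok: "\<not> (s n \<omega> = 0 \<or> D n \<omega> = 0)"
    then have "n \<noteq> 0" by (auto simp: s_def)
    then obtain m where n: "n = Suc m" using not0_implies_Suc by blast
    note exact = estimators_exact_expansion[of "\<lambda>k. X k \<omega>" a b "\<lambda>k. V k \<omega>" n m,
        OF X_rec[OF \<omega>, folded a_def b_def] b1 n,
        folded s_def A_def B_def e0_def e1_def e2_def, folded \<mu>_def \<nu>_def, folded \<tau>]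
    have "sqrt (real n) * (theta_hat (\<lambda>k. X k \<omega>) n - \<tau>) = G n \<omega>"
      using exact(1) ok by (simp add: G_def)
    moreover have th: "theta_hat (\<lambda>k. X k \<omega>) n = t n \<omega>"
    proof -
      have "inverse (sqrt (real n)) * (sqrt (real n) * y) = y" for y
        using \<open>n \<noteq> 0\<close> by (simp flip: mult.assoc)
      note cancel = this
      show ?thesis unfolding t_def h_def calculation[symmetric] cancel by simp
    qed
    moreover have "sqrt (real n) * (rho_hat (\<lambda>k. X k \<omega>) n - b * \<tau>) = N n \<omega> * inverse (D n \<omega>)"
      using exact(2) ok unfolding th by (simp add: N_def D_def r_def h_def)
    ultimately show "?Z n \<omega> = (p * G n \<omega> + q * (N n \<omega> * inverse (D n \<omega>))) - (c * A n \<omega> + d * B n \<omega>)"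
      by simp
  qed
  then show ?thesis unfolding A_def B_def .
qed

lemma estimators_char_limit:
  fixes p q :: real
  assumes "0 < v"
  shows "(\<lambda>n. \<integral>\<omega>. iexp (p * (sqrt (real n) * (theta_hat (\<lambda>k. X k \<omega>) n - theta_star \<theta> \<rho>))
        + q * (sqrt (real n) * (rho_hat (\<lambda>k. X k \<omega>) n - rho_star \<theta> \<rho>))) \<partial>M)
    \<longlonglongrightarrow> exp (- ((p\<^sup>2 * var_theta \<theta> \<rho> + 2 * p * q * (\<theta> * \<rho> * var_theta \<theta> \<rho>) + q\<^sup>2 * var_rho \<theta> \<rho>) / 2))"
proof -
  define b where "b = \<theta> * \<rho>"
  define \<tau> where "\<tau> = (\<theta> + \<rho>) / (1 + \<theta> * \<rho>)"
  define c where "c = p / ((1 + b) * ell) + q * (\<tau>\<^sup>2 + b) / ((1 + b) * ell * (1 - \<tau>\<^sup>2))"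
  define d where "d = - (q * \<tau>) / (ell * (1 - \<tau>\<^sup>2))"
  have ell: "ell = (1 + \<theta> * \<rho>) * v / ((1 - \<theta> * \<rho>) * ((1 - \<theta>\<^sup>2) * (1 - \<rho>\<^sup>2)))"
    unfolding ell_def parameters(4) ..
  note var = asymptotic_variance_identity(3,4)[OF parameters(2,3,5,6) \<open>0 < v\<close>, of p q,
      folded ell \<tau>_def b_def, folded c_def d_def]
  have stars: "theta_star \<theta> \<rho> = \<tau>" "rho_star \<theta> \<rho> = b * \<tau>"
    by (simp_all add: theta_star_def rho_star_def \<tau>_def b_def)
  show ?thesis unfolding stars var(1)[unfolded b_def, symmetric]
    unfolding b_def[symmetric]
    by (rule char_limit_negligible_diff[OF X_score_clt[of c d, folded \<tau>_def, OF var(2)] _ _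
         estimators_linearization[OF \<open>0 < v\<close>, of p q, folded b_def \<tau>_def, folded c_def d_def]])
       measurable
qed

end

lemma (in prob_space) char_of_distr:
  "f \<in> borel_measurable M \<Longrightarrow> char (distr M borel f) t = (\<integral>\<omega>. iexp (t * f \<omega>) \<partial>M)"
  unfolding char_def by (subst integral_distr) auto

theorem theorem3p2:
  fixes M :: "'a measure"
    and V X \<epsilon> :: "nat \<Rightarrow> 'a \<Rightarrow> real"
    and \<theta> \<rho> \<sigma> :: real
  assumes "prob_space M"
    and "\<bar>\<theta>\<bar> < 1" and "\<bar>\<rho>\<bar> < 1"
    and indep: "prob_space.indep_vars M (\<lambda>_. borel) V {1..}"
    and ident: "\<And>n. n \<ge> 1 \<Longrightarrow> distr M borel (V n) = distr M borel (V 1)"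
    and moment4: "\<And>n. n \<ge> 1 \<Longrightarrow> integrable M (\<lambda>\<omega>. (V n \<omega>) ^ 4)"
    and mean: "\<And>n. n \<ge> 1 \<Longrightarrow> prob_space.expectation M (V n) = 0"
    and var: "\<And>n. n \<ge> 1 \<Longrightarrow> prob_space.variance M (V n) = \<sigma>\<^sup>2"
    and "\<sigma>\<^sup>2 > 0"
    and "X 0 \<in> borel_measurable M" and "\<epsilon> 0 \<in> borel_measurable M"
    and X_rec: "\<And>n \<omega>. n \<ge> 1 \<Longrightarrow> \<omega> \<in> space M \<Longrightarrow> X n \<omega> = \<theta> * X (n - 1) \<omega> + \<epsilon> n \<omega>"
    and \<epsilon>_rec: "\<And>n \<omega>. n \<ge> 1 \<Longrightarrow> \<omega> \<in> space M \<Longrightarrow> \<epsilon> n \<omega> = \<rho> * \<epsilon> (n - 1) \<omega> + V n \<omega>"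
  shows "(\<exists>\<mu>. is_centered_gaussian (Gamma_mat \<theta> \<rho>) \<mu> \<and>
           converges_weakly
             (\<lambda>n. distr M borel (\<lambda>\<omega>. sqrt (real n) *\<^sub>R
                (vector [theta_hat (\<lambda>k. X k \<omega>) n - theta_star \<theta> \<rho>,
                         rho_hat (\<lambda>k. X k \<omega>) n - rho_star \<theta> \<rho>] :: real^2))) \<mu>) \<and>
         weak_conv_m
           (\<lambda>n. distr M borel (\<lambda>\<omega>. sqrt (real n) * (rho_hat (\<lambda>k. X k \<omega>) n - rho_star \<theta> \<rho>)))
           (centered_normal (var_rho \<theta> \<rho>))"
proof -
  interpret prob_space M by fact
  have V_square: "expectation (\<lambda>\<omega>. (V n \<omega>)\<^sup>2) = \<sigma>\<^sup>2" if "n \<ge> 1" for n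
    using var[OF that] mean[OF that] by simp
  interpret correlated_ar_path M V "\<sigma>\<^sup>2" \<theta> \<rho> X \<epsilon>
  proof unfold_locales
    show "X (Suc n) \<omega> = \<theta> * X n \<omega> + \<epsilon> (Suc n) \<omega>" if "\<omega> \<in> space M" for n \<omega>
      using X_rec[of "Suc n" \<omega>] that by simp
    show "\<epsilon> (Suc n) \<omega> = \<rho> * \<epsilon> n \<omega> + V (Suc n) \<omega>" if "\<omega> \<in> space M" for n \<omega>
      using \<epsilon>_rec[of "Suc n" \<omega>] that by simp
  qed (fact indep ident moment4 mean V_square assms)+
  let ?b = "\<theta> * \<rho>"
  let ?g1 = "\<lambda>n \<omega>. sqrt (real n) * (theta_hat (\<lambda>k. X k \<omega>) n - theta_star \<theta> \<rho>)"
  let ?g2 = "\<lambda>n \<omega>. sqrt (real n) * (rho_hat (\<lambda>k. X k \<omega>) n - rho_star \<theta> \<rho>)"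
  let ?Q = "\<lambda>p q. p\<^sup>2 * var_theta \<theta> \<rho> + 2 * p * q * (?b * var_theta \<theta> \<rho>) + q\<^sup>2 * var_rho \<theta> \<rho>"
  note lim = estimators_char_limit[OF \<open>\<sigma>\<^sup>2 > 0\<close>]
  have g_meas [measurable]: "?g1 n \<in> borel_measurable M" "?g2 n \<in> borel_measurable M" for n
    using estimators_measurable by measurable

  (* The limit covariance matrix is L * transpose L for the lower triangular matrix L with rows
     (alpha, 0) and (b * alpha, gamma). *)
  define \<alpha> where "\<alpha> = sqrt (var_theta \<theta> \<rho>)"
  define \<gamma> where "\<gamma> = sqrt ((1 - ?b) / (1 + ?b) * (\<theta> + \<rho>)\<^sup>2)"
  have vt: "0 \<le> var_theta \<theta> \<rho>" unfolding var_theta_def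
    using parameters by (intro divide_nonneg_nonneg mult_nonneg_nonneg) auto
  then have \<alpha>: "\<alpha>\<^sup>2 = var_theta \<theta> \<rho>" by (simp add: \<alpha>_def)
  have \<gamma>: "\<gamma>\<^sup>2 = (1 - ?b) / (1 + ?b) * (\<theta> + \<rho>)\<^sup>2"
    using parameters(2,3) by (simp add: \<gamma>_def)
  have vr: "var_rho \<theta> \<rho> = ?b\<^sup>2 * \<alpha>\<^sup>2 + \<gamma>\<^sup>2"
  proof -
    have "(1 - ?b) / (1 + ?b) ^ 3 * ((\<theta> + \<rho>)\<^sup>2 * (1 + ?b)\<^sup>2) = (1 - ?b) / (1 + ?b) * (\<theta> + \<rho>)\<^sup>2"
      using parameters(2) by (simp add: power2_eq_square power3_eq_cube)
    then show ?thesis unfolding \<alpha> \<gamma> var_rho_def var_theta_def distrib_left by simp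
  qed
  have Q: "?Q p q = (p * \<alpha> + q * (?b * \<alpha>))\<^sup>2 + (q * \<gamma>)\<^sup>2" for p q
    unfolding vr \<alpha>[symmetric] by (simp add: power2_eq_square algebra_simps)
  obtain \<mu> :: "(real^2) measure" where \<mu>: "prob_space \<mu>" "sets \<mu> = sets borel"
    and \<mu>_law: "\<And>t. distr \<mu> borel (\<lambda>x. t \<bullet> x) = centered_normal (?Q (t$1) (t$2))"
    using gaussian_plane_exists[of \<alpha> "?b * \<alpha>" \<gamma>] unfolding Q by blast
  have Gamma: "t \<bullet> (Gamma_mat \<theta> \<rho> *v t) = ?Q (t$1) (t$2)" for t
    by (simp add: Gamma_mat_def inner_vec_def sum_2 matrix_vector_mult_def power2_eq_square algebra_simps)
  have "transpose (Gamma_mat \<theta> \<rho>) = Gamma_mat \<theta> \<rho>"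
    by (simp add: Gamma_mat_def transpose_def vec_eq_iff forall_2)
  then have gaussian: "is_centered_gaussian (Gamma_mat \<theta> \<rho>) \<mu>"
    unfolding is_centered_gaussian_def Gamma using \<mu> \<mu>_law by (auto simp: Q)

  let ?Z = "\<lambda>n \<omega>. sqrt (real n) *\<^sub>R (vector [theta_hat (\<lambda>k. X k \<omega>) n - theta_star \<theta> \<rho>,
       rho_hat (\<lambda>k. X k \<omega>) n - rho_star \<theta> \<rho>] :: real^2)"
  have Z: "?Z n \<omega> = ?g1 n \<omega> *\<^sub>R axis 1 1 + ?g2 n \<omega> *\<^sub>R axis 2 1" for n \<omega>
    by (simp add: vec_eq_iff forall_2 axis_def)
  have Z_meas: "?Z n \<in> borel_measurable M" for n unfolding Z by measurable
  have "converges_weakly (\<lambda>n. distr M borel (?Z n)) \<mu>"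
  proof (rule cramer_wold)
    fix t :: "real^2"
    interpret \<mu>: prob_space \<mu> by fact
    have [measurable_cong]: "sets \<mu> = sets borel" by fact
    have "(\<integral>x. iexp (t \<bullet> x) \<partial>distr M borel (?Z n)) = (\<integral>\<omega>. iexp (t$1 * ?g1 n \<omega> + t$2 * ?g2 n \<omega>) \<partial>M)" for n
    proof -
      have "t \<bullet> ?Z n \<omega> = t$1 * ?g1 n \<omega> + t$2 * ?g2 n \<omega>" for \<omega>
        by (simp add: inner_vec_def sum_2)
      then show ?thesis using Z_meas by (subst integral_distr) (auto simp del: of_real_add of_real_mult)
    qed
    moreover have "(\<integral>x. iexp (t \<bullet> x) \<partial>\<mu>) = exp (- (?Q (t$1) (t$2) / 2))"
    proof -
      have "(\<integral>x. iexp (t \<bullet> x) \<partial>\<mu>) = char (distr \<mu> borel (\<lambda>x. t \<bullet> x)) 1"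
        unfolding char_def by (subst integral_distr) auto
      also have "\<dots> = exp (- (?Q (t$1) (t$2) / 2))"
      proof -
        have "0 \<le> ?Q (t$1) (t$2)" unfolding Q by simp
        moreover have "char (centered_normal w) 1 = exp (- (w / 2))" if "0 \<le> w" for w
          using char_centered_normal[OF that, of 1] by simp
        ultimately show ?thesis unfolding \<mu>_law by blast
      qed
      finally show ?thesis .
    qed
    ultimately show "(\<lambda>n. \<integral>x. iexp (t \<bullet> x) \<partial>distr M borel (?Z n)) \<longlonglongrightarrow> (\<integral>x. iexp (t \<bullet> x) \<partial>\<mu>)"
      using lim[of "t$1" "t$2"] by simp
  qed (use Z_meas \<mu> in \<open>auto intro: prob_space_distr\<close>)
  moreover have "weak_conv_m (\<lambda>n. distr M borel (?g2 n)) (centered_normal (var_rho \<theta> \<rho>))"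
  proof (rule levy_continuity)
    have "0 \<le> var_rho \<theta> \<rho>" by (simp add: vr)
    then show "real_distribution (centered_normal (var_rho \<theta> \<rho>))" by (rule centered_normal_real_distribution)
    show "real_distribution (distr M borel (?g2 n))" for n by (rule real_distribution_distr) simp
    show "(\<lambda>n. char (distr M borel (?g2 n)) t) \<longlonglongrightarrow> char (centered_normal (var_rho \<theta> \<rho>)) t" for t
      using lim[of 0 t] unfolding char_of_distr[OF g_meas(2)] char_centered_normal[OF \<open>0 \<le> var_rho \<theta> \<rho>\<close>]
      by (simp add: mult.commute)
  qed
  ultimately show ?thesis using gaussian by blast
qed

end
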